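(* Let $\mathbf{k}$ be a field of characteristic $\neq 2$, let $A$ be a (commutative) Poisson algebra over $\mathbf{k}$ and let $n\geq1$. Assume that $A^{\otimes n}$ is an integral domain, and let $\operatorname{Frac}(A^{\otimes n})$ be its fraction field, equipped with its Poisson structure. Let $(f_0,\ldots,f_n)$ be a linearly independent family of elements of $A$, and for $i=0,\ldots,n$ set $$\Delta_i^{\mathrm{class}}=[f_0,\ldots,\check f_i,\ldots,f_n]\in A^{\otimes n}.$$ Then $\Delta_0^{\mathrm{class}}$ is nonzero. Set $H_i^{\mathrm{class}}=\Delta_i^{\mathrm{class}}/\Delta_0^{\mathrm{class}}\in\operatorname{Frac}(A^{\otimes n})$. Then the family $(H_i^{\mathrm{class}})_{i=1,\ldots,n}$ is Poisson commutative: $\{H_i^{\mathrm{class}},H_j^{\mathrm{class}}\}=0$ for any pair $(i,j)$.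
   Context: For $g_1,\ldots,g_n\in A$, set $[g_1,\ldots,g_n]=\sum_{\sigma\in\mathfrak{S}_n}\epsilon(\sigma)\,g_{\sigma(1)}\otimes\cdots\otimes g_{\sigma(n)}\in A^{\otimes n}$, where $\epsilon(\sigma)$ is the sign of $\sigma$; $\check f_i$ means that $f_i$ is omitted. $A^{\otimes n}$ (tensor power over $\mathbf{k}$) carries the tensor product Poisson structure, in which each tensor factor is a Poisson subalgebra isomorphic to $A$ and distinct tensor factors Poisson commute. The Poisson structure of an integral Poisson algebra $B$ extends uniquely to $\operatorname{Frac}(B)$ (with $\{1/f,g\}=-\{f,g\}/f^2$); this is the Poisson structure used on $\operatorname{Frac}(A^{\otimes n})$. *)

theory Defs
  imports "HOL-Algebra.Module" "HOL-Algebra.QuotRing" "HOL-Algebra.Product_Groups"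
    "HOL-Combinatorics.Permutations"
begin

section \<open>Poisson algebras\<close>

record ('k, 'a) poisson = "('k, 'a) module" +
  pbracket :: "'a \<Rightarrow> 'a \<Rightarrow> 'a"  (\<open>\<lbrace>_,/ _\<rbrace>\<index>\<close>)

text \<open>
  Linearity in the second argument follows from linearity in the first one, because an
  alternating biadditive bracket is antisymmetric; it is listed for readability.
\<close>

locale poisson_algebra = R?: field K + algebra K A for K (structure) and A (structure) +
  assumes pbracket_closed:
      "\<lbrakk>a \<in> carrier A; b \<in> carrier A\<rbrakk> \<Longrightarrow> \<lbrace>a, b\<rbrace>\<^bsub>A\<^esub> \<in> carrier A"
    and pbracket_add_l:
      "\<lbrakk>a \<in> carrier A; b \<in> carrier A; c \<in> carrier A\<rbrakk> \<Longrightarrow>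
        \<lbrace>a \<oplus>\<^bsub>A\<^esub> b, c\<rbrace>\<^bsub>A\<^esub> = \<lbrace>a, c\<rbrace>\<^bsub>A\<^esub> \<oplus>\<^bsub>A\<^esub> \<lbrace>b, c\<rbrace>\<^bsub>A\<^esub>"
    and pbracket_add_r:
      "\<lbrakk>a \<in> carrier A; b \<in> carrier A; c \<in> carrier A\<rbrakk> \<Longrightarrow>
        \<lbrace>a, b \<oplus>\<^bsub>A\<^esub> c\<rbrace>\<^bsub>A\<^esub> = \<lbrace>a, b\<rbrace>\<^bsub>A\<^esub> \<oplus>\<^bsub>A\<^esub> \<lbrace>a, c\<rbrace>\<^bsub>A\<^esub>"
    and pbracket_smult_l:
      "\<lbrakk>r \<in> carrier K; a \<in> carrier A; b \<in> carrier A\<rbrakk> \<Longrightarrow>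
        \<lbrace>r \<odot>\<^bsub>A\<^esub> a, b\<rbrace>\<^bsub>A\<^esub> = r \<odot>\<^bsub>A\<^esub> \<lbrace>a, b\<rbrace>\<^bsub>A\<^esub>"
    and pbracket_smult_r:
      "\<lbrakk>r \<in> carrier K; a \<in> carrier A; b \<in> carrier A\<rbrakk> \<Longrightarrow>
        \<lbrace>a, r \<odot>\<^bsub>A\<^esub> b\<rbrace>\<^bsub>A\<^esub> = r \<odot>\<^bsub>A\<^esub> \<lbrace>a, b\<rbrace>\<^bsub>A\<^esub>"
    and pbracket_self:
      "a \<in> carrier A \<Longrightarrow> \<lbrace>a, a\<rbrace>\<^bsub>A\<^esub> = \<zero>\<^bsub>A\<^esub>"
    and pbracket_jacobi:
      "\<lbrakk>a \<in> carrier A; b \<in> carrier A; c \<in> carrier A\<rbrakk> \<Longrightarrow>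
        \<lbrace>a, \<lbrace>b, c\<rbrace>\<^bsub>A\<^esub>\<rbrace>\<^bsub>A\<^esub> \<oplus>\<^bsub>A\<^esub> \<lbrace>b, \<lbrace>c, a\<rbrace>\<^bsub>A\<^esub>\<rbrace>\<^bsub>A\<^esub> \<oplus>\<^bsub>A\<^esub> \<lbrace>c, \<lbrace>a, b\<rbrace>\<^bsub>A\<^esub>\<rbrace>\<^bsub>A\<^esub> = \<zero>\<^bsub>A\<^esub>"
    and pbracket_leibniz:
      "\<lbrakk>a \<in> carrier A; b \<in> carrier A; c \<in> carrier A\<rbrakk> \<Longrightarrow>
        \<lbrace>a \<otimes>\<^bsub>A\<^esub> b, c\<rbrace>\<^bsub>A\<^esub> = a \<otimes>\<^bsub>A\<^esub> \<lbrace>b, c\<rbrace>\<^bsub>A\<^esub> \<oplus>\<^bsub>A\<^esub> \<lbrace>a, c\<rbrace>\<^bsub>A\<^esub> \<otimes>\<^bsub>A\<^esub> b"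

definition lin_indep_family ::
    "('k, 'r) ring_scheme \<Rightarrow> ('k, 'a, 's) module_scheme \<Rightarrow> 'i set \<Rightarrow> ('i \<Rightarrow> 'a) \<Rightarrow> bool"
  where "lin_indep_family K A I f \<longleftrightarrow>
    f \<in> I \<rightarrow> carrier A \<and>
    (\<forall>J c. finite J \<and> J \<subseteq> I \<and> c \<in> J \<rightarrow> carrier K \<and> (\<Oplus>\<^bsub>A\<^esub>i\<in>J. c i \<odot>\<^bsub>A\<^esub> f i) = \<zero>\<^bsub>A\<^esub>
      \<longrightarrow> (\<forall>i\<in>J. c i = \<zero>\<^bsub>K\<^esub>))"


section \<open>Tensor powers\<close>

text \<open>
  \<open>A\<^sup>\<otimes>\<^sup>n\<close> is the free \<open>K\<close>-module on the set \<open>A\<^sup>n\<close> of tuples modulo the multilinearity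
  relations.  Componentwise multiplication of tuples makes this free module the monoid
  algebra \<open>K[A\<^sup>n]\<close>.  The product of a multilinearity relation with a basis element is again
  such a relation, so the ideal generated by the relations is their \<open>K\<close>-linear span.
\<close>

definition supp :: "('k, 'r) ring_scheme \<Rightarrow> ('m \<Rightarrow> 'k) \<Rightarrow> 'm set"
  where "supp K c = {x. c x \<noteq> \<zero>\<^bsub>K\<^esub>}"

definition monoid_algebra ::
    "('k, 'r) ring_scheme \<Rightarrow> ('m, 's) monoid_scheme \<Rightarrow> ('k, 'm \<Rightarrow> 'k) module"
  where "monoid_algebra K M =
    \<lparr>carrier = {c. range c \<subseteq> carrier K \<and> finite (supp K c) \<and> supp K c \<subseteq> carrier M},
     monoid.mult = (\<lambda>c d z. \<Oplus>\<^bsub>K\<^esub>x\<in>supp K c. \<Oplus>\<^bsub>K\<^esub>y\<in>supp K d.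
       if x \<otimes>\<^bsub>M\<^esub> y = z then c x \<otimes>\<^bsub>K\<^esub> d y else \<zero>\<^bsub>K\<^esub>),
     one = (\<lambda>z. if z = \<one>\<^bsub>M\<^esub> then \<one>\<^bsub>K\<^esub> else \<zero>\<^bsub>K\<^esub>),
     zero = (\<lambda>z. \<zero>\<^bsub>K\<^esub>),
     add = (\<lambda>c d z. c z \<oplus>\<^bsub>K\<^esub> d z),
     smult = (\<lambda>r c z. r \<otimes>\<^bsub>K\<^esub> c z)\<rparr>"

definition single :: "('k, 'r) ring_scheme \<Rightarrow> 'm \<Rightarrow> 'm \<Rightarrow> 'k"
  where "single K x = (\<lambda>z. if z = x then \<one>\<^bsub>K\<^esub> else \<zero>\<^bsub>K\<^esub>)"

abbreviation tuples :: "('a, 's) monoid_scheme \<Rightarrow> nat \<Rightarrow> (nat \<Rightarrow> 'a) monoid"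
  where "tuples A n \<equiv> product_group {1..n} (\<lambda>_. A)"

abbreviation free_power ::
    "('k, 'r) ring_scheme \<Rightarrow> ('k, 'a, 's) module_scheme \<Rightarrow> nat \<Rightarrow> ('k, (nat \<Rightarrow> 'a) \<Rightarrow> 'k) module"
  where "free_power K A n \<equiv> monoid_algebra K (tuples A n)"

definition multilinear_rels ::
    "('k, 'r) ring_scheme \<Rightarrow> ('k, 'a, 's) module_scheme \<Rightarrow> nat \<Rightarrow> ((nat \<Rightarrow> 'a) \<Rightarrow> 'k) set"
  where "multilinear_rels K A n =
    {single K (x(i := a \<oplus>\<^bsub>A\<^esub> b))
        \<ominus>\<^bsub>free_power K A n\<^esub> (single K (x(i := a)) \<oplus>\<^bsub>free_power K A n\<^esub> single K (x(i := b)))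
      | x i a b. x \<in> carrier (tuples A n) \<and> i \<in> {1..n} \<and> a \<in> carrier A \<and> b \<in> carrier A} \<union>
    {single K (x(i := r \<odot>\<^bsub>A\<^esub> a))
        \<ominus>\<^bsub>free_power K A n\<^esub> (r \<odot>\<^bsub>free_power K A n\<^esub> single K (x(i := a)))
      | x i r a. x \<in> carrier (tuples A n) \<and> i \<in> {1..n} \<and> r \<in> carrier K \<and> a \<in> carrier A}"

definition tensor_ideal ::
    "('k, 'r) ring_scheme \<Rightarrow> ('k, 'a, 's) module_scheme \<Rightarrow> nat \<Rightarrow> ((nat \<Rightarrow> 'a) \<Rightarrow> 'k) set"
  where "tensor_ideal K A n = Idl\<^bsub>free_power K A n\<^esub> (multilinear_rels K A n)"

text \<open>
  The requirements that each tensor factor is a Poisson subalgebra isomorphic to \<open>A\<close> and that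
  distinct factors Poisson commute force, by the Leibniz rule,
  \[ \{x_1 \otimes \cdots \otimes x_n, y_1 \otimes \cdots \otimes y_n\} =
     \sum_k x_1 y_1 \otimes \cdots \otimes \{x_k, y_k\} \otimes \cdots \otimes x_n y_n. \]
  This is first extended bilinearly to the free module and then passed to the quotient.
\<close>

definition free_bracket ::
    "('k, 'r) ring_scheme \<Rightarrow> ('k, 'a, 's) poisson_scheme \<Rightarrow> nat \<Rightarrow>
      ((nat \<Rightarrow> 'a) \<Rightarrow> 'k) \<Rightarrow> ((nat \<Rightarrow> 'a) \<Rightarrow> 'k) \<Rightarrow> ((nat \<Rightarrow> 'a) \<Rightarrow> 'k)"
  where "free_bracket K A n c d =
    (\<Oplus>\<^bsub>free_power K A n\<^esub>x\<in>supp K c. \<Oplus>\<^bsub>free_power K A n\<^esub>y\<in>supp K d.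
      \<Oplus>\<^bsub>free_power K A n\<^esub>k\<in>{1..n}.
      (c x \<otimes>\<^bsub>K\<^esub> d y) \<odot>\<^bsub>free_power K A n\<^esub>
        single K (\<lambda>i\<in>{1..n}. if i = k then \<lbrace>x i, y i\<rbrace>\<^bsub>A\<^esub> else x i \<otimes>\<^bsub>A\<^esub> y i))"

text \<open>
  As in \<^const>\<open>rcoset_mult\<close>, an operation on cosets is the union of the cosets of the results
  over all representatives.
\<close>

definition tensor_power ::
    "('k, 'r) ring_scheme \<Rightarrow> ('k, 'a, 's) poisson_scheme \<Rightarrow> nat \<Rightarrow>
      ('k, ((nat \<Rightarrow> 'a) \<Rightarrow> 'k) set) poisson"
  where "tensor_power K A n =
    (let F = free_power K A n; I = tensor_ideal K A n; Q = F Quot I in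
      \<lparr>carrier = carrier Q, monoid.mult = monoid.mult Q, one = one Q, zero = zero Q, add = add Q,
       smult = (\<lambda>r X. \<Union>c\<in>X. I +>\<^bsub>F\<^esub> (r \<odot>\<^bsub>F\<^esub> c)),
       pbracket = (\<lambda>X Y. \<Union>c\<in>X. \<Union>d\<in>Y. I +>\<^bsub>F\<^esub> free_bracket K A n c d)\<rparr>)"

definition pure_tensor ::
    "('k, 'r) ring_scheme \<Rightarrow> ('k, 'a, 's) poisson_scheme \<Rightarrow> nat \<Rightarrow> (nat \<Rightarrow> 'a) \<Rightarrow>
      ((nat \<Rightarrow> 'a) \<Rightarrow> 'k) set"
  where "pure_tensor K A n g =
    tensor_ideal K A n +>\<^bsub>free_power K A n\<^esub> single K (\<lambda>i\<in>{1..n}. g i)"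

definition alternator ::
    "('k, 'r) ring_scheme \<Rightarrow> ('k, 'a, 's) poisson_scheme \<Rightarrow> nat \<Rightarrow> (nat \<Rightarrow> 'a) \<Rightarrow>
      ((nat \<Rightarrow> 'a) \<Rightarrow> 'k) set"
  where "alternator K A n g =
    (\<Oplus>\<^bsub>tensor_power K A n\<^esub>\<sigma>\<in>{\<sigma>. \<sigma> permutes {1..n}}.
      [sign \<sigma>] \<cdot>\<^bsub>tensor_power K A n\<^esub> pure_tensor K A n (\<lambda>k. g (\<sigma> k)))"


section \<open>Fraction fields\<close>

definition fraction :: "('b, 's) ring_scheme \<Rightarrow> 'b \<Rightarrow> 'b \<Rightarrow> ('b \<times> 'b) set"
  where "fraction R a b =
    {(c, d). c \<in> carrier R \<and> d \<in> carrier R - {\<zero>\<^bsub>R\<^esub>} \<and> a \<otimes>\<^bsub>R\<^esub> d = c \<otimes>\<^bsub>R\<^esub> b}"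

text \<open>
  The bracket is the one determined by the Leibniz rule and \<open>{1/f, g} = - {f, g} / f\<^sup>2\<close>:
  \[ \{a/b, c/d\} = \frac{bd\{a,c\} - bc\{a,d\} - ad\{b,c\} + ac\{b,d\}}{b^2 d^2}. \]
\<close>

definition fraction_field :: "('k, 'b, 's) poisson_scheme \<Rightarrow> ('k, ('b \<times> 'b) set) poisson"
  where "fraction_field R =
    \<lparr>carrier = {fraction R a b | a b. a \<in> carrier R \<and> b \<in> carrier R - {\<zero>\<^bsub>R\<^esub>}},
     monoid.mult = (\<lambda>X Y. \<Union>(a, b)\<in>X. \<Union>(c, d)\<in>Y. fraction R (a \<otimes>\<^bsub>R\<^esub> c) (b \<otimes>\<^bsub>R\<^esub> d)),
     one = fraction R \<one>\<^bsub>R\<^esub> \<one>\<^bsub>R\<^esub>,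
     zero = fraction R \<zero>\<^bsub>R\<^esub> \<one>\<^bsub>R\<^esub>,
     add = (\<lambda>X Y. \<Union>(a, b)\<in>X. \<Union>(c, d)\<in>Y.
       fraction R (a \<otimes>\<^bsub>R\<^esub> d \<oplus>\<^bsub>R\<^esub> c \<otimes>\<^bsub>R\<^esub> b) (b \<otimes>\<^bsub>R\<^esub> d)),
     smult = (\<lambda>r X. \<Union>(a, b)\<in>X. fraction R (r \<odot>\<^bsub>R\<^esub> a) b),
     pbracket = (\<lambda>X Y. \<Union>(a, b)\<in>X. \<Union>(c, d)\<in>Y.
       fraction R
         ((b \<otimes>\<^bsub>R\<^esub> d) \<otimes>\<^bsub>R\<^esub> \<lbrace>a, c\<rbrace>\<^bsub>R\<^esub> \<ominus>\<^bsub>R\<^esub> (b \<otimes>\<^bsub>R\<^esub> c) \<otimes>\<^bsub>R\<^esub> \<lbrace>a, d\<rbrace>\<^bsub>R\<^esub>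
           \<ominus>\<^bsub>R\<^esub> (a \<otimes>\<^bsub>R\<^esub> d) \<otimes>\<^bsub>R\<^esub> \<lbrace>b, c\<rbrace>\<^bsub>R\<^esub> \<oplus>\<^bsub>R\<^esub> (a \<otimes>\<^bsub>R\<^esub> c) \<otimes>\<^bsub>R\<^esub> \<lbrace>b, d\<rbrace>\<^bsub>R\<^esub>)
         ((b \<otimes>\<^bsub>R\<^esub> b) \<otimes>\<^bsub>R\<^esub> (d \<otimes>\<^bsub>R\<^esub> d)))\<rparr>"


section \<open>The classical Hamiltonians\<close>

text \<open>\<open>f\<^sub>0, \<dots>, f\<^sub>n\<close> with \<open>f\<^sub>i\<close> omitted, reindexed by \<open>1, \<dots>, n\<close>.\<close>

definition omit :: "nat \<Rightarrow> (nat \<Rightarrow> 'a) \<Rightarrow> nat \<Rightarrow> 'a"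
  where "omit i f = (\<lambda>k. if k \<le> i then f (k - 1) else f k)"

definition Delta_class ::
    "('k, 'r) ring_scheme \<Rightarrow> ('k, 'a, 's) poisson_scheme \<Rightarrow> nat \<Rightarrow> (nat \<Rightarrow> 'a) \<Rightarrow> nat \<Rightarrow>
      ((nat \<Rightarrow> 'a) \<Rightarrow> 'k) set"
  where "Delta_class K A n f i = alternator K A n (omit i f)"

definition H_class ::
    "('k, 'r) ring_scheme \<Rightarrow> ('k, 'a, 's) poisson_scheme \<Rightarrow> nat \<Rightarrow> (nat \<Rightarrow> 'a) \<Rightarrow> nat \<Rightarrow>
      (((nat \<Rightarrow> 'a) \<Rightarrow> 'k) set \<times> ((nat \<Rightarrow> 'a) \<Rightarrow> 'k) set) set"
  where "H_class K A n f i =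
    fraction (tensor_power K A n) (Delta_class K A n f i) (Delta_class K A n f 0)"

end

theory Submission
  imports Defs
begin

text \<open>
  Write \<open>f\<^sup>(\<^sup>k\<^sup>)\<close> for the copy of \<open>f \<in> A\<close> in the \<open>k\<close>-th tensor factor, so that \<open>\<Delta>\<^sub>i\<close> is a minor of
  the matrix \<open>(f\<^sub>j\<^sup>(\<^sup>k\<^sup>))\<close> and, with suitable signs \<open>E\<^sub>i = \<plusminus> \<Delta>\<^sub>i\<close>, Cramer's rule gives \<open>\<Sum>\<^sub>i E\<^sub>i f\<^sub>i\<^sup>(\<^sup>k\<^sup>) = 0\<close>
  for every \<open>k\<close>.  Bracketing the \<open>k\<close>-th relation with the \<open>l\<close>-th one, and using that different
  factors Poisson commute (for \<open>k \<noteq> l\<close>) or that the bracket is alternating (for \<open>k = l\<close>), gives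
  \<open>\<Sum>\<^sub>i\<^sub>j {E\<^sub>i, E\<^sub>j} f\<^sub>i\<^sup>(\<^sup>k\<^sup>) f\<^sub>j\<^sup>(\<^sup>l\<^sup>) = 0\<close>.  After clearing denominators this is a relation
  \<open>F\<^sup>T P F = 0\<close>, where \<open>P\<close> contains the numerators of \<open>{H\<^sub>i, H\<^sub>j}\<close> and \<open>F\<close> is the square matrix with
  determinant \<open>\<Delta>\<^sub>0\<close>; hence \<open>P = 0\<close>.  That \<open>\<Delta>\<^sub>0 \<noteq> 0\<close> follows by applying \<open>\<phi>\<^sub>1 \<otimes> \<dots> \<otimes> \<phi>\<^sub>n\<close>, where
  the \<open>\<phi>\<^sub>i\<close> are linear functionals dual to \<open>f\<^sub>1, \<dots>, f\<^sub>n\<close>.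
\<close>

section \<open>Determinants over commutative rings\<close>

text \<open>The relations among the brackets of the \<open>E i\<close> run over \<open>n + 1\<close>
  indices, so the matrix in them is not square and they do not by themselves force
  \<open>{E i, E j} = 0\<close>. Passing to the quotients \<open>E i / E 0\<close> repairs this: up
  to a factor \<open>E 0\<close>, the numerator of their bracket is \<open>E 0 {E i, E j}\<close>
  corrected by two terms, and for each of these the double sum is a product with one of the linear
  relations as a factor. The correction keeps the equation but makes the row and the column of index
  0 vanish. Two obstacles come from the encoding. Operations on cosets and on fractions are unions
  over all representatives, so a bracket has a meaning only once every choice is known to give the
  same class; for the tensor power this says that \<open>free_bracket\<close> maps the tensor ideal
  into itself in either argument. And the bracket laws hold only modulo that ideal. Both are settled
  on monomials. For fractions, the point is that the numerator of the bracket vanishes for every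
  choice of representatives.\<close>

lemma (in comm_monoid) finprod_partition:
  assumes "finite P" "finite N" "h ` P \<subseteq> N" "t \<in> P \<rightarrow> carrier G"
  shows "finprod G t P = (\<Otimes>i\<in>N. finprod G t {x \<in> P. h x = i})"
proof -
  have "finprod G t (\<Union>i\<in>N. {x \<in> P. h x = i}) = (\<Otimes>i\<in>N. finprod G t {x \<in> P. h x = i})"
    by (rule finprod_UN_disjoint) (use assms in \<open>auto simp: pairwise_def disjnt_def\<close>)
  moreover have "(\<Union>i\<in>N. {x \<in> P. h x = i}) = P"
    using assms(3) by auto
  ultimately show ?thesis by simp
qed

lemma (in comm_monoid) finprod_swap:
  assumes "finite S" "finite T" "\<And>x y. x \<in> S \<Longrightarrow> y \<in> T \<Longrightarrow> g x y \<in> carrier G"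
  shows "(\<Otimes>x\<in>S. \<Otimes>y\<in>T. g x y) = (\<Otimes>y\<in>T. \<Otimes>x\<in>S. g x y)"
  using assms(1,3)
proof (induction S)
  case (insert s S)
  then have "(\<Otimes>x\<in>insert s S. \<Otimes>y\<in>T. g x y) = (\<Otimes>y\<in>T. g s y) \<otimes> (\<Otimes>y\<in>T. \<Otimes>x\<in>S. g x y)"
    by (simp add: Pi_def)
  also have "\<dots> = (\<Otimes>y\<in>T. g s y \<otimes> (\<Otimes>x\<in>S. g x y))"
    by (rule finprod_multf[symmetric]) (use insert in auto)
  also have "\<dots> = (\<Otimes>y\<in>T. \<Otimes>x\<in>insert s S. g x y)"
    by (rule finprod_cong') (use insert in \<open>auto simp: Pi_def\<close>)
  finally show ?case .
qed simp

lemmas (in abelian_monoid) finsum_partition = add.finprod_partition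
lemmas (in abelian_monoid) finsum_swap = add.finprod_swap

lemma (in abelian_group) finsum_minus:
  assumes "finite S" "g \<in> S \<rightarrow> carrier G"
  shows "(\<Oplus>x\<in>S. \<ominus> g x) = \<ominus> (\<Oplus>x\<in>S. g x)"
  using assms
proof (induction S)
  case empty
  show ?case by simp (metis add.inv_eq_1_iff zero_closed)
next
  case (insert s S)
  then show ?case by (simp add: Pi_def minus_add)
qed

lemma (in abelian_group) sign_add_pow:
  assumes "x \<in> carrier G"
  shows "[sign \<sigma>] \<cdot> x = (if sign \<sigma> = 1 then x else \<ominus> x)"
proof (cases \<sigma> rule: sign_cases)
  case even
  then show ?thesis using assms by (simp add: add.int_pow_1)
next
  case odd
  then show ?thesis using assms add.int_pow_neg[of x 1] by (simp add: add.int_pow_1)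
qed

text \<open>\<open>h\<close> exchanges even and odd permutations without changing \<open>t\<close>,
  so the two halves of the sum are opposite. Comparing the halves gives zero itself, whereas
  reindexing the whole sum \<open>S\<close> by \<open>h\<close> would only give
  \<open>S = - S\<close>.\<close>

lemma (in abelian_group) finsum_sign_cancel:
  assumes N: "finite N"
    and t: "\<And>\<sigma>. \<sigma> permutes N \<Longrightarrow> t \<sigma> \<in> carrier G"
    and h: "\<And>\<sigma>. \<sigma> permutes N \<Longrightarrow> h \<sigma> permutes N \<and> h (h \<sigma>) = \<sigma> \<and> sign (h \<sigma>) = - sign \<sigma> \<and> t (h \<sigma>) = t \<sigma>"
  shows "(\<Oplus>\<sigma>\<in>{\<sigma>. \<sigma> permutes N}. [sign \<sigma>] \<cdot> t \<sigma>) = \<zero>"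
proof -
  let ?E = "{\<sigma>. \<sigma> permutes N \<and> sign \<sigma> = 1}" and ?O = "{\<sigma>. \<sigma> permutes N \<and> sign \<sigma> \<noteq> 1}"
  have fin: "finite ?E" "finite ?O"
    using finite_permutations[OF N] by auto
  have OE: "?O = h ` ?E"
  proof
    show "?O \<subseteq> h ` ?E"
    proof
      fix \<sigma> assume "\<sigma> \<in> ?O"
      then have "\<sigma> permutes N" "sign \<sigma> = - 1" using sign_cases[of \<sigma>] by auto
      then show "\<sigma> \<in> h ` ?E" using h[of \<sigma>] by (intro image_eqI[of _ _ "h \<sigma>"]) auto
    qed
  qed (use h in auto)
  have inj: "inj_on h ?E"
    by (rule inj_on_inverseI[of _ h]) (use h in auto)
  have "(\<Oplus>\<sigma>\<in>{\<sigma>. \<sigma> permutes N}. [sign \<sigma>] \<cdot> t \<sigma>) = (\<Oplus>\<sigma>\<in>?E \<union> ?O. [sign \<sigma>] \<cdot> t \<sigma>)"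
    by (rule arg_cong[where f="finsum G _"]) auto
  also have "\<dots> = (\<Oplus>\<sigma>\<in>?E. [sign \<sigma>] \<cdot> t \<sigma>) \<oplus> (\<Oplus>\<sigma>\<in>?O. [sign \<sigma>] \<cdot> t \<sigma>)"
    by (rule finsum_Un_disjoint) (use fin t in auto)
  also have "(\<Oplus>\<sigma>\<in>?E. [sign \<sigma>] \<cdot> t \<sigma>) = (\<Oplus>\<sigma>\<in>?E. t \<sigma>)"
    by (rule finsum_cong') (use t in \<open>auto simp: sign_add_pow\<close>)
  also have "(\<Oplus>\<sigma>\<in>?O. [sign \<sigma>] \<cdot> t \<sigma>) = (\<Oplus>\<sigma>\<in>?O. \<ominus> t \<sigma>)"
    by (rule finsum_cong') (use t in \<open>auto simp: sign_add_pow\<close>)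
  also have "\<dots> = \<ominus> (\<Oplus>\<sigma>\<in>?O. t \<sigma>)"
    by (rule finsum_minus) (use fin t in auto)
  also have "(\<Oplus>\<sigma>\<in>?O. t \<sigma>) = (\<Oplus>\<sigma>\<in>?E. t (h \<sigma>))"
    unfolding OE by (rule finsum_reindex[OF _ inj]) (use t h in auto)
  also have "\<dots> = (\<Oplus>\<sigma>\<in>?E. t \<sigma>)"
    by (rule finsum_cong') (use t h in auto)
  finally show ?thesis
    using finsum_closed[of t ?E] t by (simp add: r_neg)
qed

text \<open>The permuted index is the row index: in \<open>alternator\<close> the tensor factor
  \<open>k\<close> holds \<open>g (\<sigma> k)\<close>, so the summands match without inverting
  \<open>\<sigma>\<close>.\<close>

definition leibniz_det :: "('a, 's) ring_scheme \<Rightarrow> 'i set \<Rightarrow> ('i \<Rightarrow> 'i \<Rightarrow> 'a) \<Rightarrow> 'a"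
  where "leibniz_det R N M =
    (\<Oplus>\<^bsub>R\<^esub>\<sigma>\<in>{\<sigma>. \<sigma> permutes N}. [sign \<sigma>] \<cdot>\<^bsub>R\<^esub> (\<Otimes>\<^bsub>R\<^esub>k\<in>N. M (\<sigma> k) k))"

text \<open>Summing over the permutations with \<open>\<sigma> k = j\<close> builds the sign of the
  position into the cofactor and keeps the index set \<open>N\<close>, which carries no
  order.\<close>

definition cofactor :: "('a, 's) ring_scheme \<Rightarrow> 'i set \<Rightarrow> ('i \<Rightarrow> 'i \<Rightarrow> 'a) \<Rightarrow> 'i \<Rightarrow> 'i \<Rightarrow> 'a"
  where "cofactor R N M j k =
    (\<Oplus>\<^bsub>R\<^esub>\<sigma>\<in>{\<sigma>. \<sigma> permutes N \<and> \<sigma> k = j}. [sign \<sigma>] \<cdot>\<^bsub>R\<^esub> (\<Otimes>\<^bsub>R\<^esub>l\<in>N - {k}. M (\<sigma> l) l))"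

context cring
begin

lemma leibniz_det_closed [simp, intro]:
  assumes "\<And>i k. i \<in> N \<Longrightarrow> k \<in> N \<Longrightarrow> M i k \<in> carrier R"
  shows "leibniz_det R N M \<in> carrier R"
  unfolding leibniz_det_def
  by (intro finsum_closed Pi_I add.int_pow_closed finprod_closed)
     (use assms in \<open>auto simp: permutes_in_image\<close>)

lemma cofactor_closed [simp, intro]:
  assumes "\<And>i k. i \<in> N \<Longrightarrow> k \<in> N \<Longrightarrow> M i k \<in> carrier R"
  shows "cofactor R N M j k \<in> carrier R"
  unfolding cofactor_def
  by (intro finsum_closed Pi_I add.int_pow_closed finprod_closed)
     (use assms in \<open>auto simp: permutes_in_image\<close>)

lemma leibniz_det_cong:
  assumes "\<And>i k. i \<in> N \<Longrightarrow> k \<in> N \<Longrightarrow> M i k \<in> carrier R"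
    and "\<And>i k. i \<in> N \<Longrightarrow> k \<in> N \<Longrightarrow> M i k = M' i k"
  shows "leibniz_det R N M = leibniz_det R N M'"
  unfolding leibniz_det_def
proof (rule finsum_cong'[OF refl])
  show "(\<lambda>\<sigma>. [sign \<sigma>] \<cdot> (\<Otimes>k\<in>N. M' (\<sigma> k) k)) \<in> {\<sigma>. \<sigma> permutes N} \<rightarrow> carrier R"
    using assms by (intro Pi_I add.int_pow_closed finprod_closed) (auto simp: permutes_in_image)
  fix \<sigma> assume "\<sigma> \<in> {\<sigma>. \<sigma> permutes N}"
  then have "(\<Otimes>k\<in>N. M (\<sigma> k) k) = (\<Otimes>k\<in>N. M' (\<sigma> k) k)"
    using assms by (intro finprod_cong') (auto simp: permutes_in_image)
  then show "[sign \<sigma>] \<cdot> (\<Otimes>k\<in>N. M (\<sigma> k) k) = [sign \<sigma>] \<cdot> (\<Otimes>k\<in>N. M' (\<sigma> k) k)" by simp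
qed

text \<open>Substituting \<open>p \<circ> \<sigma>\<close> for \<open>\<sigma>\<close> permutes the
  summands and multiplies each sign by \<open>sign p\<close>, which is its own inverse.\<close>

lemma leibniz_det_permute:
  assumes N: "finite N" and M: "\<And>i k. i \<in> N \<Longrightarrow> k \<in> N \<Longrightarrow> M i k \<in> carrier R"
    and p: "p permutes N"
  shows "leibniz_det R N (\<lambda>i. M (p i)) = [sign p] \<cdot> leibniz_det R N M"
proof -
  let ?P = "{\<sigma>. \<sigma> permutes N}" and ?t = "\<lambda>\<sigma>. \<Otimes>k\<in>N. M (\<sigma> k) k"
  have t: "?t \<sigma> \<in> carrier R" if "\<sigma> permutes N" for \<sigma>
    using that M by (intro finprod_closed) (auto simp: permutes_in_image)
  have P: "?P = (\<circ>) p ` ?P"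
    using image_compose_permutations_left[OF p] by (simp add: setcompr_eq_image)
  have inj: "inj_on ((\<circ>) p) ?P"
    using permutes_inj[OF p] by (auto simp: inj_on_def fun_eq_iff)
  have tp: "?t (p \<circ> \<sigma>) \<in> carrier R" if "\<sigma> permutes N" for \<sigma>
    using that by (intro t permutes_compose[OF _ p])
  have sign: "sign (p \<circ> \<sigma>) = sign p * sign \<sigma>" if "\<sigma> permutes N" for \<sigma>
    using that p N by (intro sign_compose) (auto simp: permutation_permutes)
  \<comment> \<open>The integer multiple becomes multiplication by a ring element, so that it can be
    moved into the sum by distributivity.\<close>
  have "[sign p] \<cdot> leibniz_det R N M = [sign p] \<cdot> \<one> \<otimes> (\<Oplus>\<sigma>\<in>?P. [sign \<sigma>] \<cdot> ?t \<sigma>)"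
    using leibniz_det_closed[of N M] M
    by (simp add: add_pow_ldistr_int leibniz_det_def)
  also have "(\<Oplus>\<sigma>\<in>?P. [sign \<sigma>] \<cdot> ?t \<sigma>) = (\<Oplus>\<sigma>\<in>(\<circ>) p ` ?P. [sign \<sigma>] \<cdot> ?t \<sigma>)"
    by (rule arg_cong[OF P])
  also have "\<dots> = (\<Oplus>\<sigma>\<in>?P. [sign (p \<circ> \<sigma>)] \<cdot> ?t (p \<circ> \<sigma>))"
    by (rule finsum_reindex[OF _ inj]) (use t permutes_compose[OF _ p] in \<open>auto simp del: o_apply intro!: add.int_pow_closed\<close>)
  also have "[sign p] \<cdot> \<one> \<otimes> \<dots> = (\<Oplus>\<sigma>\<in>?P. [sign p] \<cdot> \<one> \<otimes> [sign (p \<circ> \<sigma>)] \<cdot> ?t (p \<circ> \<sigma>))"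
    by (rule finsum_rdistr)
       (use finite_permutations[OF N] tp in \<open>auto simp del: o_apply\<close>)
  also have "\<dots> = (\<Oplus>\<sigma>\<in>?P. [sign \<sigma>] \<cdot> ?t (p \<circ> \<sigma>))"
  proof (rule finsum_cong'[OF refl])
    show "(\<lambda>\<sigma>. [sign \<sigma>] \<cdot> ?t (p \<circ> \<sigma>)) \<in> ?P \<rightarrow> carrier R"
      using tp by (auto simp del: o_apply)
    fix \<sigma> assume "\<sigma> \<in> ?P"
    then have \<sigma>: "\<sigma> permutes N" by simp
    have tc: "?t (p \<circ> \<sigma>) \<in> carrier R" by (rule tp[OF \<sigma>])
    show "[sign p] \<cdot> \<one> \<otimes> [sign (p \<circ> \<sigma>)] \<cdot> ?t (p \<circ> \<sigma>) = [sign \<sigma>] \<cdot> ?t (p \<circ> \<sigma>)"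
      using tc
      by (simp add: sign[OF \<sigma>] add_pow_ldistr_int add.int_pow_pow mult.assoc[symmetric] del: o_apply)
         (simp add: ac_simps)
  qed
  finally show ?thesis by (simp add: leibniz_det_def)
qed

text \<open>Exchanging the values \<open>i\<close> and \<open>j\<close> of \<open>\<sigma>\<close>
  reverses the sign and only exchanges equal entries of the rows \<open>i\<close> and
  \<open>j\<close>.\<close>

lemma leibniz_det_row_repeat:
  assumes N: "finite N" and M: "\<And>i k. i \<in> N \<Longrightarrow> k \<in> N \<Longrightarrow> M i k \<in> carrier R"
    and ij: "i \<in> N" "j \<in> N" "i \<noteq> j" "\<And>k. k \<in> N \<Longrightarrow> M i k = M j k"
  shows "leibniz_det R N M = \<zero>"
  unfolding leibniz_det_def
proof (rule finsum_sign_cancel[where h="(\<circ>) (transpose i j)", OF N])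
  fix \<sigma> assume \<sigma>: "\<sigma> permutes N"
  show "(\<Otimes>k\<in>N. M (\<sigma> k) k) \<in> carrier R"
    using \<sigma> M by (intro finprod_closed) (auto simp: permutes_in_image)
  have "(\<Otimes>k\<in>N. M ((transpose i j \<circ> \<sigma>) k) k) = (\<Otimes>k\<in>N. M (\<sigma> k) k)"
    using \<sigma> M ij by (intro finprod_cong') (auto simp: permutes_in_image transpose_def)
  moreover have "sign (transpose i j \<circ> \<sigma>) = - sign \<sigma>"
    using \<sigma> N ij by (subst sign_compose) (auto simp: sign_swap_id permutation_swap_id intro: permutes_imp_permutation)
  moreover have "transpose i j \<circ> (transpose i j \<circ> \<sigma>) = \<sigma>"
    by (simp add: comp_assoc[symmetric])
  ultimately show "transpose i j \<circ> \<sigma> permutes N \<and> transpose i j \<circ> (transpose i j \<circ> \<sigma>) = \<sigma> \<and>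
      sign (transpose i j \<circ> \<sigma>) = - sign \<sigma> \<and>
      (\<Otimes>k\<in>N. M ((transpose i j \<circ> \<sigma>) k) k) = (\<Otimes>k\<in>N. M (\<sigma> k) k)"
    using permutes_compose[OF \<sigma> permutes_swap_id[OF ij(1,2)]] by blast
qed

text \<open>Here the transposition acts on the arguments of \<open>\<sigma>\<close>, so the product
  must be reindexed by it before equal columns can be compared.\<close>

lemma leibniz_det_col_repeat:
  assumes N: "finite N" and M: "\<And>i k. i \<in> N \<Longrightarrow> k \<in> N \<Longrightarrow> M i k \<in> carrier R"
    and kl: "k \<in> N" "l \<in> N" "k \<noteq> l" "\<And>i. i \<in> N \<Longrightarrow> M i k = M i l"
  shows "leibniz_det R N M = \<zero>"
  unfolding leibniz_det_def
proof (rule finsum_sign_cancel[where h="\<lambda>\<sigma>. \<sigma> \<circ> transpose k l", OF N])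
  fix \<sigma> assume \<sigma>: "\<sigma> permutes N"
  let ?\<tau> = "transpose k l"
  show "(\<Otimes>m\<in>N. M (\<sigma> m) m) \<in> carrier R"
    using \<sigma> M by (intro finprod_closed) (auto simp: permutes_in_image)
  have \<tau>: "?\<tau> permutes N" using kl by (intro permutes_swap_id)
  have mem: "?\<tau> m \<in> N \<longleftrightarrow> m \<in> N" for m
    using \<tau> by (simp add: permutes_in_image)
  have "(\<Otimes>m\<in>N. M (\<sigma> m) m) = (\<Otimes>m\<in>?\<tau> ` N. M (\<sigma> m) m)"
    using \<tau> by (simp add: permutes_image)
  also have "\<dots> = (\<Otimes>m\<in>N. M (\<sigma> (?\<tau> m)) (?\<tau> m))"
    by (rule finprod_reindex) (use \<sigma> M \<tau> in \<open>auto simp: permutes_in_image mem intro: inj_on_subset\<close>)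
  also have "\<dots> = (\<Otimes>m\<in>N. M ((\<sigma> \<circ> ?\<tau>) m) m)"
  proof (rule finprod_cong'[OF refl])
    show "(\<lambda>m. M ((\<sigma> \<circ> ?\<tau>) m) m) \<in> N \<rightarrow> carrier R"
      using \<sigma> M mem by (auto simp: permutes_in_image)
    fix m assume "m \<in> N"
    then have "\<sigma> (?\<tau> m) \<in> N" using \<sigma> mem by (simp add: permutes_in_image)
    then show "M (\<sigma> (?\<tau> m)) (?\<tau> m) = M ((\<sigma> \<circ> ?\<tau>) m) m"
      using kl(4)[of "\<sigma> (?\<tau> m)"] by (auto simp: transpose_def)
  qed
  finally have "(\<Otimes>m\<in>N. M ((\<sigma> \<circ> ?\<tau>) m) m) = (\<Otimes>m\<in>N. M (\<sigma> m) m)" by simp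
  moreover have "sign (\<sigma> \<circ> ?\<tau>) = - sign \<sigma>"
    using \<sigma> N kl by (subst sign_compose) (auto simp: sign_swap_id permutation_swap_id intro: permutes_imp_permutation)
  moreover have "\<sigma> \<circ> ?\<tau> \<circ> ?\<tau> = \<sigma>"
    by (simp add: comp_assoc)
  ultimately show "\<sigma> \<circ> ?\<tau> permutes N \<and> \<sigma> \<circ> ?\<tau> \<circ> ?\<tau> = \<sigma> \<and> sign (\<sigma> \<circ> ?\<tau>) = - sign \<sigma> \<and>
      (\<Otimes>m\<in>N. M ((\<sigma> \<circ> ?\<tau>) m) m) = (\<Otimes>m\<in>N. M (\<sigma> m) m)"
    using permutes_compose[OF \<tau> \<sigma>] by blast
qed

text \<open>The permutations are sorted by the column \<open>k\<close> with
  \<open>\<sigma> k = j\<close>. The cofactors are those of \<open>M\<close> itself, because row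
  \<open>j\<close> does not occur in them.\<close>

lemma leibniz_det_expand_row:
  assumes N: "finite N" and M: "\<And>i k. i \<in> N \<Longrightarrow> k \<in> N \<Longrightarrow> M i k \<in> carrier R"
    and j: "j \<in> N" and v: "\<And>k. k \<in> N \<Longrightarrow> v k \<in> carrier R"
  shows "leibniz_det R N (M(j := v)) = (\<Oplus>k\<in>N. v k \<otimes> cofactor R N M j k)"
proof -
  let ?P = "{\<sigma>. \<sigma> permutes N}"
  let ?t = "\<lambda>\<sigma>. [sign \<sigma>] \<cdot> (\<Otimes>k\<in>N. (M(j := v)) (\<sigma> k) k)"
  have M': "(M(j := v)) i k \<in> carrier R" if "i \<in> N" "k \<in> N" for i k
    using M v that by simp
  have t: "?t \<in> ?P \<rightarrow> carrier R"
    using M' by (intro Pi_I add.int_pow_closed finprod_closed) (simp add: permutes_in_image)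
  have "leibniz_det R N (M(j := v)) = finsum R ?t ?P"
    by (simp add: leibniz_det_def)
  also have "\<dots> = (\<Oplus>k\<in>N. finsum R ?t {\<sigma> \<in> ?P. inv_into UNIV \<sigma> j = k})"
    by (rule finsum_partition)
       (use N finite_permutations[OF N] j t in \<open>auto simp: permutes_in_image permutes_inv\<close>)
  also have "\<dots> = (\<Oplus>k\<in>N. v k \<otimes> cofactor R N M j k)"
  proof (rule finsum_cong'[OF refl])
    show "(\<lambda>k. v k \<otimes> cofactor R N M j k) \<in> N \<rightarrow> carrier R"
      using v M by auto
    fix k assume k: "k \<in> N"
    have P: "{\<sigma> \<in> ?P. inv_into UNIV \<sigma> j = k} = {\<sigma>. \<sigma> permutes N \<and> \<sigma> k = j}"
      using permutes_inv_eq by fastforce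
    have c: "(\<lambda>\<sigma>. \<Otimes>l\<in>N - {k}. M (\<sigma> l) l) \<in> {\<sigma>. \<sigma> permutes N \<and> \<sigma> k = j} \<rightarrow> carrier R"
      using M by (intro Pi_I finprod_closed) (simp add: permutes_in_image)
    have "v k \<otimes> cofactor R N M j k =
        (\<Oplus>\<sigma>\<in>{\<sigma>. \<sigma> permutes N \<and> \<sigma> k = j}. v k \<otimes> [sign \<sigma>] \<cdot> (\<Otimes>l\<in>N - {k}. M (\<sigma> l) l))"
      unfolding cofactor_def
      by (rule finsum_rdistr) (use finite_permutations[OF N] v k c in auto)
    also have "\<dots> = (\<Oplus>\<sigma>\<in>{\<sigma>. \<sigma> permutes N \<and> \<sigma> k = j}. ?t \<sigma>)"
    proof (rule finsum_cong'[OF refl])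
      show "?t \<in> {\<sigma>. \<sigma> permutes N \<and> \<sigma> k = j} \<rightarrow> carrier R" using t by auto
      fix \<sigma> assume "\<sigma> \<in> {\<sigma>. \<sigma> permutes N \<and> \<sigma> k = j}"
      then have \<sigma>: "\<sigma> permutes N" "\<sigma> k = j" by auto
      have "(\<Otimes>l\<in>insert k (N - {k}). (M(j := v)) (\<sigma> l) l) =
          (M(j := v)) (\<sigma> k) k \<otimes> (\<Otimes>l\<in>N - {k}. (M(j := v)) (\<sigma> l) l)"
        by (rule finprod_insert) (use N M' \<sigma> k in \<open>auto simp: permutes_in_image simp del: fun_upd_apply\<close>)
      also have "(\<Otimes>l\<in>N - {k}. (M(j := v)) (\<sigma> l) l) = (\<Otimes>l\<in>N - {k}. M (\<sigma> l) l)"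
      proof (rule finprod_cong'[OF refl])
        show "(\<lambda>l. M (\<sigma> l) l) \<in> N - {k} \<rightarrow> carrier R"
          using M \<sigma> by (auto simp: permutes_in_image)
        fix l assume "l \<in> N - {k}"
        \<comment> \<open>\<open>\<sigma>\<close> is injective and already takes the value
          \<open>j\<close> at \<open>k\<close>.\<close>
        then have "\<sigma> l \<noteq> j" using \<sigma> by (metis DiffD2 permutes_inv_eq singletonI)
        then show "(M(j := v)) (\<sigma> l) l = M (\<sigma> l) l" by simp
      qed
      also have "insert k (N - {k}) = N" using k by auto
      finally show "v k \<otimes> [sign \<sigma>] \<cdot> (\<Otimes>l\<in>N - {k}. M (\<sigma> l) l) = ?t \<sigma>"
        using c \<sigma> v k by (simp add: add_pow_rdistr_int Pi_def)
    qed
    finally show "finsum R ?t {\<sigma> \<in> ?P. inv_into UNIV \<sigma> j = k} = v k \<otimes> cofactor R N M j k"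
      by (simp only: P)
  qed
  finally show ?thesis .
qed

text \<open>As for rows, but the permutations are sorted by the row \<open>\<sigma> k\<close> used
  in column \<open>k\<close>.\<close>

lemma leibniz_det_expand_col:
  assumes N: "finite N" and M: "\<And>i k. i \<in> N \<Longrightarrow> k \<in> N \<Longrightarrow> M i k \<in> carrier R"
    and k: "k \<in> N" and v: "\<And>i. i \<in> N \<Longrightarrow> v i \<in> carrier R"
  shows "leibniz_det R N (\<lambda>i. (M i)(k := v i)) = (\<Oplus>i\<in>N. v i \<otimes> cofactor R N M i k)"
proof -
  let ?P = "{\<sigma>. \<sigma> permutes N}"
  let ?M = "\<lambda>i. (M i)(k := v i)"
  let ?t = "\<lambda>\<sigma>. [sign \<sigma>] \<cdot> (\<Otimes>l\<in>N. ?M (\<sigma> l) l)"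
  have M': "?M i l \<in> carrier R" if "i \<in> N" "l \<in> N" for i l
    using M v that by simp
  have t: "?t \<in> ?P \<rightarrow> carrier R"
    using M' by (intro Pi_I add.int_pow_closed finprod_closed) (simp add: permutes_in_image)
  have "leibniz_det R N ?M = finsum R ?t ?P"
    by (simp add: leibniz_det_def)
  also have "\<dots> = (\<Oplus>i\<in>N. finsum R ?t {\<sigma> \<in> ?P. \<sigma> k = i})"
    by (rule finsum_partition)
       (use N finite_permutations[OF N] k t in \<open>auto simp: permutes_in_image\<close>)
  also have "\<dots> = (\<Oplus>i\<in>N. v i \<otimes> cofactor R N M i k)"
  proof (rule finsum_cong'[OF refl])
    show "(\<lambda>i. v i \<otimes> cofactor R N M i k) \<in> N \<rightarrow> carrier R"
      using v M by auto
    fix i assume i: "i \<in> N"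
    have c: "(\<lambda>\<sigma>. \<Otimes>l\<in>N - {k}. M (\<sigma> l) l) \<in> {\<sigma>. \<sigma> permutes N \<and> \<sigma> k = i} \<rightarrow> carrier R"
      using M by (intro Pi_I finprod_closed) (simp add: permutes_in_image)
    have "v i \<otimes> cofactor R N M i k =
        (\<Oplus>\<sigma>\<in>{\<sigma>. \<sigma> permutes N \<and> \<sigma> k = i}. v i \<otimes> [sign \<sigma>] \<cdot> (\<Otimes>l\<in>N - {k}. M (\<sigma> l) l))"
      unfolding cofactor_def
      by (rule finsum_rdistr) (use finite_permutations[OF N] v i c in auto)
    also have "\<dots> = (\<Oplus>\<sigma>\<in>{\<sigma>. \<sigma> permutes N \<and> \<sigma> k = i}. ?t \<sigma>)"
    proof (rule finsum_cong'[OF refl])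
      show "?t \<in> {\<sigma>. \<sigma> permutes N \<and> \<sigma> k = i} \<rightarrow> carrier R" using t by auto
      fix \<sigma> assume "\<sigma> \<in> {\<sigma>. \<sigma> permutes N \<and> \<sigma> k = i}"
      then have \<sigma>: "\<sigma> permutes N" "\<sigma> k = i" by auto
      have "(\<Otimes>l\<in>insert k (N - {k}). ?M (\<sigma> l) l) =
          ?M (\<sigma> k) k \<otimes> (\<Otimes>l\<in>N - {k}. ?M (\<sigma> l) l)"
        by (rule finprod_insert) (use N M' \<sigma> k in \<open>auto simp: permutes_in_image simp del: fun_upd_apply\<close>)
      also have "(\<Otimes>l\<in>N - {k}. ?M (\<sigma> l) l) = (\<Otimes>l\<in>N - {k}. M (\<sigma> l) l)"
        by (rule finprod_cong') (use M \<sigma> in \<open>auto simp: permutes_in_image\<close>)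
      also have "insert k (N - {k}) = N" using k by auto
      finally show "v i \<otimes> [sign \<sigma>] \<cdot> (\<Otimes>l\<in>N - {k}. M (\<sigma> l) l) = ?t \<sigma>"
        using c \<sigma> v i by (simp add: add_pow_rdistr_int Pi_def)
    qed
    finally show "finsum R ?t {\<sigma> \<in> ?P. \<sigma> k = i} = v i \<otimes> cofactor R N M i k"
      by simp
  qed
  finally show ?thesis .
qed

text \<open>Each determinant on the left is expanded along its new row \<open>v\<close>. After the
  sums are exchanged, the coefficient of \<open>v k\<close> is an expansion along column
  \<open>k\<close> of \<open>M\<close> with that column overwritten by column \<open>m\<close>; it
  has a repeated column unless \<open>k = m\<close>.\<close>

lemma cramer:
  assumes N: "finite N" and M: "\<And>i k. i \<in> N \<Longrightarrow> k \<in> N \<Longrightarrow> M i k \<in> carrier R"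
    and v: "\<And>k. k \<in> N \<Longrightarrow> v k \<in> carrier R" and m: "m \<in> N"
  shows "(\<Oplus>i\<in>N. leibniz_det R N (M(i := v)) \<otimes> M i m) = leibniz_det R N M \<otimes> v m"
proof -
  let ?c = "cofactor R N M"
  have col: "(\<Oplus>i\<in>N. M i m \<otimes> ?c i k) = (if k = m then leibniz_det R N M else \<zero>)"
    if k: "k \<in> N" for k
  proof -
    have "(\<Oplus>i\<in>N. M i m \<otimes> ?c i k) = leibniz_det R N (\<lambda>i. (M i)(k := M i m))"
      by (rule leibniz_det_expand_col[symmetric]) (use N M k m in auto)
    also have "\<dots> = (if k = m then leibniz_det R N M else \<zero>)"
    proof (cases "k = m")
      case False
      then show ?thesis
        using leibniz_det_col_repeat[of N "\<lambda>i. (M i)(k := M i m)" k m] N M k m by simp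
    qed simp
    finally show ?thesis .
  qed
  have "(\<Oplus>i\<in>N. leibniz_det R N (M(i := v)) \<otimes> M i m) =
      (\<Oplus>i\<in>N. \<Oplus>k\<in>N. v k \<otimes> (M i m \<otimes> ?c i k))"
  proof (rule finsum_cong'[OF refl])
    show "(\<lambda>i. \<Oplus>k\<in>N. v k \<otimes> (M i m \<otimes> ?c i k)) \<in> N \<rightarrow> carrier R"
      using v M m by (intro Pi_I finsum_closed) auto
    fix i assume i: "i \<in> N"
    have "leibniz_det R N (M(i := v)) \<otimes> M i m = (\<Oplus>k\<in>N. v k \<otimes> ?c i k) \<otimes> M i m"
      using leibniz_det_expand_row[OF N M i v] by simp
    also have "\<dots> = (\<Oplus>k\<in>N. v k \<otimes> ?c i k \<otimes> M i m)"
      by (rule finsum_ldistr) (use N M v i m in auto)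
    also have "\<dots> = (\<Oplus>k\<in>N. v k \<otimes> (M i m \<otimes> ?c i k))"
      by (rule finsum_cong') (use M v i m in \<open>auto simp: m_ac\<close>)
    finally show "leibniz_det R N (M(i := v)) \<otimes> M i m = (\<Oplus>k\<in>N. v k \<otimes> (M i m \<otimes> ?c i k))" .
  qed
  also have "\<dots> = (\<Oplus>k\<in>N. \<Oplus>i\<in>N. v k \<otimes> (M i m \<otimes> ?c i k))"
    by (rule finsum_swap) (use N M v m in auto)
  also have "\<dots> = (\<Oplus>k\<in>N. if k = m then leibniz_det R N M \<otimes> v k else \<zero>)"
  proof (rule finsum_cong'[OF refl])
    fix k assume k: "k \<in> N"
    have "(\<Oplus>i\<in>N. v k \<otimes> (M i m \<otimes> ?c i k)) = v k \<otimes> (\<Oplus>i\<in>N. M i m \<otimes> ?c i k)"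
      by (rule finsum_rdistr[symmetric]) (use N M v k m in auto)
    then show "(\<Oplus>i\<in>N. v k \<otimes> (M i m \<otimes> ?c i k)) = (if k = m then leibniz_det R N M \<otimes> v k else \<zero>)"
      using col[OF k] v[OF k] leibniz_det_closed[of N M, OF M] by (auto simp: m_comm)
  qed (use M v m in auto)
  also have "\<dots> = leibniz_det R N M \<otimes> v m"
    using add.finprod_singleton_swap[of m N "\<lambda>k. leibniz_det R N M \<otimes> v k"] N m v M by auto
  finally show ?thesis .
qed

text \<open>Multiplication of \<open>x M = 0\<close> by the adjugate of \<open>M\<close>: row
  \<open>i\<close> of \<open>M\<close> paired with the cofactors of row \<open>j\<close> gives the
  determinant for \<open>i = j\<close> and otherwise a determinant with a repeated row. No division
  occurs, so this holds over any commutative ring.\<close>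

lemma leibniz_det_kernel:
  assumes N: "finite N" and M: "\<And>i k. i \<in> N \<Longrightarrow> k \<in> N \<Longrightarrow> M i k \<in> carrier R"
    and x: "\<And>i. i \<in> N \<Longrightarrow> x i \<in> carrier R"
    and ker: "\<And>k. k \<in> N \<Longrightarrow> (\<Oplus>i\<in>N. x i \<otimes> M i k) = \<zero>" and j: "j \<in> N"
  shows "x j \<otimes> leibniz_det R N M = \<zero>"
proof -
  let ?c = "cofactor R N M"
  have row: "(\<Oplus>k\<in>N. M i k \<otimes> ?c j k) = (if i = j then leibniz_det R N M else \<zero>)"
    if i: "i \<in> N" for i
  proof -
    have "(\<Oplus>k\<in>N. M i k \<otimes> ?c j k) = leibniz_det R N (M(j := M i))"
      by (rule leibniz_det_expand_row[symmetric]) (use N M i j in auto)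
    also have "\<dots> = (if i = j then leibniz_det R N M else \<zero>)"
    proof (cases "i = j")
      case False
      then show ?thesis
        using leibniz_det_row_repeat[of N "M(j := M i)" i j] N M i j by auto
    qed simp
    finally show ?thesis .
  qed
  have "x j \<otimes> leibniz_det R N M = (\<Oplus>i\<in>N. if i = j then x i \<otimes> leibniz_det R N M else \<zero>)"
    using add.finprod_singleton_swap[of j N "\<lambda>i. x i \<otimes> leibniz_det R N M"] N j x M by auto
  also have "\<dots> = (\<Oplus>i\<in>N. \<Oplus>k\<in>N. x i \<otimes> M i k \<otimes> ?c j k)"
  proof (rule finsum_cong'[OF refl])
    show "(\<lambda>i. \<Oplus>k\<in>N. x i \<otimes> M i k \<otimes> ?c j k) \<in> N \<rightarrow> carrier R"
      using x M by (intro Pi_I finsum_closed) auto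
    fix i assume i: "i \<in> N"
    have "(\<Oplus>k\<in>N. x i \<otimes> M i k \<otimes> ?c j k) = (\<Oplus>k\<in>N. x i \<otimes> (M i k \<otimes> ?c j k))"
      by (rule finsum_cong') (use M x i in \<open>auto simp: m_assoc\<close>)
    also have "\<dots> = x i \<otimes> (\<Oplus>k\<in>N. M i k \<otimes> ?c j k)"
      by (rule finsum_rdistr[symmetric]) (use N M x i in auto)
    finally show "(if i = j then x i \<otimes> leibniz_det R N M else \<zero>) = (\<Oplus>k\<in>N. x i \<otimes> M i k \<otimes> ?c j k)"
      using row[OF i] x i by simp
  qed
  also have "\<dots> = (\<Oplus>k\<in>N. \<Oplus>i\<in>N. x i \<otimes> M i k \<otimes> ?c j k)"
    by (rule finsum_swap) (use N M x in auto)
  also have "\<dots> = (\<Oplus>k\<in>N. \<zero>)"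
  proof (rule finsum_cong'[OF refl])
    fix k assume k: "k \<in> N"
    have "(\<Oplus>i\<in>N. x i \<otimes> M i k \<otimes> ?c j k) = (\<Oplus>i\<in>N. x i \<otimes> M i k) \<otimes> ?c j k"
      by (rule finsum_ldistr[symmetric]) (use N M x k in auto)
    then show "(\<Oplus>i\<in>N. x i \<otimes> M i k \<otimes> ?c j k) = \<zero>"
      using ker[OF k] M by simp
  qed simp
  finally show ?thesis by simp
qed

end

section \<open>Alternating biderivations\<close>

text \<open>Applied to the bracket of \<open>A\<close>, where it yields antisymmetry and the
  vanishing on \<open>\<one>\<close>, and to the bracket of the tensor power, where the main
  computation takes place.\<close>

locale alternating_biderivation = cring R for R (structure) +
  fixes br :: "'a \<Rightarrow> 'a \<Rightarrow> 'a"
  assumes br_closed [simp, intro]: "\<lbrakk>a \<in> carrier R; b \<in> carrier R\<rbrakk> \<Longrightarrow> br a b \<in> carrier R"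
    and br_add_l: "\<lbrakk>a \<in> carrier R; b \<in> carrier R; c \<in> carrier R\<rbrakk> \<Longrightarrow> br (a \<oplus> b) c = br a c \<oplus> br b c"
    and br_add_r: "\<lbrakk>a \<in> carrier R; b \<in> carrier R; c \<in> carrier R\<rbrakk> \<Longrightarrow> br a (b \<oplus> c) = br a b \<oplus> br a c"
    and br_self: "a \<in> carrier R \<Longrightarrow> br a a = \<zero>"
    and br_leibniz_l: "\<lbrakk>a \<in> carrier R; b \<in> carrier R; c \<in> carrier R\<rbrakk> \<Longrightarrow>
      br (a \<otimes> b) c = a \<otimes> br b c \<oplus> br a c \<otimes> b"
begin

text \<open>Polarization of \<open>br_self\<close> at \<open>a \<oplus> b\<close>.\<close>

lemma br_swap:
  assumes "a \<in> carrier R" "b \<in> carrier R"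
  shows "br a b = \<ominus> br b a"
proof -
  have "br (a \<oplus> b) (a \<oplus> b) = br a a \<oplus> br a b \<oplus> (br b a \<oplus> br b b)"
    using assms by (simp add: br_add_l br_add_r a_ac)
  then have "br a b \<oplus> br b a = \<zero>"
    using assms by (simp add: br_self)
  then show ?thesis
    using assms by (metis br_closed sum_zero_eq_neg)
qed

lemma br_leibniz_r:
  assumes "a \<in> carrier R" "b \<in> carrier R" "c \<in> carrier R"
  shows "br c (a \<otimes> b) = a \<otimes> br c b \<oplus> br c a \<otimes> b"
  using assms by (simp add: br_swap[of c] br_leibniz_l minus_add l_minus r_minus)

lemma br_zero_l [simp]: "c \<in> carrier R \<Longrightarrow> br \<zero> c = \<zero>"
  using br_add_l[of \<zero> \<zero> c] add.r_cancel_one[of "br \<zero> c" "br \<zero> c"] by simp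

lemma br_zero_r [simp]: "c \<in> carrier R \<Longrightarrow> br c \<zero> = \<zero>"
  using br_add_r[of c \<zero> \<zero>] add.r_cancel_one[of "br c \<zero>" "br c \<zero>"] by simp

lemma br_one_l: "c \<in> carrier R \<Longrightarrow> br \<one> c = \<zero>"
  using br_leibniz_l[of \<one> \<one> c] add.r_cancel_one[of "br \<one> c" "br \<one> c"] by simp

lemma br_one_r: "c \<in> carrier R \<Longrightarrow> br c \<one> = \<zero>"
  using br_leibniz_r[of \<one> \<one> c] add.r_cancel_one[of "br c \<one>" "br c \<one>"] by simp

lemma br_minus_l: "\<lbrakk>a \<in> carrier R; c \<in> carrier R\<rbrakk> \<Longrightarrow> br (\<ominus> a) c = \<ominus> br a c"
  using br_add_l[of "\<ominus> a" a c] by (simp add: l_neg sum_zero_eq_neg)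

lemma br_finsum_l:
  assumes "finite S" "g \<in> S \<rightarrow> carrier R" "c \<in> carrier R"
  shows "br (\<Oplus>x\<in>S. g x) c = (\<Oplus>x\<in>S. br (g x) c)"
  using assms by (induction S) (simp_all add: Pi_def br_add_l)

lemma br_finsum_r:
  assumes "finite S" "g \<in> S \<rightarrow> carrier R" "c \<in> carrier R"
  shows "br c (\<Oplus>x\<in>S. g x) = (\<Oplus>x\<in>S. br c (g x))"
  using assms by (induction S) (simp_all add: Pi_def br_add_r)

text \<open>The numerator of \<open>{a/b, c/d}\<close> over the denominator \<open>b\<^sup>2 d\<^sup>2\<close>.\<close>

definition br_num :: "'a \<Rightarrow> 'a \<Rightarrow> 'a \<Rightarrow> 'a \<Rightarrow> 'a"
  where "br_num a b c d =
    (b \<otimes> d) \<otimes> br a c \<ominus> (b \<otimes> c) \<otimes> br a d \<ominus> (a \<otimes> d) \<otimes> br b c \<oplus> (a \<otimes> c) \<otimes> br b d"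

lemma br_num_closed [simp, intro]:
  "\<lbrakk>a \<in> carrier R; b \<in> carrier R; c \<in> carrier R; d \<in> carrier R\<rbrakk> \<Longrightarrow> br_num a b c d \<in> carrier R"
  by (simp add: br_num_def)

lemma br_num_swap:
  assumes [simp]: "a \<in> carrier R" "b \<in> carrier R" "c \<in> carrier R" "d \<in> carrier R"
  shows "br_num a b c d = \<ominus> br_num c d a b"
proof -
  have "br_num a b c d = (b \<otimes> d) \<otimes> br a c \<ominus> (b \<otimes> c) \<otimes> br a d \<ominus> (a \<otimes> d) \<otimes> br b c \<oplus> (a \<otimes> c) \<otimes> br b d"
    by (simp add: br_num_def)
  also have "\<dots> = \<ominus> ((d \<otimes> b) \<otimes> (\<ominus> br a c) \<ominus> (d \<otimes> a) \<otimes> (\<ominus> br b c) \<ominus> (c \<otimes> b) \<otimes> (\<ominus> br a d) \<oplus> (c \<otimes> a) \<otimes> (\<ominus> br b d))"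
    using br_closed[of a c] br_closed[of a d] br_closed[of b c] br_closed[of b d] assms by algebra
  also have "\<dots> = \<ominus> br_num c d a b"
    by (simp add: br_num_def br_swap[of c] br_swap[of d])
  finally show ?thesis .
qed

text \<open>For the derivation \<open>D = br _ c\<close>, the quotient rule reads
  \<open>b D a - a D b = b^2 D (a/b)\<close>. Applying \<open>D\<close> to \<open>eq\<close> shows
  that the value on a fraction does not depend on the representative; the lemma is that fact with
  denominators cleared.\<close>

lemma br_quotient_numerator:
  assumes [simp]: "a \<in> carrier R" "b \<in> carrier R" "a' \<in> carrier R" "b' \<in> carrier R" "c \<in> carrier R"
    and eq: "a \<otimes> b' = a' \<otimes> b"
  shows "(b' \<otimes> b') \<otimes> (b \<otimes> br a c \<ominus> a \<otimes> br b c) = (b \<otimes> b) \<otimes> (b' \<otimes> br a' c \<ominus> a' \<otimes> br b' c)"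
proof -
  define da db da' db' where d: "da = br a c" "db = br b c" "da' = br a' c" "db' = br b' c"
  have [simp]: "da \<in> carrier R" "db \<in> carrier R" "da' \<in> carrier R" "db' \<in> carrier R"
    by (simp_all add: d)
  note cl = \<open>da \<in> carrier R\<close> \<open>db \<in> carrier R\<close> \<open>da' \<in> carrier R\<close> \<open>db' \<in> carrier R\<close> assms(1-5)
  have d1: "a \<otimes> db' \<oplus> da \<otimes> b' = a' \<otimes> db \<oplus> da' \<otimes> b"
    using arg_cong[OF eq, of "\<lambda>x. br x c"] by (simp add: br_leibniz_l d)
  \<comment> \<open>Solved for \<open>da \<otimes> b'\<close> in order to eliminate
    \<open>da\<close>; the terms in \<open>db\<close> then cancel by \<open>eq\<close>.\<close>
  have "da \<otimes> b' = (a \<otimes> db' \<oplus> da \<otimes> b') \<ominus> a \<otimes> db'"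
    using cl by algebra
  then have "da \<otimes> b' = a' \<otimes> db \<oplus> da' \<otimes> b \<ominus> a \<otimes> db'"
    by (simp only: d1)
  moreover have "(b' \<otimes> b') \<otimes> (b \<otimes> da \<ominus> a \<otimes> db) = b' \<otimes> b \<otimes> (da \<otimes> b') \<ominus> (a \<otimes> b') \<otimes> (b' \<otimes> db)"
    using cl by algebra
  ultimately have "(b' \<otimes> b') \<otimes> (b \<otimes> da \<ominus> a \<otimes> db) =
      b' \<otimes> b \<otimes> (a' \<otimes> db \<oplus> da' \<otimes> b \<ominus> a \<otimes> db') \<ominus> (a' \<otimes> b) \<otimes> (b' \<otimes> db)"
    by (simp add: eq)
  also have "\<dots> = b' \<otimes> b \<otimes> (da' \<otimes> b) \<ominus> b \<otimes> (a \<otimes> b') \<otimes> db'"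
    using cl by algebra
  also have "\<dots> = b' \<otimes> b \<otimes> (da' \<otimes> b) \<ominus> b \<otimes> (a' \<otimes> b) \<otimes> db'"
    by (simp add: eq)
  also have "\<dots> = (b \<otimes> b) \<otimes> (b' \<otimes> da' \<ominus> a' \<otimes> db')"
    using cl by algebra
  finally show ?thesis by (simp add: d)
qed

text \<open>In its first pair, \<open>br_num\<close> is \<open>d\<close> times the quotient rule for
  \<open>br _ c\<close> minus \<open>c\<close> times the one for \<open>br _ d\<close>. The second
  pair is reached through \<open>br_num_swap\<close>.\<close>

lemma br_num_rescale:
  assumes [simp]: "a \<in> carrier R" "b \<in> carrier R" "a' \<in> carrier R" "b' \<in> carrier R"
      "c \<in> carrier R" "d \<in> carrier R"
    and eq: "a \<otimes> b' = a' \<otimes> b"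
  shows "(b' \<otimes> b') \<otimes> br_num a b c d = (b \<otimes> b) \<otimes> br_num a' b' c d"
proof -
  have split: "br_num x y c d = d \<otimes> (y \<otimes> br x c \<ominus> x \<otimes> br y c) \<ominus> c \<otimes> (y \<otimes> br x d \<ominus> x \<otimes> br y d)"
    if "x \<in> carrier R" "y \<in> carrier R" for x y
    unfolding br_num_def
    using that br_closed[of x c] br_closed[of x d] br_closed[of y c] br_closed[of y d] assms(5,6)
    by algebra
  have dist: "s \<otimes> (d \<otimes> p \<ominus> c \<otimes> q) = d \<otimes> (s \<otimes> p) \<ominus> c \<otimes> (s \<otimes> q)"
    if "s \<in> carrier R" "p \<in> carrier R" "q \<in> carrier R" for s p q
    using that assms(5,6) by algebra
  show ?thesis
    using eq by (simp add: split dist br_quotient_numerator[of a b a' b'])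
qed

text \<open>The minors differ from the Cramer coefficients by signs; this makes the signs
  harmless.\<close>

lemma br_num_minus:
  assumes "a \<in> carrier R" "b \<in> carrier R" "c \<in> carrier R"
  shows "br_num (\<ominus> a) b c b = \<ominus> br_num a b c b"
proof -
  note cl = assms br_closed[of a c] br_closed[of a b] br_closed[of b c] br_closed[of b b]
  have "br_num (\<ominus> a) b c b = (b \<otimes> b) \<otimes> (\<ominus> br a c) \<ominus> (b \<otimes> c) \<otimes> (\<ominus> br a b) \<ominus> ((\<ominus> a) \<otimes> b) \<otimes> br b c \<oplus> ((\<ominus> a) \<otimes> c) \<otimes> br b b"
    using assms by (simp add: br_num_def br_minus_l)
  also have "\<dots> = \<ominus> br_num a b c b"
    unfolding br_num_def using cl by algebra
  finally show ?thesis .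
qed

text \<open>By induction: the row and the column of a new index \<open>x\<close> cancel by
  \<open>swap\<close>, and the corner vanishes by \<open>diag\<close>. Antisymmetry alone would only
  give \<open>2 a i i = 0\<close> on the diagonal.\<close>

lemma finsum_antisymmetric:
  assumes "finite I" and a: "\<And>i j. i \<in> I \<Longrightarrow> j \<in> I \<Longrightarrow> a i j \<in> carrier R"
    and swap: "\<And>i j. i \<in> I \<Longrightarrow> j \<in> I \<Longrightarrow> a i j = \<ominus> a j i"
    and diag: "\<And>i. i \<in> I \<Longrightarrow> a i i = \<zero>"
  shows "(\<Oplus>j\<in>I. \<Oplus>i\<in>I. a i j) = \<zero>"
  using assms
proof (induction I rule: finite_induct)
  case empty
  show ?case by simp
next
  case (insert x I)
  have cl: "(\<lambda>j. a x j) \<in> I \<rightarrow> carrier R" "(\<lambda>i. a i x) \<in> I \<rightarrow> carrier R"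
    "(\<lambda>j. \<Oplus>i\<in>I. a i j) \<in> I \<rightarrow> carrier R" "\<And>j. j \<in> I \<Longrightarrow> (\<lambda>i. a i j) \<in> I \<rightarrow> carrier R"
    using insert.prems(1) by (auto intro!: finsum_closed)
  have "(\<Oplus>j\<in>insert x I. \<Oplus>i\<in>insert x I. a i j) =
      (\<Oplus>i\<in>insert x I. a i x) \<oplus> (\<Oplus>j\<in>I. \<Oplus>i\<in>insert x I. a i j)"
    using insert.hyps insert.prems(1) by (intro finsum_insert) (auto intro!: finsum_closed)
  also have "(\<Oplus>j\<in>I. \<Oplus>i\<in>insert x I. a i j) = (\<Oplus>j\<in>I. a x j \<oplus> (\<Oplus>i\<in>I. a i j))"
    by (rule finsum_cong') (use insert.hyps insert.prems(1) cl in auto)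
  also have "\<dots> = (\<Oplus>j\<in>I. a x j) \<oplus> (\<Oplus>j\<in>I. \<Oplus>i\<in>I. a i j)"
    using cl by (intro finsum_addf) auto
  also have "(\<Oplus>j\<in>I. \<Oplus>i\<in>I. a i j) = \<zero>"
    by (rule insert.IH) (rule insert.prems; simp)+
  also have "(\<Oplus>i\<in>insert x I. a i x) = a x x \<oplus> (\<Oplus>i\<in>I. a i x)"
    using insert.hyps insert.prems(1) cl by (intro finsum_insert) auto
  also have "(\<Oplus>i\<in>I. a i x) = (\<Oplus>i\<in>I. \<ominus> a x i)"
    by (rule finsum_cong'[OF refl _ insert.prems(2)]) (use insert.prems(1) in auto)
  also have "\<dots> = \<ominus> (\<Oplus>i\<in>I. a x i)"
    by (rule finsum_minus) (use insert.hyps cl in auto)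
  finally show ?case
    using insert.prems(3)[of x] finsum_closed[OF cl(1)] by (simp add: l_neg)
qed

lemma finsum_product:
  assumes "finite I" "finite J" "X \<in> I \<rightarrow> carrier R" "Y \<in> J \<rightarrow> carrier R"
  shows "(\<Oplus>j\<in>J. \<Oplus>i\<in>I. X i \<otimes> Y j) = (\<Oplus>i\<in>I. X i) \<otimes> (\<Oplus>j\<in>J. Y j)"
proof -
  have "(\<Oplus>j\<in>J. \<Oplus>i\<in>I. X i \<otimes> Y j) = (\<Oplus>j\<in>J. (\<Oplus>i\<in>I. X i) \<otimes> Y j)"
    by (rule finsum_cong') (use assms in \<open>auto simp: finsum_ldistr Pi_def intro!: finsum_closed\<close>)
  also have "\<dots> = (\<Oplus>i\<in>I. X i) \<otimes> (\<Oplus>j\<in>J. Y j)"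
    by (rule finsum_rdistr[symmetric]) (use assms in auto)
  finally show ?thesis .
qed

end

text \<open>The setting freed from tensors: \<open>E\<close> solves a linear system with one
  equation for each \<open>k\<close>, and equation \<open>k\<close> involves only variables
  \<open>u i k\<close> that commute with those of every other equation. Brackets within one equation
  are unrestricted.\<close>

locale separated_variables = alternating_biderivation +
  fixes I :: "'i set" and N :: "'k set" and E :: "'i \<Rightarrow> 'a" and u :: "'i \<Rightarrow> 'k \<Rightarrow> 'a"
  assumes I: "finite I"
    and E [simp, intro]: "i \<in> I \<Longrightarrow> E i \<in> carrier R"
    and u [simp, intro]: "\<lbrakk>i \<in> I; k \<in> N\<rbrakk> \<Longrightarrow> u i k \<in> carrier R"
    and rel: "k \<in> N \<Longrightarrow> (\<Oplus>i\<in>I. E i \<otimes> u i k) = \<zero>"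
    and u_commute: "\<lbrakk>i \<in> I; j \<in> I; k \<in> N; l \<in> N; k \<noteq> l\<rbrakk> \<Longrightarrow> br (u i k) (u j l) = \<zero>"
begin

text \<open>This is relation \<open>l\<close> bracketed with \<open>u i k\<close>: in the Leibniz
  rule the terms with \<open>br (u i k) (u j l)\<close> drop out.\<close>

lemma br_u_rel:
  assumes i: "i \<in> I" and k: "k \<in> N" and l: "l \<in> N" and kl: "k \<noteq> l"
  shows "(\<Oplus>j\<in>I. br (u i k) (E j) \<otimes> u j l) = \<zero>"
proof -
  have "(\<Oplus>j\<in>I. br (u i k) (E j) \<otimes> u j l) = (\<Oplus>j\<in>I. br (u i k) (E j \<otimes> u j l))"
    by (rule finsum_cong') (use i k l kl in \<open>auto simp: br_leibniz_r u_commute\<close>)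
  also have "\<dots> = br (u i k) (\<Oplus>j\<in>I. E j \<otimes> u j l)"
    by (rule br_finsum_r[symmetric]) (use i k l I in auto)
  finally show ?thesis
    using rel[OF l] i k by simp
qed

text \<open>For \<open>k \<noteq> l\<close>, relation \<open>k\<close> is bracketed with
  \<open>E j\<close>, multiplied by \<open>u j l\<close> and summed over \<open>j\<close>. The terms
  in which the bracket meets \<open>u i k\<close> are, for each \<open>i\<close>, a multiple of
  \<open>br_u_rel\<close>.\<close>

lemma br_E_rel:
  assumes k: "k \<in> N" and l: "l \<in> N"
  shows "(\<Oplus>j\<in>I. \<Oplus>i\<in>I. br (E i) (E j) \<otimes> (u i k \<otimes> u j l)) = \<zero>"
proof (cases "k = l")
  case True
  show ?thesis unfolding True
  proof (rule finsum_antisymmetric[OF I])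
    fix i j assume ij: "i \<in> I" "j \<in> I"
    show "br (E i) (E j) \<otimes> (u i l \<otimes> u j l) = \<ominus> (br (E j) (E i) \<otimes> (u j l \<otimes> u i l))"
      using ij l br_swap[of "E i" "E j"] by (simp add: l_minus m_comm)
  qed (use l in \<open>auto simp: br_self\<close>)
next
  case False
  let ?a = "\<lambda>i j. br (E i) (E j) \<otimes> (u i k \<otimes> u j l)"
  let ?b = "\<lambda>i j. E i \<otimes> (br (u i k) (E j) \<otimes> u j l)"
  have "(\<Oplus>j\<in>I. \<Oplus>i\<in>I. ?b i j) = (\<Oplus>i\<in>I. \<Oplus>j\<in>I. ?b i j)"
    by (rule finsum_swap) (use I k l in auto)
  also have "\<dots> = (\<Oplus>i\<in>I. \<zero>)"
  proof (rule finsum_cong'[OF refl])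
    fix i assume i: "i \<in> I"
    have "(\<Oplus>j\<in>I. ?b i j) = E i \<otimes> (\<Oplus>j\<in>I. br (u i k) (E j) \<otimes> u j l)"
      by (rule finsum_rdistr[symmetric]) (use I i k l in auto)
    then show "(\<Oplus>j\<in>I. ?b i j) = \<zero>"
      using br_u_rel[OF i k l False] i by simp
  qed simp
  finally have b: "(\<Oplus>j\<in>I. \<Oplus>i\<in>I. ?b i j) = \<zero>" by simp
  have "(\<Oplus>j\<in>I. \<Oplus>i\<in>I. ?b i j) \<oplus> (\<Oplus>j\<in>I. \<Oplus>i\<in>I. ?a i j) =
      (\<Oplus>j\<in>I. (\<Oplus>i\<in>I. ?b i j) \<oplus> (\<Oplus>i\<in>I. ?a i j))"
    by (rule finsum_addf[symmetric]) (use k l in \<open>auto intro!: finsum_closed\<close>)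
  also have "\<dots> = (\<Oplus>j\<in>I. \<zero>)"
  proof (rule finsum_cong'[OF refl])
    fix j assume j: "j \<in> I"
    have "(\<Oplus>i\<in>I. ?b i j) \<oplus> (\<Oplus>i\<in>I. ?a i j) = (\<Oplus>i\<in>I. ?b i j \<oplus> ?a i j)"
      by (rule finsum_addf[symmetric]) (use j k l in auto)
    also have "\<dots> = (\<Oplus>i\<in>I. br (E i \<otimes> u i k) (E j) \<otimes> u j l)"
    proof (rule finsum_cong'[OF refl])
      fix i assume i: "i \<in> I"
      show "?b i j \<oplus> ?a i j = br (E i \<otimes> u i k) (E j) \<otimes> u j l"
        using i j k l by (simp add: br_leibniz_l l_distr m_assoc)
    qed (use j k l in auto)
    also have "\<dots> = (\<Oplus>i\<in>I. br (E i \<otimes> u i k) (E j)) \<otimes> u j l"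
      by (rule finsum_ldistr[symmetric]) (use I j k l in auto)
    also have "(\<Oplus>i\<in>I. br (E i \<otimes> u i k) (E j)) = br (\<Oplus>i\<in>I. E i \<otimes> u i k) (E j)"
      by (rule br_finsum_l[symmetric]) (use I j k in auto)
    finally show "(\<Oplus>i\<in>I. ?b i j) \<oplus> (\<Oplus>i\<in>I. ?a i j) = \<zero>"
      using rel[OF k] j l by simp
  qed simp
  finally show ?thesis
    using b k l by (simp add: finsum_closed Pi_def)
qed

text \<open>\<open>E z\<close> times this is the numerator of \<open>{E i / E z, E j / E z}\<close>.\<close>

definition reduced_num :: "'i \<Rightarrow> 'i \<Rightarrow> 'i \<Rightarrow> 'a"
  where "reduced_num z i j = E z \<otimes> br (E i) (E j) \<ominus> E j \<otimes> br (E i) (E z) \<ominus> E i \<otimes> br (E z) (E j)"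

lemma reduced_num_closed [simp, intro]: "\<lbrakk>z \<in> I; i \<in> I; j \<in> I\<rbrakk> \<Longrightarrow> reduced_num z i j \<in> carrier R"
  by (simp add: reduced_num_def)

text \<open>The first term of \<open>reduced_num\<close> contributes a multiple of
  \<open>br_E_rel\<close>. In each of the other two the double sum factors into two single sums, one
  of which is the relation for \<open>l\<close> or for \<open>k\<close>.\<close>

lemma reduced_num_rel:
  assumes z: "z \<in> I" and k: "k \<in> N" and l: "l \<in> N"
  shows "(\<Oplus>j\<in>I. \<Oplus>i\<in>I. reduced_num z i j \<otimes> (u i k \<otimes> u j l)) = \<zero>"
proof -
  let ?a = "\<lambda>i j. E z \<otimes> (br (E i) (E j) \<otimes> (u i k \<otimes> u j l))"
  let ?b = "\<lambda>i j. (br (E i) (E z) \<otimes> u i k) \<otimes> (E j \<otimes> u j l)"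
  let ?c = "\<lambda>i j. (E i \<otimes> u i k) \<otimes> (br (E z) (E j) \<otimes> u j l)"
  have a: "(\<Oplus>j\<in>I. \<Oplus>i\<in>I. ?a i j) = \<zero>"
  proof -
    have "(\<Oplus>j\<in>I. \<Oplus>i\<in>I. ?a i j) = (\<Oplus>j\<in>I. E z \<otimes> (\<Oplus>i\<in>I. br (E i) (E j) \<otimes> (u i k \<otimes> u j l)))"
      by (rule finsum_cong') (use I z k l in \<open>auto simp: finsum_rdistr Pi_def intro!: finsum_closed\<close>)
    also have "\<dots> = E z \<otimes> (\<Oplus>j\<in>I. \<Oplus>i\<in>I. br (E i) (E j) \<otimes> (u i k \<otimes> u j l))"
      by (rule finsum_rdistr[symmetric]) (use I z k l in \<open>auto intro!: finsum_closed\<close>)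
    finally show ?thesis using br_E_rel[OF k l] z by simp
  qed
  have b: "(\<Oplus>j\<in>I. \<Oplus>i\<in>I. ?b i j) = \<zero>"
    by (subst finsum_product) (use I z k l in \<open>auto simp: rel intro!: finsum_closed r_null\<close>)
  have c: "(\<Oplus>j\<in>I. \<Oplus>i\<in>I. ?c i j) = \<zero>"
    by (subst finsum_product) (use I z k l in \<open>auto simp: rel intro!: finsum_closed l_null\<close>)
  \<comment> \<open>The two corrections are added back to the summand, so that only sums, and no
    differences, have to be split.\<close>
  have expand: "reduced_num z i j \<otimes> (u i k \<otimes> u j l) \<oplus> (?b i j \<oplus> ?c i j) = ?a i j" if "i \<in> I" "j \<in> I" for i j
    unfolding reduced_num_def
    using that E[of i] E[of j] E[OF z] br_closed[of "E i" "E j"] br_closed[of "E i" "E z"]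
      br_closed[of "E z" "E j"] u[of i k] u[of j l] k l by algebra
  let ?p = "\<lambda>i j. reduced_num z i j \<otimes> (u i k \<otimes> u j l)"
  have cl: "(\<lambda>j. \<Oplus>i\<in>I. ?p i j) \<in> I \<rightarrow> carrier R" "(\<lambda>j. \<Oplus>i\<in>I. ?b i j) \<in> I \<rightarrow> carrier R"
    "(\<lambda>j. \<Oplus>i\<in>I. ?c i j) \<in> I \<rightarrow> carrier R"
    using z k l by (auto intro!: finsum_closed)
  have "\<zero> = (\<Oplus>j\<in>I. \<Oplus>i\<in>I. ?a i j)" using a by simp
  also have "\<dots> = (\<Oplus>j\<in>I. \<Oplus>i\<in>I. ?p i j \<oplus> (?b i j \<oplus> ?c i j))"
  proof (rule finsum_cong'[OF refl])
    show "(\<lambda>j. \<Oplus>i\<in>I. ?p i j \<oplus> (?b i j \<oplus> ?c i j)) \<in> I \<rightarrow> carrier R"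
      using z k l by (intro Pi_I finsum_closed) auto
    show "(\<Oplus>i\<in>I. ?a i j) = (\<Oplus>i\<in>I. ?p i j \<oplus> (?b i j \<oplus> ?c i j))" if "j \<in> I" for j
      by (rule finsum_cong') (use expand z k l that in auto)
  qed
  also have "\<dots> = (\<Oplus>j\<in>I. (\<Oplus>i\<in>I. ?p i j) \<oplus> ((\<Oplus>i\<in>I. ?b i j) \<oplus> (\<Oplus>i\<in>I. ?c i j)))"
    by (rule finsum_cong') (use z k l in \<open>auto simp: finsum_addf Pi_def intro!: finsum_closed\<close>)
  also have "\<dots> = (\<Oplus>j\<in>I. \<Oplus>i\<in>I. ?p i j) \<oplus> ((\<Oplus>j\<in>I. \<Oplus>i\<in>I. ?b i j) \<oplus> (\<Oplus>j\<in>I. \<Oplus>i\<in>I. ?c i j))"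
    using cl by (simp add: finsum_addf Pi_def)
  finally show ?thesis
    using b c finsum_closed[OF cl(1)] by simp
qed

text \<open>This makes the system square: with the index \<open>z\<close> gone from both sums, the
  matrix that remains is \<open>u\<close> on \<open>N\<close>.\<close>

lemma reduced_num_base_zero:
  assumes "z \<in> I" "i \<in> I"
  shows "reduced_num z z i = \<zero>" "reduced_num z i z = \<zero>"
  using assms by (simp_all add: reduced_num_def br_self minus_eq r_neg)

end

text \<open>\<open>N\<close> indexes both the equations and the unknowns other than
  \<open>z\<close>, so \<open>u\<close> restricted to \<open>N\<close> is a square matrix.\<close>

locale separated_variables_domain = separated_variables R br "insert z N" N E u + domain R
  for R (structure) and br z and N :: "'i set" and E u +
  assumes z: "z \<notin> N"
    and det: "leibniz_det R N u \<noteq> \<zero>"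
begin

text \<open>With \<open>P = reduced_num z\<close> and \<open>F = u\<close> on \<open>N\<close>, the
  relation reads \<open>(F^T P) F = 0\<close>. Since the determinant can be cancelled, the rows of
  \<open>F^T P\<close> vanish; then \<open>F^T P = 0\<close> is a relation for each column of
  \<open>P\<close>, and the same argument gives \<open>P = 0\<close>.\<close>

lemma reduced_num_zero:
  assumes i: "i \<in> N" and j: "j \<in> N"
  shows "reduced_num z i j = \<zero>"
proof -
  have N: "finite N" using I by simp
  have cancel: "x = \<zero>" if "x \<in> carrier R" "x \<otimes> leibniz_det R N u = \<zero>" for x
    using that det leibniz_det_closed[of N u] integral[of x "leibniz_det R N u"] by auto
  have 1: "(\<Oplus>i\<in>N. reduced_num z i j \<otimes> u i k) = \<zero>" if k: "k \<in> N" for k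
  proof (rule cancel)
    \<comment> \<open>Row \<open>k\<close> of \<open>F^T P\<close>, as a vector in
      \<open>j\<close>.\<close>
    let ?x = "\<lambda>j. \<Oplus>i\<in>N. reduced_num z i j \<otimes> u i k"
    show "?x j \<otimes> leibniz_det R N u = \<zero>"
    proof (rule leibniz_det_kernel[OF N _ _ _ j])
      fix l assume l: "l \<in> N"
      have "\<zero> = (\<Oplus>j\<in>insert z N. \<Oplus>i\<in>insert z N. reduced_num z i j \<otimes> (u i k \<otimes> u j l))"
        using reduced_num_rel[OF _ k l] by simp
      also have "\<dots> = (\<Oplus>j\<in>insert z N. \<Oplus>i\<in>N. reduced_num z i j \<otimes> (u i k \<otimes> u j l))"
        by (rule finsum_cong') (use N z k l in \<open>auto simp: Pi_def reduced_num_base_zero intro!: finsum_closed\<close>)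
      also have "\<dots> = (\<Oplus>j\<in>N. \<Oplus>i\<in>N. reduced_num z i j \<otimes> (u i k \<otimes> u j l))"
      proof -
        have "(\<Oplus>i\<in>N. reduced_num z i z \<otimes> (u i k \<otimes> u z l)) = (\<Oplus>i\<in>N. \<zero>)"
          by (rule finsum_cong') (use k l in \<open>auto simp: reduced_num_base_zero\<close>)
        then show ?thesis
          using N z k l by (subst finsum_insert) (auto intro!: finsum_closed l_zero)
      qed
      also have "\<dots> = (\<Oplus>j\<in>N. ?x j \<otimes> u j l)"
      proof (rule finsum_cong'[OF refl])
        fix j assume j: "j \<in> N"
        have "?x j \<otimes> u j l = (\<Oplus>i\<in>N. reduced_num z i j \<otimes> u i k \<otimes> u j l)"
          by (rule finsum_ldistr) (use N j k l in auto)
        also have "\<dots> = (\<Oplus>i\<in>N. reduced_num z i j \<otimes> (u i k \<otimes> u j l))"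
          by (rule finsum_cong') (use j k l in \<open>auto simp: m_assoc\<close>)
        finally show "(\<Oplus>i\<in>N. reduced_num z i j \<otimes> (u i k \<otimes> u j l)) = ?x j \<otimes> u j l" by simp
      qed (use k l in \<open>auto intro!: finsum_closed\<close>)
      finally show "(\<Oplus>j\<in>N. ?x j \<otimes> u j l) = \<zero>" by simp
    qed (use k in \<open>auto intro!: finsum_closed\<close>)
  qed (use k j in \<open>auto intro!: finsum_closed\<close>)
  show ?thesis
    by (rule cancel[OF _ leibniz_det_kernel[OF N _ _ 1 i]]) (use i j in auto)
qed

lemma br_num_zero:
  assumes i: "i \<in> N" and j: "j \<in> N"
  shows "br_num (E i) (E z) (E j) (E z) = \<zero>"
proof -
  have "br_num (E i) (E z) (E j) (E z) = E z \<otimes> reduced_num z i j \<oplus> (E i \<otimes> E j) \<otimes> br (E z) (E z)"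
  proof -
    have "E i \<in> carrier R" "E j \<in> carrier R" "E z \<in> carrier R" using i j by auto
    then show ?thesis
      unfolding br_num_def reduced_num_def
      using br_closed[of "E i" "E j"] br_closed[of "E i" "E z"] br_closed[of "E z" "E j"]
        br_closed[of "E z" "E z"] by algebra
  qed
  then show ?thesis
    using reduced_num_zero[OF i j] i j by (simp add: br_self)
qed

end

section \<open>Monoid algebras\<close>

text \<open>The coefficient \<open>r\<close> is part of the element because the maps used below are
  only additive: these elements generate the monoid algebra as an abelian group.\<close>

definition monom_elem :: "('k, 'r) ring_scheme \<Rightarrow> 'k \<Rightarrow> 'm \<Rightarrow> 'm \<Rightarrow> 'k"
  where "monom_elem K r x = (\<lambda>z. if z = x then r else \<zero>\<^bsub>K\<^esub>)"

lemma single_eq_monom_elem: "single K x = monom_elem K \<one>\<^bsub>K\<^esub> x"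
  by (simp add: single_def monom_elem_def)

section \<open>Additive homomorphisms\<close>

lemma add_hom_iff:
  "\<phi> \<in> hom (add_monoid G) (add_monoid H) \<longleftrightarrow>
    \<phi> \<in> carrier G \<rightarrow> carrier H \<and>
    (\<forall>x\<in>carrier G. \<forall>y\<in>carrier G. \<phi> (x \<oplus>\<^bsub>G\<^esub> y) = \<phi> x \<oplus>\<^bsub>H\<^esub> \<phi> y)"
  by (auto simp: hom_def)

lemma add_hom_closed:
  "\<lbrakk>\<phi> \<in> hom (add_monoid G) (add_monoid H); x \<in> carrier G\<rbrakk> \<Longrightarrow> \<phi> x \<in> carrier H"
  by (auto simp: add_hom_iff)

lemma add_hom_add:
  "\<lbrakk>\<phi> \<in> hom (add_monoid G) (add_monoid H); x \<in> carrier G; y \<in> carrier G\<rbrakk> \<Longrightarrow>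
    \<phi> (x \<oplus>\<^bsub>G\<^esub> y) = \<phi> x \<oplus>\<^bsub>H\<^esub> \<phi> y"
  by (auto simp: add_hom_iff)

lemma add_hom_zero:
  assumes "abelian_group G" "abelian_group H" "\<phi> \<in> hom (add_monoid G) (add_monoid H)"
  shows "\<phi> \<zero>\<^bsub>G\<^esub> = \<zero>\<^bsub>H\<^esub>"
  using hom_one[OF assms(3) abelian_group.a_group[OF assms(1)] abelian_group.a_group[OF assms(2)]] by simp

lemma add_hom_minus:
  assumes "abelian_group G" "abelian_group H" "\<phi> \<in> hom (add_monoid G) (add_monoid H)"
    and "x \<in> carrier G" "y \<in> carrier G"
  shows "\<phi> (x \<ominus>\<^bsub>G\<^esub> y) = \<phi> x \<ominus>\<^bsub>H\<^esub> \<phi> y"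
proof -
  interpret G: abelian_group G by fact
  interpret H: abelian_group H by fact
  interpret h: group_hom "add_monoid G" "add_monoid H" \<phi>
    using assms(3) G.a_group H.a_group by (simp add: group_hom_def group_hom_axioms_def)
  show ?thesis
    using assms(4,5) add_hom_add[OF assms(3), of x "\<ominus>\<^bsub>G\<^esub> y"] h.hom_inv[of y]
    by (simp add: a_minus_def a_inv_def)
qed

lemma add_hom_finsum:
  assumes "abelian_group G" "abelian_group H" "\<phi> \<in> hom (add_monoid G) (add_monoid H)"
    and "finite S" "g \<in> S \<rightarrow> carrier G"
  shows "\<phi> (\<Oplus>\<^bsub>G\<^esub>x\<in>S. g x) = (\<Oplus>\<^bsub>H\<^esub>x\<in>S. \<phi> (g x))"
  using assms(4,5)
proof (induction S rule: finite_induct)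
  case empty
  interpret G: abelian_group G by fact
  interpret H: abelian_group H by fact
  show ?case using add_hom_zero[OF assms(1-3)] by simp
next
  case (insert s S)
  interpret G: abelian_group G by fact
  interpret H: abelian_group H by fact
  show ?case
    using insert add_hom_closed[OF assms(3)] add_hom_add[OF assms(3)]
    by (simp add: Pi_def)
qed

lemma add_hom_comp:
  "\<lbrakk>\<phi> \<in> hom (add_monoid G) (add_monoid H); \<psi> \<in> hom (add_monoid H) (add_monoid L)\<rbrakk> \<Longrightarrow>
    (\<lambda>x. \<psi> (\<phi> x)) \<in> hom (add_monoid G) (add_monoid L)"
  by (simp add: add_hom_iff Pi_iff)

text \<open>The additive group of the monoid algebra is a direct sum of copies of the additive group
  of \<open>K\<close>; this is the map out of it with components \<open>\<phi> x\<close>.\<close>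

definition lin_ext ::
    "('k, 'r) ring_scheme \<Rightarrow> ('g, 's) ring_scheme \<Rightarrow> ('m \<Rightarrow> 'k \<Rightarrow> 'g) \<Rightarrow> ('m \<Rightarrow> 'k) \<Rightarrow> 'g"
  where "lin_ext K G \<phi> c = (\<Oplus>\<^bsub>G\<^esub>x\<in>supp K c. \<phi> x (c x))"

locale comm_monoid_algebra = K?: cring K + M?: comm_monoid M
  for K (structure) and M (structure)
begin

abbreviation F where "F \<equiv> monoid_algebra K M"
abbreviation mon where "mon \<equiv> monom_elem K"

lemma carrier_iff:
  "c \<in> carrier F \<longleftrightarrow> range c \<subseteq> carrier K \<and> finite (supp K c) \<and> supp K c \<subseteq> carrier M"
  by (simp add: monoid_algebra_def)

lemma add_apply: "(c \<oplus>\<^bsub>F\<^esub> d) z = c z \<oplus> d z"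
  by (simp add: monoid_algebra_def)

lemma zero_apply: "\<zero>\<^bsub>F\<^esub> z = \<zero>"
  by (simp add: monoid_algebra_def)

lemma smult_apply: "(r \<odot>\<^bsub>F\<^esub> c) z = r \<otimes> c z"
  by (simp add: monoid_algebra_def)

lemma coeff_closed [simp, intro]: "c \<in> carrier F \<Longrightarrow> c z \<in> carrier K"
  by (auto simp: carrier_iff)

lemma supp_finite: "c \<in> carrier F \<Longrightarrow> finite (supp K c)"
  by (simp add: carrier_iff)

lemma supp_subset: "c \<in> carrier F \<Longrightarrow> supp K c \<subseteq> carrier M"
  by (simp add: carrier_iff)

lemma carrierI:
  assumes "\<And>z. c z \<in> carrier K" "finite S" "S \<subseteq> carrier M" "\<And>z. z \<notin> S \<Longrightarrow> c z = \<zero>"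
  shows "c \<in> carrier F"
proof -
  have "supp K c \<subseteq> S" using assms(4) by (auto simp: supp_def)
  then show ?thesis
    using assms finite_subset by (auto simp: carrier_iff)
qed

lemma mon_closed [simp, intro]: "\<lbrakk>r \<in> carrier K; x \<in> carrier M\<rbrakk> \<Longrightarrow> mon r x \<in> carrier F"
  by (rule carrierI[of _ "{x}"]) (auto simp: monom_elem_def)

lemma mon_add:
  "\<lbrakk>r \<in> carrier K; s \<in> carrier K\<rbrakk> \<Longrightarrow> mon (r \<oplus> s) x = mon r x \<oplus>\<^bsub>F\<^esub> mon s x"
  by (rule ext) (simp add: add_apply monom_elem_def)

lemma smult_mon: "\<lbrakk>r \<in> carrier K; s \<in> carrier K\<rbrakk> \<Longrightarrow> r \<odot>\<^bsub>F\<^esub> mon s x = mon (r \<otimes> s) x"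
  by (rule ext) (simp add: smult_apply monom_elem_def)

lemma add_closed: "\<lbrakk>c \<in> carrier F; d \<in> carrier F\<rbrakk> \<Longrightarrow> c \<oplus>\<^bsub>F\<^esub> d \<in> carrier F"
  by (rule carrierI[of _ "supp K c \<union> supp K d"])
     (auto simp: add_apply supp_finite dest: supp_subset, simp add: supp_def)

lemma abelian_group_F: "abelian_group F"
proof (rule abelian_groupI)
  show "\<zero>\<^bsub>F\<^esub> \<in> carrier F"
    by (rule carrierI[of _ "{}"]) (auto simp: zero_apply)
  fix c assume c: "c \<in> carrier F"
  show "\<exists>d\<in>carrier F. d \<oplus>\<^bsub>F\<^esub> c = \<zero>\<^bsub>F\<^esub>"
  proof (rule bexI[of _ "\<lambda>z. \<ominus> c z"])
    show "(\<lambda>z. \<ominus> c z) \<oplus>\<^bsub>F\<^esub> c = \<zero>\<^bsub>F\<^esub>"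
      by (rule ext) (simp add: add_apply zero_apply c K.l_neg)
    show "(\<lambda>z. \<ominus> c z) \<in> carrier F"
      by (rule carrierI[of _ "supp K c"]) (use c in \<open>auto simp: supp_finite dest: supp_subset\<close>, simp add: supp_def)
  qed
qed (auto intro!: add_closed simp: add_apply zero_apply fun_eq_iff K.a_ac)

sublocale F: abelian_group F
  by (rule abelian_group_F)

lemma finsum_apply:
  assumes "finite S" "g \<in> S \<rightarrow> carrier F"
  shows "(\<Oplus>\<^bsub>F\<^esub>x\<in>S. g x) z = (\<Oplus>x\<in>S. g x z)"
  using assms by (induction S) (auto simp: add_apply zero_apply Pi_def)

text \<open>Induction on a finite set containing the support: one coefficient is set to zero and put
  back as a monomial.\<close>

lemma F_induct [consumes 1, case_names zero add]:
  assumes c: "c \<in> carrier F"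
    and zero: "Q \<zero>\<^bsub>F\<^esub>"
    and add: "\<And>c r x. \<lbrakk>c \<in> carrier F; Q c; r \<in> carrier K; x \<in> carrier M\<rbrakk> \<Longrightarrow> Q (c \<oplus>\<^bsub>F\<^esub> mon r x)"
  shows "Q c"
proof -
  have "Q c" if "finite S" "supp K c \<subseteq> S" "c \<in> carrier F" for S c
    using that
  proof (induction S arbitrary: c rule: finite_induct)
    case empty
    then have "c = \<zero>\<^bsub>F\<^esub>" by (auto simp: supp_def zero_apply fun_eq_iff)
    then show ?case using zero by simp
  next
    case (insert x S)
    show ?case
    proof (cases "x \<in> carrier M")
      case False
      then show ?thesis using insert supp_subset[of c] by blast
    next
      case True
      let ?c = "c(x := \<zero>)"
      have c': "?c \<in> carrier F"
        by (rule carrierI[of _ "supp K c"])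
           (use insert.prems in \<open>auto simp: supp_finite dest: supp_subset\<close>, simp add: supp_def)
      have "supp K ?c \<subseteq> S" using insert.prems by (auto simp: supp_def)
      then have "Q ?c" using insert.IH c' by blast
      then have "Q (?c \<oplus>\<^bsub>F\<^esub> mon (c x) x)"
        using add c' True insert.prems by blast
      also have "?c \<oplus>\<^bsub>F\<^esub> mon (c x) x = c"
        using insert.prems by (auto simp: fun_eq_iff add_apply monom_elem_def)
      finally show ?thesis .
    qed
  qed
  then show ?thesis using c supp_finite by blast
qed

text \<open>Laws that are additive in an argument are checked on monomials in it by this lemma, one
  argument at a time.\<close>

lemma hom_eqI:
  assumes G: "abelian_group G"
    and \<phi>: "\<phi> \<in> hom (add_monoid F) (add_monoid G)" and \<psi>: "\<psi> \<in> hom (add_monoid F) (add_monoid G)"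
    and mon: "\<And>r x. \<lbrakk>r \<in> carrier K; x \<in> carrier M\<rbrakk> \<Longrightarrow> \<phi> (mon r x) = \<psi> (mon r x)"
    and c: "c \<in> carrier F"
  shows "\<phi> c = \<psi> c"
  using c
proof (induction rule: F_induct)
  case zero
  show ?case using add_hom_zero[OF abelian_group_F G] \<phi> \<psi> by metis
next
  case (add c r x)
  then show ?case using add_hom_add[OF \<phi>] add_hom_add[OF \<psi>] mon by simp
qed

text \<open>Points outside the support contribute \<open>\<phi> x \<zero>\<close>, which vanishes by
  additivity; so elements with different supports can be summed over one common set.\<close>

lemma lin_ext_superset:
  assumes G: "abelian_group G" and c: "c \<in> carrier F"
    and \<phi>: "\<And>x. x \<in> carrier M \<Longrightarrow> \<phi> x \<in> hom (add_monoid K) (add_monoid G)"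
    and S: "finite S" "supp K c \<subseteq> S" "S \<subseteq> carrier M"
  shows "lin_ext K G \<phi> c = (\<Oplus>\<^bsub>G\<^esub>x\<in>S. \<phi> x (c x))"
proof -
  interpret G: abelian_group G by fact
  show ?thesis
    unfolding lin_ext_def
  proof (rule G.add.finprod_mono_neutral_cong_left)
    show "\<phi> x (c x) = \<zero>\<^bsub>G\<^esub>" if "x \<in> S - supp K c" for x
      using that S add_hom_zero[OF K.abelian_group_axioms G \<phi>[of x]] by (auto simp: supp_def)
    show "(\<lambda>x. \<phi> x (c x)) \<in> S \<rightarrow> carrier G"
      using S c add_hom_closed[OF \<phi>] by blast
  qed (use S in auto)
qed

lemma lin_ext_hom:
  assumes G: "abelian_group G"
    and \<phi>: "\<And>x. x \<in> carrier M \<Longrightarrow> \<phi> x \<in> hom (add_monoid K) (add_monoid G)"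
  shows "lin_ext K G \<phi> \<in> hom (add_monoid F) (add_monoid G)"
proof -
  interpret G: abelian_group G by fact
  have cl: "\<phi> x (c x) \<in> carrier G" if "x \<in> carrier M" "c \<in> carrier F" for x c
    using that add_hom_closed[OF \<phi>] by blast
  show ?thesis
    unfolding add_hom_iff
  proof (intro conjI Pi_I ballI)
    fix c assume c: "c \<in> carrier F"
    then show "lin_ext K G \<phi> c \<in> carrier G"
      unfolding lin_ext_def using cl supp_subset by (intro G.finsum_closed) blast
    fix d assume d: "d \<in> carrier F"
    let ?S = "supp K c \<union> supp K d"
    have S: "finite ?S" "?S \<subseteq> carrier M"
      using c d supp_finite supp_subset by auto
    have "supp K (c \<oplus>\<^bsub>F\<^esub> d) \<subseteq> ?S" by (auto simp: supp_def add_apply)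
    then have "lin_ext K G \<phi> (c \<oplus>\<^bsub>F\<^esub> d) = (\<Oplus>\<^bsub>G\<^esub>x\<in>?S. \<phi> x ((c \<oplus>\<^bsub>F\<^esub> d) x))"
      using c d S by (intro lin_ext_superset[OF G _ \<phi>]) auto
    also have "\<dots> = (\<Oplus>\<^bsub>G\<^esub>x\<in>?S. \<phi> x (c x) \<oplus>\<^bsub>G\<^esub> \<phi> x (d x))"
    proof (rule G.finsum_cong'[OF refl])
      show "(\<lambda>x. \<phi> x (c x) \<oplus>\<^bsub>G\<^esub> \<phi> x (d x)) \<in> ?S \<rightarrow> carrier G"
        using S cl c d by blast
      show "\<phi> x ((c \<oplus>\<^bsub>F\<^esub> d) x) = \<phi> x (c x) \<oplus>\<^bsub>G\<^esub> \<phi> x (d x)" if "x \<in> ?S" for x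
        using that S c d add_hom_add[OF \<phi>[of x]] by (auto simp: add_apply)
    qed
    also have "\<dots> = (\<Oplus>\<^bsub>G\<^esub>x\<in>?S. \<phi> x (c x)) \<oplus>\<^bsub>G\<^esub> (\<Oplus>\<^bsub>G\<^esub>x\<in>?S. \<phi> x (d x))"
      using S cl c d by (intro G.finsum_addf) blast+
    also have "\<dots> = lin_ext K G \<phi> c \<oplus>\<^bsub>G\<^esub> lin_ext K G \<phi> d"
      using c d S by (simp add: lin_ext_superset[OF G _ \<phi>, where S="?S"])
    finally show "lin_ext K G \<phi> (c \<oplus>\<^bsub>F\<^esub> d) = lin_ext K G \<phi> c \<oplus>\<^bsub>G\<^esub> lin_ext K G \<phi> d" .
  qed
qed

lemma lin_ext_mon:
  assumes G: "abelian_group G"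
    and \<phi>: "\<And>x. x \<in> carrier M \<Longrightarrow> \<phi> x \<in> hom (add_monoid K) (add_monoid G)"
    and r: "r \<in> carrier K" and x: "x \<in> carrier M"
  shows "lin_ext K G \<phi> (mon r x) = \<phi> x r"
proof -
  interpret G: abelian_group G by fact
  have "lin_ext K G \<phi> (mon r x) = (\<Oplus>\<^bsub>G\<^esub>y\<in>{x}. \<phi> y (mon r x y))"
    by (rule lin_ext_superset[OF G mon_closed[OF r x] \<phi>]) (use r x in \<open>auto simp: supp_def monom_elem_def\<close>)
  also have "\<dots> = \<phi> x r"
    using add_hom_closed[OF \<phi>[OF x] r] by (simp add: monom_elem_def)
  finally show ?thesis .
qed

text \<open>\<open>L\<close> is left open because the parameter is a coefficient in one application
  and an element of the monoid algebra in the other.\<close>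

lemma lin_ext_param_hom:
  assumes G: "abelian_group G"
    and l: "\<And>y s. \<lbrakk>y \<in> carrier M; s \<in> carrier K\<rbrakk> \<Longrightarrow> (\<lambda>r. \<phi> r y s) \<in> hom (add_monoid L) (add_monoid G)"
    and d: "d \<in> carrier F"
  shows "(\<lambda>r. lin_ext K G (\<phi> r) d) \<in> hom (add_monoid L) (add_monoid G)"
proof -
  interpret G: abelian_group G by fact
  have cl: "\<phi> r y (d y) \<in> carrier G" if "r \<in> carrier L" "y \<in> supp K d" for r y
    using that supp_subset[OF d] d add_hom_closed[OF l] by blast
  show ?thesis
    unfolding add_hom_iff
  proof (intro conjI Pi_I ballI)
    fix r assume r: "r \<in> carrier L"
    show "lin_ext K G (\<phi> r) d \<in> carrier G"
      unfolding lin_ext_def using cl r by (intro G.finsum_closed) blast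
    fix s assume s: "s \<in> carrier L"
    have "lin_ext K G (\<phi> (r \<oplus>\<^bsub>L\<^esub> s)) d = (\<Oplus>\<^bsub>G\<^esub>y\<in>supp K d. \<phi> r y (d y) \<oplus>\<^bsub>G\<^esub> \<phi> s y (d y))"
      unfolding lin_ext_def
    proof (rule G.finsum_cong'[OF refl])
      show "(\<lambda>y. \<phi> r y (d y) \<oplus>\<^bsub>G\<^esub> \<phi> s y (d y)) \<in> supp K d \<rightarrow> carrier G"
        using cl r s by blast
      show "\<phi> (r \<oplus>\<^bsub>L\<^esub> s) y (d y) = \<phi> r y (d y) \<oplus>\<^bsub>G\<^esub> \<phi> s y (d y)" if "y \<in> supp K d" for y
        using that supp_subset[OF d] d r s add_hom_add[OF l[of y "d y"]] by blast
    qed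
    also have "\<dots> = lin_ext K G (\<phi> r) d \<oplus>\<^bsub>G\<^esub> lin_ext K G (\<phi> s) d"
      unfolding lin_ext_def using cl r s by (intro G.finsum_addf) blast+
    finally show "lin_ext K G (\<phi> (r \<oplus>\<^bsub>L\<^esub> s)) d = lin_ext K G (\<phi> r) d \<oplus>\<^bsub>G\<^esub> lin_ext K G (\<phi> s) d" .
  qed
qed

text \<open>Common source of the product of the monoid algebra and of \<open>free_bracket\<close>:
  both are nested sums over two supports whose summand is additive in each coefficient.\<close>

lemma bilin_ext:
  assumes G: "abelian_group G"
    and l: "\<And>x y s. \<lbrakk>x \<in> carrier M; y \<in> carrier M; s \<in> carrier K\<rbrakk> \<Longrightarrow>
      (\<lambda>r. \<phi> x r y s) \<in> hom (add_monoid K) (add_monoid G)"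
    and r: "\<And>x r y. \<lbrakk>x \<in> carrier M; r \<in> carrier K; y \<in> carrier M\<rbrakk> \<Longrightarrow>
      \<phi> x r y \<in> hom (add_monoid K) (add_monoid G)"
  defines "B \<equiv> \<lambda>c d. lin_ext K G (\<lambda>x r. lin_ext K G (\<phi> x r) d) c"
  shows "d \<in> carrier F \<Longrightarrow> (\<lambda>c. B c d) \<in> hom (add_monoid F) (add_monoid G)"
    and "c \<in> carrier F \<Longrightarrow> B c \<in> hom (add_monoid F) (add_monoid G)"
    and "\<lbrakk>s \<in> carrier K; x \<in> carrier M; t \<in> carrier K; y \<in> carrier M\<rbrakk> \<Longrightarrow>
      B (mon s x) (mon t y) = \<phi> x s y t"
proof -
  have inner: "(\<lambda>r. lin_ext K G (\<phi> x r) d) \<in> hom (add_monoid K) (add_monoid G)"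
    if "x \<in> carrier M" "d \<in> carrier F" for x d
    by (rule lin_ext_param_hom[OF G]) (use that l in auto)
  show "(\<lambda>c. B c d) \<in> hom (add_monoid F) (add_monoid G)" if "d \<in> carrier F"
    unfolding B_def by (rule lin_ext_hom[OF G inner]) (use that in auto)
  have outer: "(\<lambda>d. lin_ext K G (\<phi> x r) d) \<in> hom (add_monoid F) (add_monoid G)"
    if "x \<in> carrier M" "r \<in> carrier K" for x r
    by (rule lin_ext_hom[OF G]) (use r that in simp)
  show "B c \<in> hom (add_monoid F) (add_monoid G)" if "c \<in> carrier F"
    unfolding B_def by (rule lin_ext_param_hom[OF G outer]) (use that in auto)
  assume *: "s \<in> carrier K" "x \<in> carrier M" "t \<in> carrier K" "y \<in> carrier M"
  have "B (mon s x) (mon t y) = lin_ext K G (\<phi> x s) (mon t y)"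
    unfolding B_def by (rule lin_ext_mon[OF G inner]) (use * in auto)
  also have "\<dots> = \<phi> x s y t"
    by (rule lin_ext_mon[OF G r]) (use * in auto)
  finally show "B (mon s x) (mon t y) = \<phi> x s y t" .
qed

section \<open>Ring structure of a monoid algebra\<close>

lemma mon_mult_hom:
  assumes "x \<in> carrier M" "s \<in> carrier K"
  shows "(\<lambda>r. mon (r \<otimes> s) x) \<in> hom (add_monoid K) (add_monoid F)"
    "(\<lambda>r. mon (s \<otimes> r) x) \<in> hom (add_monoid K) (add_monoid F)"
  using assms by (auto simp: add_hom_iff mon_add K.l_distr K.r_distr)

text \<open>The product is defined coefficient by coefficient; evaluating the nested sum at
  \<open>z\<close> gives the same value, which makes \<open>bilin_ext\<close> applicable.\<close>

lemma mult_eq_lin_ext: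
  assumes c: "c \<in> carrier F" and d: "d \<in> carrier F"
  shows "c \<otimes>\<^bsub>F\<^esub> d = lin_ext K F (\<lambda>x r. lin_ext K F (\<lambda>y s. mon (r \<otimes> s) (x \<otimes>\<^bsub>M\<^esub> y)) d) c"
proof
  fix z
  have cM: "x \<in> carrier M" if "x \<in> supp K c" for x using that supp_subset[OF c] by blast
  have dM: "x \<in> carrier M" if "x \<in> supp K d" for x using that supp_subset[OF d] by blast
  have in_F: "(\<lambda>y. mon (c x \<otimes> d y) (x \<otimes>\<^bsub>M\<^esub> y)) \<in> supp K d \<rightarrow> carrier F" if "x \<in> supp K c" for x
    using that c d cM dM by auto
  have "lin_ext K F (\<lambda>x r. lin_ext K F (\<lambda>y s. mon (r \<otimes> s) (x \<otimes>\<^bsub>M\<^esub> y)) d) c z =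
      (\<Oplus>x\<in>supp K c. (\<Oplus>\<^bsub>F\<^esub>y\<in>supp K d. mon (c x \<otimes> d y) (x \<otimes>\<^bsub>M\<^esub> y)) z)"
    unfolding lin_ext_def
    by (rule finsum_apply) (use in_F supp_finite[OF c] in \<open>auto intro!: F.finsum_closed\<close>)
  also have "\<dots> = (\<Oplus>x\<in>supp K c. \<Oplus>y\<in>supp K d. mon (c x \<otimes> d y) (x \<otimes>\<^bsub>M\<^esub> y) z)"
  proof (rule K.finsum_cong'[OF refl])
    show "(\<lambda>x. \<Oplus>y\<in>supp K d. mon (c x \<otimes> d y) (x \<otimes>\<^bsub>M\<^esub> y) z) \<in> supp K c \<rightarrow> carrier K"
      using in_F c d by (auto intro!: K.finsum_closed simp: monom_elem_def)
    fix x assume "x \<in> supp K c"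
    then show "(\<Oplus>\<^bsub>F\<^esub>y\<in>supp K d. mon (c x \<otimes> d y) (x \<otimes>\<^bsub>M\<^esub> y)) z =
        (\<Oplus>y\<in>supp K d. mon (c x \<otimes> d y) (x \<otimes>\<^bsub>M\<^esub> y) z)"
      by (intro finsum_apply supp_finite[OF d] in_F)
  qed
  also have "\<dots> = (\<Oplus>x\<in>supp K c. \<Oplus>y\<in>supp K d. if x \<otimes>\<^bsub>M\<^esub> y = z then c x \<otimes> d y else \<zero>)"
    by (simp add: monom_elem_def eq_commute[of z])
  finally show "(c \<otimes>\<^bsub>F\<^esub> d) z = lin_ext K F (\<lambda>x r. lin_ext K F (\<lambda>y s. mon (r \<otimes> s) (x \<otimes>\<^bsub>M\<^esub> y)) d) c z"
    by (simp add: monoid_algebra_def)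
qed

lemma
  shows mult_hom_l: "d \<in> carrier F \<Longrightarrow> (\<lambda>c. c \<otimes>\<^bsub>F\<^esub> d) \<in> hom (add_monoid F) (add_monoid F)"
    and mult_hom_r: "c \<in> carrier F \<Longrightarrow> (\<lambda>d. c \<otimes>\<^bsub>F\<^esub> d) \<in> hom (add_monoid F) (add_monoid F)"
    and mult_mon: "\<lbrakk>r \<in> carrier K; x \<in> carrier M; s \<in> carrier K; y \<in> carrier M\<rbrakk> \<Longrightarrow>
      mon r x \<otimes>\<^bsub>F\<^esub> mon s y = mon (r \<otimes> s) (x \<otimes>\<^bsub>M\<^esub> y)"
proof -
  note B = bilin_ext[OF abelian_group_F, of "\<lambda>x r y s. mon (r \<otimes> s) (x \<otimes>\<^bsub>M\<^esub> y)"]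
  \<comment> \<open>The nested sums represent the product only on the carrier, so the homomorphism
    property has to be carried over.\<close>
  have cong: "\<phi> \<in> hom (add_monoid F) (add_monoid F)"
    if "\<psi> \<in> hom (add_monoid F) (add_monoid F)" "\<And>c. c \<in> carrier F \<Longrightarrow> \<phi> c = \<psi> c" for \<phi> \<psi>
    using that F.a_closed by (auto simp: add_hom_iff)
  show "(\<lambda>c. c \<otimes>\<^bsub>F\<^esub> d) \<in> hom (add_monoid F) (add_monoid F)" if "d \<in> carrier F"
    by (rule cong[OF B(1)[OF _ _ that]]) (use that mult_eq_lin_ext in \<open>auto intro: mon_mult_hom\<close>)
  show "(\<lambda>d. c \<otimes>\<^bsub>F\<^esub> d) \<in> hom (add_monoid F) (add_monoid F)" if "c \<in> carrier F"
    by (rule cong[OF B(2)[OF _ _ that]]) (use that mult_eq_lin_ext in \<open>auto intro: mon_mult_hom\<close>)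
  show "mon r x \<otimes>\<^bsub>F\<^esub> mon s y = mon (r \<otimes> s) (x \<otimes>\<^bsub>M\<^esub> y)"
    if "r \<in> carrier K" "x \<in> carrier M" "s \<in> carrier K" "y \<in> carrier M"
    using B(3)[OF _ _ that] that by (simp add: mult_eq_lin_ext mon_mult_hom)
qed

lemma mult_closed: "\<lbrakk>c \<in> carrier F; d \<in> carrier F\<rbrakk> \<Longrightarrow> c \<otimes>\<^bsub>F\<^esub> d \<in> carrier F"
  by (rule add_hom_closed[OF mult_hom_l])

lemma one_eq_mon: "\<one>\<^bsub>F\<^esub> = mon \<one> \<one>\<^bsub>M\<^esub>"
  by (simp add: monoid_algebra_def monom_elem_def)

text \<open>Commutativity, the unit law and associativity compare maps that are additive in every
  argument, so nested use of \<open>hom_eqI\<close> leaves the corresponding laws of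
  \<open>K\<close> and \<open>M\<close>.\<close>

lemma cring_F: "cring F"
proof (rule cringI)
  show "abelian_group F" by (rule abelian_group_F)
  show "comm_monoid F"
  proof (rule comm_monoidI)
    show "\<one>\<^bsub>F\<^esub> \<in> carrier F" by (simp add: one_eq_mon)
    fix c d assume c: "c \<in> carrier F" and d: "d \<in> carrier F"
    show "c \<otimes>\<^bsub>F\<^esub> d \<in> carrier F" using c d by (rule mult_closed)
    show "\<one>\<^bsub>F\<^esub> \<otimes>\<^bsub>F\<^esub> c = c"
      by (rule hom_eqI[where \<psi>="\<lambda>c. c", OF abelian_group_F mult_hom_r _ _ c])
         (auto simp: one_eq_mon mult_mon add_hom_iff)
    show "c \<otimes>\<^bsub>F\<^esub> d = d \<otimes>\<^bsub>F\<^esub> c"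
    proof (rule hom_eqI[OF abelian_group_F mult_hom_l mult_hom_r _ c])
      fix r x assume rx: "r \<in> carrier K" "x \<in> carrier M"
      show "mon r x \<otimes>\<^bsub>F\<^esub> d = d \<otimes>\<^bsub>F\<^esub> mon r x"
        by (rule hom_eqI[OF abelian_group_F mult_hom_r mult_hom_l _ d])
           (use rx in \<open>auto simp: mult_mon K.m_comm M.m_comm\<close>)
    qed (use d in auto)
    fix e assume e: "e \<in> carrier F"
    show "c \<otimes>\<^bsub>F\<^esub> d \<otimes>\<^bsub>F\<^esub> e = c \<otimes>\<^bsub>F\<^esub> (d \<otimes>\<^bsub>F\<^esub> e)"
    proof (rule hom_eqI[OF abelian_group_F add_hom_comp[OF mult_hom_l mult_hom_l] mult_hom_l _ c])
      fix r x assume rx: "r \<in> carrier K" "x \<in> carrier M"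
      show "mon r x \<otimes>\<^bsub>F\<^esub> d \<otimes>\<^bsub>F\<^esub> e = mon r x \<otimes>\<^bsub>F\<^esub> (d \<otimes>\<^bsub>F\<^esub> e)"
      proof (rule hom_eqI[OF abelian_group_F add_hom_comp[OF mult_hom_r mult_hom_l] add_hom_comp[OF mult_hom_l mult_hom_r] _ d])
        fix s y assume sy: "s \<in> carrier K" "y \<in> carrier M"
        show "mon r x \<otimes>\<^bsub>F\<^esub> mon s y \<otimes>\<^bsub>F\<^esub> e = mon r x \<otimes>\<^bsub>F\<^esub> (mon s y \<otimes>\<^bsub>F\<^esub> e)"
          by (rule hom_eqI[OF abelian_group_F mult_hom_r add_hom_comp[OF mult_hom_r mult_hom_r] _ e])
             (use rx sy in \<open>auto simp: mult_mon K.m_assoc M.m_assoc\<close>)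
      qed (use rx e in auto)
    qed (use d e mult_closed in auto)
  qed
  show "(c \<oplus>\<^bsub>F\<^esub> d) \<otimes>\<^bsub>F\<^esub> e = c \<otimes>\<^bsub>F\<^esub> e \<oplus>\<^bsub>F\<^esub> d \<otimes>\<^bsub>F\<^esub> e"
    if "c \<in> carrier F" "d \<in> carrier F" "e \<in> carrier F" for c d e
    using add_hom_add[OF mult_hom_l] that by blast
qed

lemma smult_closed_F: "\<lbrakk>r \<in> carrier K; c \<in> carrier F\<rbrakk> \<Longrightarrow> r \<odot>\<^bsub>F\<^esub> c \<in> carrier F"
  by (rule carrierI[of _ "supp K c"])
     (auto simp: smult_apply supp_finite dest: supp_subset, simp add: supp_def)

end

section \<open>The tensor ideal\<close>

lemma (in abelian_group) minus_self: "x \<in> carrier G \<Longrightarrow> x \<ominus> x = \<zero>"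
  by (simp add: minus_eq r_neg)

lemma (in abelian_group) minus_eq_zeroD:
  "\<lbrakk>x \<ominus> y = \<zero>; x \<in> carrier G; y \<in> carrier G\<rbrakk> \<Longrightarrow> x = y"
  using minus_equality[of x "\<ominus> y"] by (simp add: minus_eq)

lemma add_hom_sum:
  assumes H: "abelian_group H"
    and \<phi>: "\<And>k. k \<in> S \<Longrightarrow> \<phi> k \<in> hom (add_monoid G) (add_monoid H)"
  shows "(\<lambda>r. \<Oplus>\<^bsub>H\<^esub>k\<in>S. \<phi> k r) \<in> hom (add_monoid G) (add_monoid H)"
proof -
  interpret H: abelian_group H by fact
  have cl: "(\<lambda>k. \<phi> k r) \<in> S \<rightarrow> carrier H" if "r \<in> carrier G" for r
    using add_hom_closed[OF \<phi>] that by simp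
  show ?thesis
    unfolding add_hom_iff
  proof (intro conjI Pi_I ballI)
    fix r s assume r: "r \<in> carrier G" and s: "s \<in> carrier G"
    have "(\<Oplus>\<^bsub>H\<^esub>k\<in>S. \<phi> k (r \<oplus>\<^bsub>G\<^esub> s)) = (\<Oplus>\<^bsub>H\<^esub>k\<in>S. \<phi> k r \<oplus>\<^bsub>H\<^esub> \<phi> k s)"
      using cl[OF r] cl[OF s] add_hom_add[OF \<phi> r s] by (intro H.finsum_cong') auto
    also have "\<dots> = (\<Oplus>\<^bsub>H\<^esub>k\<in>S. \<phi> k r) \<oplus>\<^bsub>H\<^esub> (\<Oplus>\<^bsub>H\<^esub>k\<in>S. \<phi> k s)"
      by (rule H.finsum_addf[OF cl[OF r] cl[OF s]])
    finally show "(\<Oplus>\<^bsub>H\<^esub>k\<in>S. \<phi> k (r \<oplus>\<^bsub>G\<^esub> s)) = (\<Oplus>\<^bsub>H\<^esub>k\<in>S. \<phi> k r) \<oplus>\<^bsub>H\<^esub> (\<Oplus>\<^bsub>H\<^esub>k\<in>S. \<phi> k s)" .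
  qed (use cl in \<open>auto intro: H.finsum_closed\<close>)
qed

lemma add_hom_plus:
  assumes "abelian_group H"
    and "\<phi> \<in> hom (add_monoid G) (add_monoid H)" "\<psi> \<in> hom (add_monoid G) (add_monoid H)"
  shows "(\<lambda>x. \<phi> x \<oplus>\<^bsub>H\<^esub> \<psi> x) \<in> hom (add_monoid G) (add_monoid H)"
proof -
  interpret abelian_group H by fact
  show ?thesis using assms(2,3) by (simp add: add_hom_iff Pi_iff a_ac)
qed

lemma add_hom_const_zero:
  assumes "abelian_group H"
  shows "(\<lambda>x. \<zero>\<^bsub>H\<^esub>) \<in> hom (add_monoid G) (add_monoid H)"
proof -
  interpret abelian_group H by fact
  show ?thesis by (simp add: add_hom_iff)
qed

locale poisson_tensor =
  fixes K :: "('k, 'r) ring_scheme" and A :: "('k, 'a, 's) poisson_scheme" and n :: nat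
  assumes PA: "poisson_algebra K A"
begin

sublocale K: field K
  using PA by (simp add: poisson_algebra_def)

lemma algebra_A: "algebra K A"
  using PA by (simp add: poisson_algebra_def)

sublocale A: cring A
  by (rule algebra.M_cring[OF algebra_A])

lemma module_A: "module K A"
  by (rule algebra.module[OF algebra_A])

lemmas smult_closed [simp, intro] = module.smult_closed[OF module_A]
  and smult_assoc2 = algebra.smult_assoc2[OF algebra_A]

lemmas bracket_closed [simp, intro] = poisson_algebra.pbracket_closed[OF PA]
  and bracket_add_l = poisson_algebra.pbracket_add_l[OF PA]
  and bracket_add_r = poisson_algebra.pbracket_add_r[OF PA]
  and bracket_smult_l = poisson_algebra.pbracket_smult_l[OF PA]
  and bracket_self = poisson_algebra.pbracket_self[OF PA]
  and bracket_leibniz = poisson_algebra.pbracket_leibniz[OF PA]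

end


context poisson_tensor
begin

lemma comm_monoid_tuples: "comm_monoid (tuples A n)"
proof (rule comm_monoidI)
  show "x \<otimes>\<^bsub>tuples A n\<^esub> y \<otimes>\<^bsub>tuples A n\<^esub> z = x \<otimes>\<^bsub>tuples A n\<^esub> (y \<otimes>\<^bsub>tuples A n\<^esub> z)"
    if "x \<in> carrier (tuples A n)" "y \<in> carrier (tuples A n)" "z \<in> carrier (tuples A n)" for x y z
    using that by (auto simp: PiE_iff A.m_assoc intro!: restrict_ext)
  show "x \<otimes>\<^bsub>tuples A n\<^esub> y = y \<otimes>\<^bsub>tuples A n\<^esub> x"
    if "x \<in> carrier (tuples A n)" "y \<in> carrier (tuples A n)" for x y
    using that by (auto simp: PiE_iff A.m_comm intro!: restrict_ext)
  show "\<one>\<^bsub>tuples A n\<^esub> \<otimes>\<^bsub>tuples A n\<^esub> x = x" if "x \<in> carrier (tuples A n)" for x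
    using that by (auto simp: PiE_iff extensional_def fun_eq_iff)
qed (auto simp: PiE_iff)

sublocale fp: comm_monoid_algebra K "tuples A n"
  by (intro comm_monoid_algebra.intro comm_monoid_tuples K.cring_axioms)

sublocale F: cring "free_power K A n"
  by (rule fp.cring_F)

declare One_nat_def [simp del] carrier_product_group [simp del] mult_product_group [simp del]

abbreviation M where "M \<equiv> tuples A n"
abbreviation F where "F \<equiv> free_power K A n"
abbreviation I where "I \<equiv> tensor_ideal K A n"
abbreviation TP where "TP \<equiv> tensor_power K A n"
abbreviation mon where "mon \<equiv> monom_elem K"
abbreviation q where "q c \<equiv> I +>\<^bsub>F\<^esub> c"

lemma F_group: "abelian_group F"
  by (rule fp.abelian_group_F)

lemma upd_closed [simp, intro]: "\<lbrakk>x \<in> carrier M; i \<in> {1..n}; a \<in> carrier A\<rbrakk> \<Longrightarrow> x(i := a) \<in> carrier M"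
  by (auto simp: carrier_product_group PiE_iff extensional_def)

lemma comp_closed: "\<lbrakk>x \<in> carrier M; i \<in> {1..n}\<rbrakk> \<Longrightarrow> x i \<in> carrier A"
  by (auto simp: carrier_product_group)

lemma mult_upd:
  "i \<in> {1..n} \<Longrightarrow> y \<otimes>\<^bsub>M\<^esub> x(i := a) = (y \<otimes>\<^bsub>M\<^esub> x)(i := y i \<otimes>\<^bsub>A\<^esub> a)"
  by (auto simp: fun_eq_iff mult_product_group)

section \<open>The bracket on the free module\<close>

definition bracket_at :: "nat \<Rightarrow> (nat \<Rightarrow> 'a) \<Rightarrow> (nat \<Rightarrow> 'a) \<Rightarrow> nat \<Rightarrow> 'a"
  where "bracket_at k x y = (\<lambda>i\<in>{1..n}. if i = k then \<lbrace>x i, y i\<rbrace>\<^bsub>A\<^esub> else x i \<otimes>\<^bsub>A\<^esub> y i)"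

lemma bracket_at_closed [simp, intro]:
  "\<lbrakk>x \<in> carrier M; y \<in> carrier M\<rbrakk> \<Longrightarrow> bracket_at k x y \<in> carrier M"
  by (auto simp: bracket_at_def carrier_product_group PiE_iff)

lemma bracket_at_eq_upd:
  "k \<in> {1..n} \<Longrightarrow> bracket_at k x y = (x \<otimes>\<^bsub>M\<^esub> y)(k := \<lbrace>x k, y k\<rbrace>\<^bsub>A\<^esub>)"
  by (auto simp: bracket_at_def fun_eq_iff mult_product_group)

text \<open>In one component \<open>bracket_at\<close> is either the bracket or the product. Both
  are \<open>K\<close>-linear in the first argument, so a change of component \<open>i\<close> is
  treated alike for \<open>i = k\<close> and \<open>i \<noteq> k\<close>.\<close>

definition bracket_or_mult :: "bool \<Rightarrow> 'a \<Rightarrow> 'a \<Rightarrow> 'a"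
  where "bracket_or_mult p a b = (if p then \<lbrace>a, b\<rbrace>\<^bsub>A\<^esub> else a \<otimes>\<^bsub>A\<^esub> b)"

lemma bracket_or_mult_closed [simp, intro]:
  "\<lbrakk>a \<in> carrier A; b \<in> carrier A\<rbrakk> \<Longrightarrow> bracket_or_mult p a b \<in> carrier A"
  by (simp add: bracket_or_mult_def)

lemma bracket_or_mult_add:
  "\<lbrakk>a \<in> carrier A; a' \<in> carrier A; b \<in> carrier A\<rbrakk> \<Longrightarrow>
    bracket_or_mult p (a \<oplus>\<^bsub>A\<^esub> a') b = bracket_or_mult p a b \<oplus>\<^bsub>A\<^esub> bracket_or_mult p a' b"
  by (auto simp: bracket_or_mult_def bracket_add_l A.l_distr)

lemma bracket_or_mult_smult:
  "\<lbrakk>r \<in> carrier K; a \<in> carrier A; b \<in> carrier A\<rbrakk> \<Longrightarrow>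
    bracket_or_mult p (r \<odot>\<^bsub>A\<^esub> a) b = r \<odot>\<^bsub>A\<^esub> bracket_or_mult p a b"
  by (auto simp: bracket_or_mult_def bracket_smult_l smult_assoc2)

lemma bracket_at_upd:
  "i \<in> {1..n} \<Longrightarrow> bracket_at k (x(i := a)) y =
    (bracket_at k x y)(i := bracket_or_mult (i = k) a (y i))"
  by (auto simp: bracket_at_def bracket_or_mult_def fun_eq_iff)

lemma free_bracket_eq_lin_ext:
  assumes c: "c \<in> carrier F" and d: "d \<in> carrier F"
  shows "free_bracket K A n c d = lin_ext K F (\<lambda>x r. lin_ext K F (\<lambda>y s.
    \<Oplus>\<^bsub>F\<^esub>k\<in>{1..n}. mon (r \<otimes>\<^bsub>K\<^esub> s) (bracket_at k x y)) d) c"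
  using fp.coeff_closed[OF c] fp.coeff_closed[OF d]
  by (simp add: free_bracket_def lin_ext_def single_eq_monom_elem fp.smult_mon bracket_at_def)

lemma
  shows free_bracket_hom_l: "d \<in> carrier F \<Longrightarrow> (\<lambda>c. free_bracket K A n c d) \<in> hom (add_monoid F) (add_monoid F)"
    and free_bracket_hom_r: "c \<in> carrier F \<Longrightarrow> free_bracket K A n c \<in> hom (add_monoid F) (add_monoid F)"
    and free_bracket_mon: "\<lbrakk>r \<in> carrier K; x \<in> carrier M; s \<in> carrier K; y \<in> carrier M\<rbrakk> \<Longrightarrow>
      free_bracket K A n (mon r x) (mon s y) = (\<Oplus>\<^bsub>F\<^esub>k\<in>{1..n}. mon (r \<otimes>\<^bsub>K\<^esub> s) (bracket_at k x y))"
proof -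
  note B = fp.bilin_ext[OF F_group, of "\<lambda>x r y s. \<Oplus>\<^bsub>F\<^esub>k\<in>{1..n}. mon (r \<otimes>\<^bsub>K\<^esub> s) (bracket_at k x y)"]
  have 1: "(\<lambda>r. \<Oplus>\<^bsub>F\<^esub>k\<in>{1..n}. mon (r \<otimes>\<^bsub>K\<^esub> s) (bracket_at k x y)) \<in> hom (add_monoid K) (add_monoid F)"
    if "x \<in> carrier M" "y \<in> carrier M" "s \<in> carrier K" for x y s
    by (rule add_hom_sum[OF F_group fp.mon_mult_hom(1)]) (use that in auto)
  have 2: "(\<lambda>s. \<Oplus>\<^bsub>F\<^esub>k\<in>{1..n}. mon (r \<otimes>\<^bsub>K\<^esub> s) (bracket_at k x y)) \<in> hom (add_monoid K) (add_monoid F)"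
    if "x \<in> carrier M" "r \<in> carrier K" "y \<in> carrier M" for x y r
    by (rule add_hom_sum[OF F_group fp.mon_mult_hom(2)]) (use that in auto)
  have cong: "\<phi> \<in> hom (add_monoid F) (add_monoid F)"
    if "\<psi> \<in> hom (add_monoid F) (add_monoid F)" "\<And>c. c \<in> carrier F \<Longrightarrow> \<phi> c = \<psi> c" for \<phi> \<psi>
    using that fp.F.add.m_closed by (auto simp: add_hom_iff)
  show "(\<lambda>c. free_bracket K A n c d) \<in> hom (add_monoid F) (add_monoid F)" if "d \<in> carrier F"
    by (rule cong[OF B(1)[OF 1 2 that]]) (use that free_bracket_eq_lin_ext in auto)
  show "free_bracket K A n c \<in> hom (add_monoid F) (add_monoid F)" if "c \<in> carrier F"
    by (rule cong[OF B(2)[OF 1 2 that]]) (use that free_bracket_eq_lin_ext in auto)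
  show "free_bracket K A n (mon r x) (mon s y) = (\<Oplus>\<^bsub>F\<^esub>k\<in>{1..n}. mon (r \<otimes>\<^bsub>K\<^esub> s) (bracket_at k x y))"
    if "r \<in> carrier K" "x \<in> carrier M" "s \<in> carrier K" "y \<in> carrier M"
    using B(3)[OF 1 2 that] free_bracket_eq_lin_ext[of "mon r x" "mon s y"] that by simp
qed

lemma free_bracket_closed:
  "\<lbrakk>c \<in> carrier F; d \<in> carrier F\<rbrakk> \<Longrightarrow> free_bracket K A n c d \<in> carrier F"
  by (rule add_hom_closed[OF free_bracket_hom_l])

lemma single_closed [simp, intro]: "x \<in> carrier M \<Longrightarrow> single K x \<in> carrier F"
  by (simp add: single_eq_monom_elem fp.mon_closed)

lemma multilinear_rels_closed: "multilinear_rels K A n \<subseteq> carrier F"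
  unfolding multilinear_rels_def
  by (auto intro!: fp.F.minus_closed fp.F.add.m_closed single_closed upd_closed fp.smult_closed_F)

lemma ideal_I: "ideal I F"
  unfolding tensor_ideal_def by (rule F.genideal_ideal[OF multilinear_rels_closed])

lemma rels_in_I: "multilinear_rels K A n \<subseteq> I"
  unfolding tensor_ideal_def by (rule F.genideal_self[OF multilinear_rels_closed])

lemma I_closed: "c \<in> I \<Longrightarrow> c \<in> carrier F"
  using ideal.Icarr[OF ideal_I] .

text \<open>Plays the part of the universal property of the tensor power, both for the bracket and
  for products of functionals. As \<open>G\<close> is only an abelian group, linearity in
  \<open>s\<close> is expressed by moving \<open>s\<close> into the coefficient of the
  monomial.\<close>

lemma tensor_ideal_universal:
  assumes G: "abelian_group G" and \<Phi>: "\<Phi> \<in> hom (add_monoid F) (add_monoid G)"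
    and add: "\<And>r x i a b. \<lbrakk>r \<in> carrier K; x \<in> carrier M; i \<in> {1..n}; a \<in> carrier A; b \<in> carrier A\<rbrakk> \<Longrightarrow>
      \<Phi> (mon r (x(i := a \<oplus>\<^bsub>A\<^esub> b))) = \<Phi> (mon r (x(i := a))) \<oplus>\<^bsub>G\<^esub> \<Phi> (mon r (x(i := b)))"
    and smult: "\<And>r s x i a. \<lbrakk>r \<in> carrier K; s \<in> carrier K; x \<in> carrier M; i \<in> {1..n}; a \<in> carrier A\<rbrakk> \<Longrightarrow>
      \<Phi> (mon r (x(i := s \<odot>\<^bsub>A\<^esub> a))) = \<Phi> (mon (r \<otimes>\<^bsub>K\<^esub> s) (x(i := a)))"
    and c: "c \<in> I"
  shows "\<Phi> c = \<zero>\<^bsub>G\<^esub>"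
proof -
  interpret G: abelian_group G by fact
  \<comment> \<open>Multiplying a relation by a tuple gives a relation, so \<open>\<Phi>\<close> kills all multiples of relations.\<close>
  let ?J = "{c \<in> carrier F. \<forall>e\<in>carrier F. \<Phi> (e \<otimes>\<^bsub>F\<^esub> c) = \<zero>\<^bsub>G\<^esub>}"
  have \<Phi>_closed: "\<Phi> c \<in> carrier G" if "c \<in> carrier F" for c
    using add_hom_closed[OF \<Phi> that] .
  have "ideal ?J F"
  proof (rule idealI[OF F.ring_axioms])
    show "subgroup ?J (add_monoid F)"
    proof (rule group.subgroupI[OF fp.F.a_group])
      fix c assume c: "c \<in> ?J"
      have "\<Phi> (e \<otimes>\<^bsub>F\<^esub> (\<ominus>\<^bsub>F\<^esub> c)) = \<zero>\<^bsub>G\<^esub>" if e: "e \<in> carrier F" for e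
      proof -
        have "e \<otimes>\<^bsub>F\<^esub> (\<ominus>\<^bsub>F\<^esub> c) = (\<ominus>\<^bsub>F\<^esub> e) \<otimes>\<^bsub>F\<^esub> c"
          using c e by (simp add: F.l_minus F.r_minus)
        then show ?thesis using c e by simp
      qed
      then show "inv\<^bsub>add_monoid F\<^esub> c \<in> ?J"
        using c by (auto simp: a_inv_def[symmetric])
    next
      show "?J \<noteq> {}"
        using add_hom_zero[OF F_group G \<Phi>] by auto
    qed (auto simp: F.r_distr add_hom_add[OF \<Phi>])
  next
    fix c e assume c: "c \<in> ?J" and e: "e \<in> carrier F"
    have "\<Phi> (e' \<otimes>\<^bsub>F\<^esub> (e \<otimes>\<^bsub>F\<^esub> c)) = \<zero>\<^bsub>G\<^esub>" if "e' \<in> carrier F" for e'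
      using c e that by (simp add: F.m_assoc[symmetric])
    then show "e \<otimes>\<^bsub>F\<^esub> c \<in> ?J" using c e by simp
    then show "c \<otimes>\<^bsub>F\<^esub> e \<in> ?J" using c e by (simp add: F.m_comm)
  qed
  moreover have "multilinear_rels K A n \<subseteq> ?J"
  proof
    fix rel assume rel: "rel \<in> multilinear_rels K A n"
    then have rel_F: "rel \<in> carrier F" using multilinear_rels_closed by blast
    have "\<Phi> (e \<otimes>\<^bsub>F\<^esub> rel) = \<zero>\<^bsub>G\<^esub>" if e: "e \<in> carrier F" for e
    proof (rule fp.hom_eqI[OF G add_hom_comp[OF fp.mult_hom_l \<Phi>] add_hom_const_zero[OF G] _ e])
      fix s y assume s: "s \<in> carrier K" and y: "y \<in> carrier M"
      have sy: "mon s y \<in> carrier F" using s y by (rule fp.mon_closed)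
      note H = add_hom_comp[OF fp.mult_hom_r[OF sy] \<Phi>]
      note H_minus = add_hom_minus[OF F_group G H] and H_add = add_hom_add[OF H]
      have H_single: "\<Phi> (mon s y \<otimes>\<^bsub>F\<^esub> single K z) = \<Phi> (mon s (y \<otimes>\<^bsub>M\<^esub> z))" if "z \<in> carrier M" for z
        using that s y by (simp add: single_eq_monom_elem fp.mult_mon)
      from rel consider
        (add) x i a b where "rel = single K (x(i := a \<oplus>\<^bsub>A\<^esub> b)) \<ominus>\<^bsub>F\<^esub> (single K (x(i := a)) \<oplus>\<^bsub>F\<^esub> single K (x(i := b)))"
          "x \<in> carrier M" "i \<in> {1..n}" "a \<in> carrier A" "b \<in> carrier A"
        | (smult) x i r a where "rel = single K (x(i := r \<odot>\<^bsub>A\<^esub> a)) \<ominus>\<^bsub>F\<^esub> (r \<odot>\<^bsub>F\<^esub> single K (x(i := a)))"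
          "x \<in> carrier M" "i \<in> {1..n}" "r \<in> carrier K" "a \<in> carrier A"
        unfolding multilinear_rels_def by blast
      then show "\<Phi> (mon s y \<otimes>\<^bsub>F\<^esub> rel) = \<zero>\<^bsub>G\<^esub>"
      proof cases
        case add
        have cl: "single K (x(i := c)) \<in> carrier F" if "c \<in> carrier A" for c
          using add that by (intro single_closed upd_closed)
        have "\<Phi> (mon s y \<otimes>\<^bsub>F\<^esub> rel) = \<Phi> (mon s y \<otimes>\<^bsub>F\<^esub> single K (x(i := a \<oplus>\<^bsub>A\<^esub> b))) \<ominus>\<^bsub>G\<^esub>
            (\<Phi> (mon s y \<otimes>\<^bsub>F\<^esub> single K (x(i := a))) \<oplus>\<^bsub>G\<^esub> \<Phi> (mon s y \<otimes>\<^bsub>F\<^esub> single K (x(i := b))))"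
          unfolding add(1) using cl add(4,5) by (subst H_minus) (simp_all add: H_add)
        also have "\<dots> = \<Phi> (mon s ((y \<otimes>\<^bsub>M\<^esub> x)(i := y i \<otimes>\<^bsub>A\<^esub> a \<oplus>\<^bsub>A\<^esub> y i \<otimes>\<^bsub>A\<^esub> b))) \<ominus>\<^bsub>G\<^esub>
            (\<Phi> (mon s ((y \<otimes>\<^bsub>M\<^esub> x)(i := y i \<otimes>\<^bsub>A\<^esub> a))) \<oplus>\<^bsub>G\<^esub> \<Phi> (mon s ((y \<otimes>\<^bsub>M\<^esub> x)(i := y i \<otimes>\<^bsub>A\<^esub> b))))"
          using add comp_closed[OF y add(3)]
          by (simp add: H_single upd_closed mult_upd A.r_distr)
        also have "\<dots> = \<zero>\<^bsub>G\<^esub>"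
        proof -
          have yx: "y \<otimes>\<^bsub>M\<^esub> x \<in> carrier M" using y add(2) by (rule fp.M.m_closed)
          have ya: "y i \<otimes>\<^bsub>A\<^esub> a \<in> carrier A" "y i \<otimes>\<^bsub>A\<^esub> b \<in> carrier A"
            using comp_closed[OF y add(3)] add(4,5) by auto
          show ?thesis
            unfolding assms(3)[OF s yx add(3) ya]
            by (intro G.minus_self G.a_closed \<Phi>_closed fp.mon_closed s upd_closed yx add ya)
        qed
        finally show ?thesis .
      next
        case smult
        have cl: "single K (x(i := c)) \<in> carrier F" if "c \<in> carrier A" for c
          using smult that by (intro single_closed upd_closed)
        have "\<Phi> (mon s y \<otimes>\<^bsub>F\<^esub> rel) = \<Phi> (mon s y \<otimes>\<^bsub>F\<^esub> single K (x(i := r \<odot>\<^bsub>A\<^esub> a))) \<ominus>\<^bsub>G\<^esub>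
            \<Phi> (mon s y \<otimes>\<^bsub>F\<^esub> (r \<odot>\<^bsub>F\<^esub> single K (x(i := a))))"
          unfolding smult(1) using cl smult(4,5) fp.smult_closed_F by (subst H_minus) simp_all
        also have "r \<odot>\<^bsub>F\<^esub> single K (x(i := a)) = mon r (x(i := a))"
          using smult(4) by (simp add: single_eq_monom_elem fp.smult_mon)
        also have "mon s y \<otimes>\<^bsub>F\<^esub> mon r (x(i := a)) = mon (s \<otimes>\<^bsub>K\<^esub> r) ((y \<otimes>\<^bsub>M\<^esub> x)(i := y i \<otimes>\<^bsub>A\<^esub> a))"
          using s y smult by (simp add: fp.mult_mon upd_closed mult_upd)
        also have "\<Phi> (mon s y \<otimes>\<^bsub>F\<^esub> single K (x(i := r \<odot>\<^bsub>A\<^esub> a))) =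
            \<Phi> (mon s ((y \<otimes>\<^bsub>M\<^esub> x)(i := r \<odot>\<^bsub>A\<^esub> (y i \<otimes>\<^bsub>A\<^esub> a))))"
          using smult comp_closed[OF y smult(3)] smult_assoc2[of r a "y i"]
          by (simp add: H_single upd_closed mult_upd A.m_comm)
        also have "\<dots> \<ominus>\<^bsub>G\<^esub> \<Phi> (mon (s \<otimes>\<^bsub>K\<^esub> r) ((y \<otimes>\<^bsub>M\<^esub> x)(i := y i \<otimes>\<^bsub>A\<^esub> a))) = \<zero>\<^bsub>G\<^esub>"
        proof -
          have yx: "y \<otimes>\<^bsub>M\<^esub> x \<in> carrier M" using y smult(2) by (rule fp.M.m_closed)
          have ya: "y i \<otimes>\<^bsub>A\<^esub> a \<in> carrier A"
            using comp_closed[OF y smult(3)] smult(5) by auto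
          show ?thesis
            unfolding assms(4)[OF s smult(4) yx smult(3) ya]
            by (intro G.minus_self \<Phi>_closed fp.mon_closed K.m_closed s smult upd_closed yx ya)
        qed
        finally show ?thesis .
      qed
    qed (rule rel_F)
    then show "rel \<in> ?J" using rel_F by simp
  qed
  ultimately have "I \<subseteq> ?J"
    unfolding tensor_ideal_def by (rule F.genideal_minimal)
  then have "c \<in> ?J" using c by blast
  then have "\<Phi> (\<one>\<^bsub>F\<^esub> \<otimes>\<^bsub>F\<^esub> c) = \<zero>\<^bsub>G\<^esub>" by blast
  then show ?thesis using I_closed[OF c] by simp
qed

lemma tensor_power_simps:
  "carrier TP = carrier (F Quot I)" "monoid.mult TP = monoid.mult (F Quot I)"
  "one TP = one (F Quot I)" "zero TP = zero (F Quot I)" "add TP = add (F Quot I)"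
  by (simp_all add: tensor_power_def Let_def)

lemma q_ring_hom: "(\<lambda>c. q c) \<in> ring_hom F TP"
  using ideal.rcos_ring_hom[OF ideal_I] by (simp add: ring_hom_def tensor_power_simps)

lemma q_surj: "X \<in> carrier TP \<Longrightarrow> \<exists>c\<in>carrier F. X = q c"
  by (auto simp: tensor_power_simps FactRing_def A_RCOSETS_def')

lemma q_zero_iff: "c \<in> carrier F \<Longrightarrow> q c = \<zero>\<^bsub>TP\<^esub> \<longleftrightarrow> c \<in> I"
  using abelian_subgroup.a_rcos_self[OF abelian_subgroupI3[OF ideal.axioms(1)[OF ideal_I] F_group], of c]
    abelian_subgroup.a_rcos_const[OF abelian_subgroupI3[OF ideal.axioms(1)[OF ideal_I] F_group], of c]
  by (auto simp: tensor_power_simps FactRing_def)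

end

section \<open>The Poisson bracket on the tensor power\<close>

locale poisson_tensor_domain = poisson_tensor K A n
  for K :: "('k, 'r) ring_scheme" and A :: "('k, 'a, 's) poisson_scheme" and n +
  assumes domain_TP: "domain (tensor_power K A n)"
begin

sublocale TP: domain TP
  by (rule domain_TP)

abbreviation B where "B \<equiv> free_bracket K A n"

lemma bracket_biderivation: "alternating_biderivation A (pbracket A)"
  by unfold_locales (simp_all add: bracket_add_l bracket_add_r bracket_self bracket_leibniz)

lemma TP_group: "abelian_group TP"
  by (rule TP.abelian_group_axioms)

lemma q_closed [simp, intro]: "c \<in> carrier F \<Longrightarrow> q c \<in> carrier TP"
  using q_ring_hom by (rule ring_hom_closed)

lemma q_add: "\<lbrakk>c \<in> carrier F; d \<in> carrier F\<rbrakk> \<Longrightarrow> q (c \<oplus>\<^bsub>F\<^esub> d) = q c \<oplus>\<^bsub>TP\<^esub> q d"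
  using q_ring_hom by (rule ring_hom_add)

lemma q_mult: "\<lbrakk>c \<in> carrier F; d \<in> carrier F\<rbrakk> \<Longrightarrow> q (c \<otimes>\<^bsub>F\<^esub> d) = q c \<otimes>\<^bsub>TP\<^esub> q d"
  using q_ring_hom by (rule ring_hom_mult)

lemma q_one: "q \<one>\<^bsub>F\<^esub> = \<one>\<^bsub>TP\<^esub>"
  using q_ring_hom by (rule ring_hom_one)

lemma q_hom: "(\<lambda>c. q c) \<in> hom (add_monoid F) (add_monoid TP)"
  by (simp add: add_hom_iff q_add)

lemma q_finsum:
  assumes "finite S" "g \<in> S \<rightarrow> carrier F"
  shows "q (\<Oplus>\<^bsub>F\<^esub>k\<in>S. g k) = (\<Oplus>\<^bsub>TP\<^esub>k\<in>S. q (g k))"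
  by (rule add_hom_finsum[OF F_group TP_group q_hom assms])

lemma q_mult_rel:
  assumes e: "e \<in> carrier F" and c: "c \<in> carrier F" and d: "d \<in> carrier F"
    and rel: "c \<ominus>\<^bsub>F\<^esub> d \<in> multilinear_rels K A n"
  shows "q (e \<otimes>\<^bsub>F\<^esub> c) = q (e \<otimes>\<^bsub>F\<^esub> d)"
proof -
  have "e \<otimes>\<^bsub>F\<^esub> (c \<ominus>\<^bsub>F\<^esub> d) \<in> I"
    using ideal.I_l_closed[OF ideal_I] rel rels_in_I e by blast
  then have "q (e \<otimes>\<^bsub>F\<^esub> (c \<ominus>\<^bsub>F\<^esub> d)) = \<zero>\<^bsub>TP\<^esub>"
    using q_zero_iff I_closed by blast
  moreover have "q (e \<otimes>\<^bsub>F\<^esub> (c \<ominus>\<^bsub>F\<^esub> d)) = q (e \<otimes>\<^bsub>F\<^esub> c) \<ominus>\<^bsub>TP\<^esub> q (e \<otimes>\<^bsub>F\<^esub> d)"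
    by (rule add_hom_minus[OF F_group TP_group add_hom_comp[OF fp.mult_hom_r[OF e] q_hom] c d])
  ultimately show ?thesis using e c d TP.minus_eq_zeroD by (simp add: F.m_closed q_closed)
qed

text \<open>The generators in \<open>multilinear_rels\<close> start from a tuple with coefficient
  one; a general coefficient is produced by multiplying with a monomial at the unit tuple, which
  stays in the ideal.\<close>

lemma mon_eq_mult: "\<lbrakk>r \<in> carrier K; x \<in> carrier M\<rbrakk> \<Longrightarrow> mon r x = mon r \<one>\<^bsub>M\<^esub> \<otimes>\<^bsub>F\<^esub> single K x"
  by (simp add: single_eq_monom_elem fp.mult_mon del: one_product_group)

lemma q_mon_add:
  assumes r: "r \<in> carrier K" and x: "x \<in> carrier M" and i: "i \<in> {1..n}"
    and a: "a \<in> carrier A" and b: "b \<in> carrier A"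
  shows "q (mon r (x(i := a \<oplus>\<^bsub>A\<^esub> b))) = q (mon r (x(i := a))) \<oplus>\<^bsub>TP\<^esub> q (mon r (x(i := b)))"
proof -
  let ?s = "\<lambda>c. single K (x(i := c))" and ?e = "mon r \<one>\<^bsub>M\<^esub>"
  have cl: "?s c \<in> carrier F" "x(i := c) \<in> carrier M" if "c \<in> carrier A" for c
    using x i that by (auto intro: single_closed upd_closed)
  have e: "?e \<in> carrier F" using r by (intro fp.mon_closed fp.M.one_closed)
  have "?s (a \<oplus>\<^bsub>A\<^esub> b) \<ominus>\<^bsub>F\<^esub> (?s a \<oplus>\<^bsub>F\<^esub> ?s b) \<in> multilinear_rels K A n"
    unfolding multilinear_rels_def using x i a b by blast
  then have "q (?e \<otimes>\<^bsub>F\<^esub> ?s (a \<oplus>\<^bsub>A\<^esub> b)) = q (?e \<otimes>\<^bsub>F\<^esub> (?s a \<oplus>\<^bsub>F\<^esub> ?s b))"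
    using a b by (intro q_mult_rel e cl fp.F.add.m_closed A.add.m_closed)
  also have "\<dots> = q (?e \<otimes>\<^bsub>F\<^esub> ?s a) \<oplus>\<^bsub>TP\<^esub> q (?e \<otimes>\<^bsub>F\<^esub> ?s b)"
    using add_hom_add[OF add_hom_comp[OF fp.mult_hom_r[OF e] q_hom]] cl a b by simp
  finally show ?thesis
    by (simp only: mon_eq_mult[OF r cl(2)[OF A.add.m_closed[OF a b]]] mon_eq_mult[OF r cl(2)[OF a]]
        mon_eq_mult[OF r cl(2)[OF b]])
qed

lemma q_mon_smult:
  assumes r: "r \<in> carrier K" and s: "s \<in> carrier K" and x: "x \<in> carrier M" and i: "i \<in> {1..n}"
    and a: "a \<in> carrier A"
  shows "q (mon r (x(i := s \<odot>\<^bsub>A\<^esub> a))) = q (mon (r \<otimes>\<^bsub>K\<^esub> s) (x(i := a)))"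
proof -
  let ?s = "\<lambda>c. single K (x(i := c))" and ?e = "mon r \<one>\<^bsub>M\<^esub>"
  have cl: "?s c \<in> carrier F" "x(i := c) \<in> carrier M" if "c \<in> carrier A" for c
    using x i that by (auto intro: single_closed upd_closed)
  have e: "?e \<in> carrier F" using r by (intro fp.mon_closed fp.M.one_closed)
  have "?s (s \<odot>\<^bsub>A\<^esub> a) \<ominus>\<^bsub>F\<^esub> (s \<odot>\<^bsub>F\<^esub> ?s a) \<in> multilinear_rels K A n"
    unfolding multilinear_rels_def using x i a s by blast
  then have "q (?e \<otimes>\<^bsub>F\<^esub> ?s (s \<odot>\<^bsub>A\<^esub> a)) = q (?e \<otimes>\<^bsub>F\<^esub> (s \<odot>\<^bsub>F\<^esub> ?s a))"
    using a s by (intro q_mult_rel e cl fp.smult_closed_F smult_closed)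
  also have "s \<odot>\<^bsub>F\<^esub> ?s a = mon s (x(i := a))"
    using s by (simp add: single_eq_monom_elem fp.smult_mon)
  also have "?e \<otimes>\<^bsub>F\<^esub> mon s (x(i := a)) = mon (r \<otimes>\<^bsub>K\<^esub> s) (x(i := a))"
    using r s a cl by (simp add: fp.mult_mon del: one_product_group)
  finally show ?thesis
    by (simp only: mon_eq_mult[OF r cl(2)[OF smult_closed[OF s a]]])
qed

text \<open>Additivity applied to \<open>0 = 0 + 0\<close> in component \<open>i\<close> shows that
  the class equals its own double.\<close>

lemma q_mon_zero:
  assumes "r \<in> carrier K" "x \<in> carrier M" "i \<in> {1..n}" "x i = \<zero>\<^bsub>A\<^esub>"
  shows "q (mon r x) = \<zero>\<^bsub>TP\<^esub>"
proof -
  have "q (mon r x) = q (mon r x) \<oplus>\<^bsub>TP\<^esub> q (mon r x)"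
    using q_mon_add[of r x i "\<zero>\<^bsub>A\<^esub>" "\<zero>\<^bsub>A\<^esub>"] assms by (simp add: fun_upd_idem)
  then show ?thesis
    using assms by (simp add: TP.add.l_cancel_one fp.mon_closed)
qed

section \<open>Bracket laws modulo the tensor ideal\<close>

lemma q_bracket_mon:
  assumes "r \<in> carrier K" "x \<in> carrier M" "s \<in> carrier K" "y \<in> carrier M"
  shows "q (B (mon r x) (mon s y)) = (\<Oplus>\<^bsub>TP\<^esub>k\<in>{1..n}. q (mon (r \<otimes>\<^bsub>K\<^esub> s) (bracket_at k x y)))"
  unfolding free_bracket_mon[OF assms]
  by (rule q_finsum) (use assms in auto)

lemma q_bracket_hom_l: "d \<in> carrier F \<Longrightarrow> (\<lambda>c. q (B c d)) \<in> hom (add_monoid F) (add_monoid TP)"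
  by (rule add_hom_comp[OF free_bracket_hom_l q_hom])

lemma q_bracket_hom_r: "c \<in> carrier F \<Longrightarrow> (\<lambda>d. q (B c d)) \<in> hom (add_monoid F) (add_monoid TP)"
  by (rule add_hom_comp[OF free_bracket_hom_r q_hom])

lemma q_bracket_closed: "\<lbrakk>c \<in> carrier F; d \<in> carrier F\<rbrakk> \<Longrightarrow> q (B c d) \<in> carrier TP"
  by (intro q_closed free_bracket_closed)

text \<open>In the free module the tuples with entries \<open>{x k, y k}\<close> and
  \<open>{y k, x k}\<close> are in general unrelated basis elements; they cancel only after
  \<open>q\<close>, by additivity in component \<open>k\<close>. The law is written as a vanishing
  sum, so that it is additive in each argument.\<close>

lemma q_bracket_swap:
  assumes c: "c \<in> carrier F" and d: "d \<in> carrier F"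
  shows "q (B c d) \<oplus>\<^bsub>TP\<^esub> q (B d c) = \<zero>\<^bsub>TP\<^esub>"
proof (rule fp.hom_eqI[OF TP_group add_hom_plus[OF TP_group q_bracket_hom_l q_bracket_hom_r]
      add_hom_const_zero[OF TP_group] _ c])
  fix r x assume r: "r \<in> carrier K" and x: "x \<in> carrier M"
  have rx: "mon r x \<in> carrier F" using r x by (rule fp.mon_closed)
  show "q (B (mon r x) d) \<oplus>\<^bsub>TP\<^esub> q (B d (mon r x)) = \<zero>\<^bsub>TP\<^esub>"
  proof (rule fp.hom_eqI[OF TP_group add_hom_plus[OF TP_group q_bracket_hom_r q_bracket_hom_l]
        add_hom_const_zero[OF TP_group] _ d])
    fix s y assume s: "s \<in> carrier K" and y: "y \<in> carrier M"
    let ?m = "\<lambda>k z. q (mon (r \<otimes>\<^bsub>K\<^esub> s) ((x \<otimes>\<^bsub>M\<^esub> y)(k := z)))"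
    have xy: "x \<otimes>\<^bsub>M\<^esub> y \<in> carrier M" using x y by (rule fp.M.m_closed)
    have m: "?m k z \<in> carrier TP" if "k \<in> {1..n}" "z \<in> carrier A" for k z
      using that r s xy by (intro q_closed fp.mon_closed K.m_closed upd_closed)
    have br: "\<lbrace>x k, y k\<rbrace>\<^bsub>A\<^esub> \<in> carrier A" "\<lbrace>y k, x k\<rbrace>\<^bsub>A\<^esub> \<in> carrier A" "x k \<in> carrier A" "y k \<in> carrier A"
      if "k \<in> {1..n}" for k
      using comp_closed[OF x that] comp_closed[OF y that] by auto
    have "q (B (mon r x) (mon s y)) \<oplus>\<^bsub>TP\<^esub> q (B (mon s y) (mon r x)) =
        (\<Oplus>\<^bsub>TP\<^esub>k\<in>{1..n}. ?m k \<lbrace>x k, y k\<rbrace>\<^bsub>A\<^esub>) \<oplus>\<^bsub>TP\<^esub> (\<Oplus>\<^bsub>TP\<^esub>k\<in>{1..n}. ?m k \<lbrace>y k, x k\<rbrace>\<^bsub>A\<^esub>)"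
    proof -
      have "(\<Oplus>\<^bsub>TP\<^esub>k\<in>{1..n}. q (mon (r \<otimes>\<^bsub>K\<^esub> s) (bracket_at k x y))) =
          (\<Oplus>\<^bsub>TP\<^esub>k\<in>{1..n}. ?m k \<lbrace>x k, y k\<rbrace>\<^bsub>A\<^esub>)"
        by (rule TP.finsum_cong'[OF refl]) (simp_all add: Pi_iff m br bracket_at_eq_upd)
      moreover have "(\<Oplus>\<^bsub>TP\<^esub>k\<in>{1..n}. q (mon (s \<otimes>\<^bsub>K\<^esub> r) (bracket_at k y x))) =
          (\<Oplus>\<^bsub>TP\<^esub>k\<in>{1..n}. ?m k \<lbrace>y k, x k\<rbrace>\<^bsub>A\<^esub>)"
        by (rule TP.finsum_cong'[OF refl])
           (simp_all add: Pi_iff m br bracket_at_eq_upd K.m_comm[OF s r] fp.M.m_comm[OF y x])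
      ultimately show ?thesis by (simp only: q_bracket_mon[OF r x s y] q_bracket_mon[OF s y r x])
    qed
    also have "\<dots> = (\<Oplus>\<^bsub>TP\<^esub>k\<in>{1..n}. ?m k \<lbrace>x k, y k\<rbrace>\<^bsub>A\<^esub> \<oplus>\<^bsub>TP\<^esub> ?m k \<lbrace>y k, x k\<rbrace>\<^bsub>A\<^esub>)"
      using m br by (intro TP.finsum_addf[symmetric]) auto
    also have "\<dots> = (\<Oplus>\<^bsub>TP\<^esub>k\<in>{1..n}. \<zero>\<^bsub>TP\<^esub>)"
    proof (rule TP.finsum_cong'[OF refl])
      fix k assume k: "k \<in> {1..n}"
      have "?m k \<lbrace>x k, y k\<rbrace>\<^bsub>A\<^esub> \<oplus>\<^bsub>TP\<^esub> ?m k \<lbrace>y k, x k\<rbrace>\<^bsub>A\<^esub> = ?m k (\<lbrace>x k, y k\<rbrace>\<^bsub>A\<^esub> \<oplus>\<^bsub>A\<^esub> \<lbrace>y k, x k\<rbrace>\<^bsub>A\<^esub>)"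
        using q_mon_add[OF K.m_closed[OF r s] xy k] br[OF k] by simp
      also have "\<lbrace>x k, y k\<rbrace>\<^bsub>A\<^esub> \<oplus>\<^bsub>A\<^esub> \<lbrace>y k, x k\<rbrace>\<^bsub>A\<^esub> = \<zero>\<^bsub>A\<^esub>"
        using alternating_biderivation.br_swap[OF bracket_biderivation br(3,4)[OF k]] br[OF k] by (simp add: A.l_neg)
      also have "?m k \<zero>\<^bsub>A\<^esub> = \<zero>\<^bsub>TP\<^esub>"
        using r s xy k by (intro q_mon_zero[of _ _ k]) auto
      finally show "?m k \<lbrace>x k, y k\<rbrace>\<^bsub>A\<^esub> \<oplus>\<^bsub>TP\<^esub> ?m k \<lbrace>y k, x k\<rbrace>\<^bsub>A\<^esub> = \<zero>\<^bsub>TP\<^esub>" .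
    qed simp
    finally show "q (B (mon r x) (mon s y)) \<oplus>\<^bsub>TP\<^esub> q (B (mon s y) (mon r x)) = \<zero>\<^bsub>TP\<^esub>" by simp
  qed (rule rx)+
qed (rule d)+

text \<open>For a monomial in the second argument, each summand \<open>k\<close> of the bracket is
  multilinear in the tuple of the first one: in component \<open>k\<close> by linearity of the
  bracket of \<open>A\<close>, elsewhere by linearity of the product.\<close>

lemma q_bracket_vanish_l:
  assumes c: "c \<in> I" and d: "d \<in> carrier F"
  shows "q (B c d) = \<zero>\<^bsub>TP\<^esub>"
proof (rule fp.hom_eqI[OF TP_group q_bracket_hom_r[OF I_closed[OF c]] add_hom_const_zero[OF TP_group] _ d])
  fix t y assume t: "t \<in> carrier K" and y: "y \<in> carrier M"
  have ty: "mon t y \<in> carrier F" using t y by (rule fp.mon_closed)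
  show "q (B c (mon t y)) = \<zero>\<^bsub>TP\<^esub>"
  proof (rule tensor_ideal_universal[OF TP_group q_bracket_hom_l[OF ty] _ _ c])
    fix r x i a b
    assume r: "r \<in> carrier K" and x: "x \<in> carrier M" and i: "i \<in> {1..n}"
      and a: "a \<in> carrier A" and b: "b \<in> carrier A"
    let ?op = "\<lambda>k z. bracket_or_mult (i = k) z (y i)"
    have yi: "y i \<in> carrier A" using y i by (rule comp_closed)
    have op: "?op k z \<in> carrier A" if "z \<in> carrier A" for k z using that yi by auto
    have cl: "q (mon (r \<otimes>\<^bsub>K\<^esub> t) ((bracket_at k x y)(i := ?op k z))) \<in> carrier TP" if "z \<in> carrier A" for k z
      using r t x y i op[OF that] by (intro q_closed fp.mon_closed K.m_closed upd_closed bracket_at_closed)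
    have expand: "q (B (mon r (x(i := z))) (mon t y)) =
        (\<Oplus>\<^bsub>TP\<^esub>k\<in>{1..n}. q (mon (r \<otimes>\<^bsub>K\<^esub> t) ((bracket_at k x y)(i := ?op k z))))" if "z \<in> carrier A" for z
      using r t x y i that by (simp add: q_bracket_mon upd_closed bracket_at_upd)
    have "q (B (mon r (x(i := a \<oplus>\<^bsub>A\<^esub> b))) (mon t y)) =
        (\<Oplus>\<^bsub>TP\<^esub>k\<in>{1..n}. q (mon (r \<otimes>\<^bsub>K\<^esub> t) ((bracket_at k x y)(i := ?op k a))) \<oplus>\<^bsub>TP\<^esub>
          q (mon (r \<otimes>\<^bsub>K\<^esub> t) ((bracket_at k x y)(i := ?op k b))))"
      unfolding expand[OF A.add.m_closed[OF a b]]
    proof (rule TP.finsum_cong'[OF refl])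
      fix k
      have "?op k (a \<oplus>\<^bsub>A\<^esub> b) = ?op k a \<oplus>\<^bsub>A\<^esub> ?op k b"
        using a b yi by (rule bracket_or_mult_add)
      then show "q (mon (r \<otimes>\<^bsub>K\<^esub> t) ((bracket_at k x y)(i := ?op k (a \<oplus>\<^bsub>A\<^esub> b)))) =
          q (mon (r \<otimes>\<^bsub>K\<^esub> t) ((bracket_at k x y)(i := ?op k a))) \<oplus>\<^bsub>TP\<^esub>
          q (mon (r \<otimes>\<^bsub>K\<^esub> t) ((bracket_at k x y)(i := ?op k b)))"
        using q_mon_add[OF K.m_closed[OF r t] bracket_at_closed[OF x y] i op[OF a] op[OF b]] by simp
    qed (use cl[OF a] cl[OF b] in auto)
    also have "\<dots> = q (B (mon r (x(i := a))) (mon t y)) \<oplus>\<^bsub>TP\<^esub> q (B (mon r (x(i := b))) (mon t y))"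
      unfolding expand[OF a] expand[OF b] using cl[OF a] cl[OF b] by (intro TP.finsum_addf) auto
    finally show "q (B (mon r (x(i := a \<oplus>\<^bsub>A\<^esub> b))) (mon t y)) =
        q (B (mon r (x(i := a))) (mon t y)) \<oplus>\<^bsub>TP\<^esub> q (B (mon r (x(i := b))) (mon t y))" .
  next
    fix r s x i a
    assume r: "r \<in> carrier K" and s: "s \<in> carrier K" and x: "x \<in> carrier M" and i: "i \<in> {1..n}"
      and a: "a \<in> carrier A"
    let ?op = "\<lambda>k z. bracket_or_mult (i = k) z (y i)"
    have yi: "y i \<in> carrier A" using y i by (rule comp_closed)
    have op: "?op k a \<in> carrier A" for k using a yi by auto
    have cl: "q (mon (r \<otimes>\<^bsub>K\<^esub> s \<otimes>\<^bsub>K\<^esub> t) ((bracket_at k x y)(i := ?op k a))) \<in> carrier TP" for k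
      using r s t x y i op by (intro q_closed fp.mon_closed K.m_closed upd_closed bracket_at_closed)
    have "q (B (mon r (x(i := s \<odot>\<^bsub>A\<^esub> a))) (mon t y)) =
        (\<Oplus>\<^bsub>TP\<^esub>k\<in>{1..n}. q (mon (r \<otimes>\<^bsub>K\<^esub> t) ((bracket_at k x y)(i := ?op k (s \<odot>\<^bsub>A\<^esub> a)))))"
      using r s t x y i a by (simp add: q_bracket_mon upd_closed bracket_at_upd)
    also have "\<dots> = (\<Oplus>\<^bsub>TP\<^esub>k\<in>{1..n}. q (mon (r \<otimes>\<^bsub>K\<^esub> s \<otimes>\<^bsub>K\<^esub> t) ((bracket_at k x y)(i := ?op k a))))"
    proof (rule TP.finsum_cong'[OF refl])
      fix k
      have "?op k (s \<odot>\<^bsub>A\<^esub> a) = s \<odot>\<^bsub>A\<^esub> ?op k a"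
        using s a yi by (rule bracket_or_mult_smult)
      moreover have "r \<otimes>\<^bsub>K\<^esub> t \<otimes>\<^bsub>K\<^esub> s = r \<otimes>\<^bsub>K\<^esub> s \<otimes>\<^bsub>K\<^esub> t"
        using r s t by (simp add: K.m_assoc K.m_comm K.m_lcomm)
      ultimately show "q (mon (r \<otimes>\<^bsub>K\<^esub> t) ((bracket_at k x y)(i := ?op k (s \<odot>\<^bsub>A\<^esub> a)))) =
          q (mon (r \<otimes>\<^bsub>K\<^esub> s \<otimes>\<^bsub>K\<^esub> t) ((bracket_at k x y)(i := ?op k a)))"
        using q_mon_smult[OF K.m_closed[OF r t] s bracket_at_closed[OF x y] i op] by simp
    qed (use cl in auto)
    also have "\<dots> = q (B (mon (r \<otimes>\<^bsub>K\<^esub> s) (x(i := a))) (mon t y))"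
      using r s t x y i a by (simp add: q_bracket_mon upd_closed bracket_at_upd)
    finally show "q (B (mon r (x(i := s \<odot>\<^bsub>A\<^esub> a))) (mon t y)) = q (B (mon (r \<otimes>\<^bsub>K\<^esub> s) (x(i := a))) (mon t y))" .
  qed
qed

lemma q_bracket_vanish_r:
  assumes c: "c \<in> carrier F" and d: "d \<in> I"
  shows "q (B c d) = \<zero>\<^bsub>TP\<^esub>"
  using q_bracket_swap[OF c I_closed[OF d]] q_bracket_vanish_l[OF d c]
    q_bracket_closed[OF c I_closed[OF d]] by simp

text \<open>By the two vanishing lemmas all representatives give the same coset, so the union in the
  definition is that coset.\<close>

lemma pbracket_q:
  assumes c: "c \<in> carrier F" and d: "d \<in> carrier F"
  shows "\<lbrace>q c, q d\<rbrace>\<^bsub>TP\<^esub> = q (B c d)"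
proof -
  have rep: "\<exists>h\<in>I. c' = h \<oplus>\<^bsub>F\<^esub> c" if "c' \<in> q c" for c c'
    using that by (auto simp: a_r_coset_def')
  have "q (B c' d') = q (B c d)" if c': "c' \<in> q c" and d': "d' \<in> q d" for c' d'
  proof -
    obtain h where h: "h \<in> I" "c' = h \<oplus>\<^bsub>F\<^esub> c" using rep[OF c'] by blast
    obtain k where k: "k \<in> I" "d' = k \<oplus>\<^bsub>F\<^esub> d" using rep[OF d'] by blast
    have kd: "k \<oplus>\<^bsub>F\<^esub> d \<in> carrier F" using I_closed[OF k(1)] d by (rule fp.F.add.m_closed)
    have "q (B c' d') = q (B h (k \<oplus>\<^bsub>F\<^esub> d)) \<oplus>\<^bsub>TP\<^esub> q (B c (k \<oplus>\<^bsub>F\<^esub> d))"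
      unfolding h(2) k(2) by (rule add_hom_add[OF q_bracket_hom_l[OF kd] I_closed[OF h(1)] c])
    also have "\<dots> = q (B c (k \<oplus>\<^bsub>F\<^esub> d))"
      using q_bracket_vanish_l[OF h(1) kd] q_bracket_closed[OF c kd] by simp
    also have "\<dots> = q (B c k) \<oplus>\<^bsub>TP\<^esub> q (B c d)"
      by (rule add_hom_add[OF q_bracket_hom_r[OF c] I_closed[OF k(1)] d])
    also have "\<dots> = q (B c d)"
      using q_bracket_vanish_r[OF c k(1)] q_bracket_closed[OF c d] by simp
    finally show ?thesis .
  qed
  \<comment> \<open>The index sets of the union are nonempty.\<close>
  moreover have "c \<in> q c" "d \<in> q d"
    using abelian_subgroup.a_rcos_self[OF abelian_subgroupI3[OF ideal.axioms(1)[OF ideal_I] F_group]] c d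
    by auto
  ultimately have "(\<Union>c'\<in>q c. \<Union>d'\<in>q d. q (B c' d')) = q (B c d)" by blast
  then show ?thesis by (simp add: tensor_power_def Let_def)
qed

text \<open>The law is quadratic, so \<open>hom_eqI\<close> does not cover it; monomials are added
  one at a time instead. Mixed terms cancel by \<open>q_bracket_swap\<close>, and in the bracket of
  a monomial with itself every summand has an entry \<open>{x k, x k} = 0\<close>.\<close>

lemma q_bracket_self:
  assumes "c \<in> carrier F"
  shows "q (B c c) = \<zero>\<^bsub>TP\<^esub>"
  using assms
proof (induction rule: fp.F_induct)
  case zero
  show ?case
    using add_hom_zero[OF F_group TP_group q_bracket_hom_l[of "\<zero>\<^bsub>F\<^esub>"]] by simp
next
  case (add c r x)
  let ?m = "mon r x"
  have m: "?m \<in> carrier F" using add by (intro fp.mon_closed)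
  have cm: "c \<oplus>\<^bsub>F\<^esub> ?m \<in> carrier F" using add(1) m by (rule fp.F.add.m_closed)
  have "q (B ?m ?m) = (\<Oplus>\<^bsub>TP\<^esub>k\<in>{1..n}. q (mon (r \<otimes>\<^bsub>K\<^esub> r) (bracket_at k x x)))"
    using add by (intro q_bracket_mon)
  also have "\<dots> = (\<Oplus>\<^bsub>TP\<^esub>k\<in>{1..n}. \<zero>\<^bsub>TP\<^esub>)"
  proof (rule TP.finsum_cong'[OF refl])
    fix k assume k: "k \<in> {1..n}"
    show "q (mon (r \<otimes>\<^bsub>K\<^esub> r) (bracket_at k x x)) = \<zero>\<^bsub>TP\<^esub>"
      using add k comp_closed[of x k]
      by (intro q_mon_zero[OF _ _ k]) (auto simp: bracket_at_def[of k] bracket_self intro: bracket_at_closed[unfolded bracket_at_def])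
  qed simp
  finally have mm: "q (B ?m ?m) = \<zero>\<^bsub>TP\<^esub>" by simp
  have "q (B (c \<oplus>\<^bsub>F\<^esub> ?m) (c \<oplus>\<^bsub>F\<^esub> ?m)) = q (B c (c \<oplus>\<^bsub>F\<^esub> ?m)) \<oplus>\<^bsub>TP\<^esub> q (B ?m (c \<oplus>\<^bsub>F\<^esub> ?m))"
    by (rule add_hom_add[OF q_bracket_hom_l[OF cm] add(1) m])
  also have "\<dots> = (q (B c c) \<oplus>\<^bsub>TP\<^esub> q (B c ?m)) \<oplus>\<^bsub>TP\<^esub> (q (B ?m c) \<oplus>\<^bsub>TP\<^esub> q (B ?m ?m))"
    using add_hom_add[OF q_bracket_hom_r[OF add(1)] add(1) m] add_hom_add[OF q_bracket_hom_r[OF m] add(1) m]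
    by simp
  also have "\<dots> = \<zero>\<^bsub>TP\<^esub>"
    using add.IH mm q_bracket_swap[OF add(1) m] q_bracket_closed[OF add(1) m] q_bracket_closed[OF m add(1)]
    by simp
  finally show ?case .
qed

text \<open>On monomials the law holds summand by summand: component \<open>k\<close> is the Leibniz
  rule of \<open>A\<close>, and in every other component both sides have the threefold
  product.\<close>

lemma q_bracket_leibniz:
  assumes c: "c \<in> carrier F" and d: "d \<in> carrier F" and e: "e \<in> carrier F"
  shows "q (B (c \<otimes>\<^bsub>F\<^esub> d) e) = q (c \<otimes>\<^bsub>F\<^esub> B d e) \<oplus>\<^bsub>TP\<^esub> q (B c e \<otimes>\<^bsub>F\<^esub> d)"
proof (rule fp.hom_eqI[OF TP_group add_hom_comp[OF fp.mult_hom_l q_bracket_hom_l]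
      add_hom_plus[OF TP_group add_hom_comp[OF fp.mult_hom_l q_hom]
        add_hom_comp[OF free_bracket_hom_l add_hom_comp[OF fp.mult_hom_l q_hom]]] _ c])
  fix r x assume r: "r \<in> carrier K" and x: "x \<in> carrier M"
  have rx: "mon r x \<in> carrier F" using r x by (rule fp.mon_closed)
  show "q (B (mon r x \<otimes>\<^bsub>F\<^esub> d) e) = q (mon r x \<otimes>\<^bsub>F\<^esub> B d e) \<oplus>\<^bsub>TP\<^esub> q (B (mon r x) e \<otimes>\<^bsub>F\<^esub> d)"
  proof (rule fp.hom_eqI[OF TP_group add_hom_comp[OF fp.mult_hom_r q_bracket_hom_l]
        add_hom_plus[OF TP_group add_hom_comp[OF free_bracket_hom_l add_hom_comp[OF fp.mult_hom_r q_hom]]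
          add_hom_comp[OF fp.mult_hom_r q_hom]] _ d])
    fix s y assume s: "s \<in> carrier K" and y: "y \<in> carrier M"
    have sy: "mon s y \<in> carrier F" using s y by (rule fp.mon_closed)
    show "q (B (mon r x \<otimes>\<^bsub>F\<^esub> mon s y) e) = q (mon r x \<otimes>\<^bsub>F\<^esub> B (mon s y) e) \<oplus>\<^bsub>TP\<^esub> q (B (mon r x) e \<otimes>\<^bsub>F\<^esub> mon s y)"
    proof (rule fp.hom_eqI[OF TP_group q_bracket_hom_r
          add_hom_plus[OF TP_group add_hom_comp[OF free_bracket_hom_r add_hom_comp[OF fp.mult_hom_r q_hom]]
            add_hom_comp[OF free_bracket_hom_r add_hom_comp[OF fp.mult_hom_l q_hom]]] _ e])
      fix t z assume t: "t \<in> carrier K" and z: "z \<in> carrier M"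
      let ?w = "x \<otimes>\<^bsub>M\<^esub> y \<otimes>\<^bsub>M\<^esub> z" and ?c = "r \<otimes>\<^bsub>K\<^esub> s \<otimes>\<^bsub>K\<^esub> t"
      \<comment> \<open>All three terms of the law are brought to this form: the product tuple
        \<open>?w\<close> with only component \<open>k\<close> changed.\<close>
      let ?m = "\<lambda>k a. q (mon ?c (?w(k := a)))"
      have w: "?w \<in> carrier M" using x y z by (intro fp.M.m_closed)
      have c: "?c \<in> carrier K" using r s t by simp
      have m: "?m k a \<in> carrier TP" if "k \<in> {1..n}" "a \<in> carrier A" for k a
        using c w that by (intro q_closed fp.mon_closed upd_closed)
      have comp: "x k \<in> carrier A" "y k \<in> carrier A" "z k \<in> carrier A" if "k \<in> {1..n}" for k
        using comp_closed[OF x that] comp_closed[OF y that] comp_closed[OF z that] by simp_all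
      have "q (B (mon r x \<otimes>\<^bsub>F\<^esub> mon s y) (mon t z)) = (\<Oplus>\<^bsub>TP\<^esub>k\<in>{1..n}. q (mon ?c (bracket_at k (x \<otimes>\<^bsub>M\<^esub> y) z)))"
        using r s t x y z fp.M.m_closed[OF x y] by (simp add: fp.mult_mon q_bracket_mon)
      also have "\<dots> = (\<Oplus>\<^bsub>TP\<^esub>k\<in>{1..n}. ?m k (x k \<otimes>\<^bsub>A\<^esub> \<lbrace>y k, z k\<rbrace>\<^bsub>A\<^esub>) \<oplus>\<^bsub>TP\<^esub> ?m k (\<lbrace>x k, z k\<rbrace>\<^bsub>A\<^esub> \<otimes>\<^bsub>A\<^esub> y k))"
      proof (rule TP.finsum_cong'[OF refl])
        fix k assume k: "k \<in> {1..n}"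
        have "\<lbrace>(x \<otimes>\<^bsub>M\<^esub> y) k, z k\<rbrace>\<^bsub>A\<^esub> = x k \<otimes>\<^bsub>A\<^esub> \<lbrace>y k, z k\<rbrace>\<^bsub>A\<^esub> \<oplus>\<^bsub>A\<^esub> \<lbrace>x k, z k\<rbrace>\<^bsub>A\<^esub> \<otimes>\<^bsub>A\<^esub> y k"
          using k comp[OF k] by (simp add: mult_product_group bracket_leibniz)
        then have "bracket_at k (x \<otimes>\<^bsub>M\<^esub> y) z =
            ?w(k := x k \<otimes>\<^bsub>A\<^esub> \<lbrace>y k, z k\<rbrace>\<^bsub>A\<^esub> \<oplus>\<^bsub>A\<^esub> \<lbrace>x k, z k\<rbrace>\<^bsub>A\<^esub> \<otimes>\<^bsub>A\<^esub> y k)"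
          by (simp only: bracket_at_eq_upd[OF k])
        then show "q (mon ?c (bracket_at k (x \<otimes>\<^bsub>M\<^esub> y) z)) =
            ?m k (x k \<otimes>\<^bsub>A\<^esub> \<lbrace>y k, z k\<rbrace>\<^bsub>A\<^esub>) \<oplus>\<^bsub>TP\<^esub> ?m k (\<lbrace>x k, z k\<rbrace>\<^bsub>A\<^esub> \<otimes>\<^bsub>A\<^esub> y k)"
          using q_mon_add[OF c w k] comp[OF k] by (simp only: A.m_closed bracket_closed)
      qed (simp add: Pi_iff m comp)
      also have "\<dots> = (\<Oplus>\<^bsub>TP\<^esub>k\<in>{1..n}. ?m k (x k \<otimes>\<^bsub>A\<^esub> \<lbrace>y k, z k\<rbrace>\<^bsub>A\<^esub>)) \<oplus>\<^bsub>TP\<^esub>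
          (\<Oplus>\<^bsub>TP\<^esub>k\<in>{1..n}. ?m k (\<lbrace>x k, z k\<rbrace>\<^bsub>A\<^esub> \<otimes>\<^bsub>A\<^esub> y k))"
        by (intro TP.finsum_addf) (simp_all add: Pi_iff m comp)
      also have "(\<Oplus>\<^bsub>TP\<^esub>k\<in>{1..n}. ?m k (x k \<otimes>\<^bsub>A\<^esub> \<lbrace>y k, z k\<rbrace>\<^bsub>A\<^esub>)) = q (mon r x \<otimes>\<^bsub>F\<^esub> B (mon s y) (mon t z))"
      proof -
        have "q (mon r x \<otimes>\<^bsub>F\<^esub> B (mon s y) (mon t z)) =
            (\<Oplus>\<^bsub>TP\<^esub>k\<in>{1..n}. q (mon r x \<otimes>\<^bsub>F\<^esub> mon (s \<otimes>\<^bsub>K\<^esub> t) (bracket_at k y z)))"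
          unfolding free_bracket_mon[OF s y t z]
          by (rule add_hom_finsum[OF F_group TP_group add_hom_comp[OF fp.mult_hom_r[OF rx] q_hom]])
             (use s t y z in auto)
        also have "\<dots> = (\<Oplus>\<^bsub>TP\<^esub>k\<in>{1..n}. ?m k (x k \<otimes>\<^bsub>A\<^esub> \<lbrace>y k, z k\<rbrace>\<^bsub>A\<^esub>))"
        proof (rule TP.finsum_cong'[OF refl])
          fix k assume k: "k \<in> {1..n}"
          show "q (mon r x \<otimes>\<^bsub>F\<^esub> mon (s \<otimes>\<^bsub>K\<^esub> t) (bracket_at k y z)) = ?m k (x k \<otimes>\<^bsub>A\<^esub> \<lbrace>y k, z k\<rbrace>\<^bsub>A\<^esub>)"
            using r s t x y z bracket_at_closed[OF y z, of k]
            by (simp add: fp.mult_mon bracket_at_eq_upd[OF k] mult_upd[OF k] K.m_assoc fp.M.m_assoc)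
        qed (simp add: Pi_iff m comp)
        finally show ?thesis by simp
      qed
      also have "(\<Oplus>\<^bsub>TP\<^esub>k\<in>{1..n}. ?m k (\<lbrace>x k, z k\<rbrace>\<^bsub>A\<^esub> \<otimes>\<^bsub>A\<^esub> y k)) = q (B (mon r x) (mon t z) \<otimes>\<^bsub>F\<^esub> mon s y)"
      proof -
        have "q (B (mon r x) (mon t z) \<otimes>\<^bsub>F\<^esub> mon s y) =
            (\<Oplus>\<^bsub>TP\<^esub>k\<in>{1..n}. q (mon (r \<otimes>\<^bsub>K\<^esub> t) (bracket_at k x z) \<otimes>\<^bsub>F\<^esub> mon s y))"
          unfolding free_bracket_mon[OF r x t z]
          by (rule add_hom_finsum[OF F_group TP_group add_hom_comp[OF fp.mult_hom_l[OF sy] q_hom]])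
             (use r t x z in auto)
        also have "\<dots> = (\<Oplus>\<^bsub>TP\<^esub>k\<in>{1..n}. ?m k (\<lbrace>x k, z k\<rbrace>\<^bsub>A\<^esub> \<otimes>\<^bsub>A\<^esub> y k))"
        proof (rule TP.finsum_cong'[OF refl])
          fix k assume k: "k \<in> {1..n}"
          have "mon (r \<otimes>\<^bsub>K\<^esub> t) (bracket_at k x z) \<otimes>\<^bsub>F\<^esub> mon s y =
              mon (s \<otimes>\<^bsub>K\<^esub> (r \<otimes>\<^bsub>K\<^esub> t)) (y \<otimes>\<^bsub>M\<^esub> bracket_at k x z)"
            using r s t x y z bracket_at_closed[OF x z, of k]
            by (simp add: fp.mult_mon K.m_comm[of _ s] fp.M.m_comm[of _ y])
          also have "y \<otimes>\<^bsub>M\<^esub> bracket_at k x z = ?w(k := \<lbrace>x k, z k\<rbrace>\<^bsub>A\<^esub> \<otimes>\<^bsub>A\<^esub> y k)"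
            using x y z comp[OF k] A.m_comm[of "y k"]
            by (simp add: bracket_at_eq_upd[OF k] mult_upd[OF k] fp.M.m_assoc fp.M.m_lcomm)
          also have "s \<otimes>\<^bsub>K\<^esub> (r \<otimes>\<^bsub>K\<^esub> t) = ?c"
            using r s t by (simp add: K.m_assoc K.m_lcomm)
          finally show "q (mon (r \<otimes>\<^bsub>K\<^esub> t) (bracket_at k x z) \<otimes>\<^bsub>F\<^esub> mon s y) = ?m k (\<lbrace>x k, z k\<rbrace>\<^bsub>A\<^esub> \<otimes>\<^bsub>A\<^esub> y k)"
            by (simp only:)
        qed (simp add: Pi_iff m comp)
        finally show ?thesis by simp
      qed
      finally show "q (B (mon r x \<otimes>\<^bsub>F\<^esub> mon s y) (mon t z)) =
          q (mon r x \<otimes>\<^bsub>F\<^esub> B (mon s y) (mon t z)) \<oplus>\<^bsub>TP\<^esub> q (B (mon r x) (mon t z) \<otimes>\<^bsub>F\<^esub> mon s y)" .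
    qed (rule rx sy F.m_closed[OF rx sy])+
  qed (rule rx e free_bracket_closed[OF rx e])+
qed (rule d e free_bracket_closed[OF d e])+

lemma pbracket_alternating_biderivation: "alternating_biderivation TP (pbracket TP)"
proof (rule alternating_biderivation.intro[OF TP.is_cring alternating_biderivation_axioms.intro])
  fix X Y assume X: "X \<in> carrier TP" and Y: "Y \<in> carrier TP"
  obtain c where c: "c \<in> carrier F" "X = q c" using q_surj[OF X] by (elim bexE)
  obtain d where d: "d \<in> carrier F" "Y = q d" using q_surj[OF Y] by (elim bexE)
  show "\<lbrace>X, Y\<rbrace>\<^bsub>TP\<^esub> \<in> carrier TP"
    unfolding c(2) d(2) pbracket_q[OF c(1) d(1)] by (rule q_bracket_closed[OF c(1) d(1)])
next
  fix X assume X: "X \<in> carrier TP"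
  obtain c where c: "c \<in> carrier F" "X = q c" using q_surj[OF X] by (elim bexE)
  show "\<lbrace>X, X\<rbrace>\<^bsub>TP\<^esub> = \<zero>\<^bsub>TP\<^esub>"
    unfolding c(2) pbracket_q[OF c(1) c(1)] by (rule q_bracket_self[OF c(1)])
next
  fix X Y Z assume X: "X \<in> carrier TP" and Y: "Y \<in> carrier TP" and Z: "Z \<in> carrier TP"
  obtain c where c: "c \<in> carrier F" "X = q c" using q_surj[OF X] by (elim bexE)
  obtain d where d: "d \<in> carrier F" "Y = q d" using q_surj[OF Y] by (elim bexE)
  obtain e where e: "e \<in> carrier F" "Z = q e" using q_surj[OF Z] by (elim bexE)
  note br = pbracket_q[OF c(1) d(1)] pbracket_q[OF c(1) e(1)] pbracket_q[OF d(1) e(1)]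
    pbracket_q[OF fp.F.add.m_closed[OF c(1) d(1)] e(1)] pbracket_q[OF c(1) fp.F.add.m_closed[OF d(1) e(1)]]
    pbracket_q[OF F.m_closed[OF c(1) d(1)] e(1)]
  show "\<lbrace>X \<oplus>\<^bsub>TP\<^esub> Y, Z\<rbrace>\<^bsub>TP\<^esub> = \<lbrace>X, Z\<rbrace>\<^bsub>TP\<^esub> \<oplus>\<^bsub>TP\<^esub> \<lbrace>Y, Z\<rbrace>\<^bsub>TP\<^esub>"
    unfolding c(2) d(2) e(2) q_add[OF c(1) d(1), symmetric] br
    by (rule add_hom_add[OF q_bracket_hom_l[OF e(1)] c(1) d(1)])
  show "\<lbrace>X, Y \<oplus>\<^bsub>TP\<^esub> Z\<rbrace>\<^bsub>TP\<^esub> = \<lbrace>X, Y\<rbrace>\<^bsub>TP\<^esub> \<oplus>\<^bsub>TP\<^esub> \<lbrace>X, Z\<rbrace>\<^bsub>TP\<^esub>"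
    unfolding c(2) d(2) e(2) q_add[OF d(1) e(1), symmetric] br
    by (rule add_hom_add[OF q_bracket_hom_r[OF c(1)] d(1) e(1)])
  show "\<lbrace>X \<otimes>\<^bsub>TP\<^esub> Y, Z\<rbrace>\<^bsub>TP\<^esub> = X \<otimes>\<^bsub>TP\<^esub> \<lbrace>Y, Z\<rbrace>\<^bsub>TP\<^esub> \<oplus>\<^bsub>TP\<^esub> \<lbrace>X, Z\<rbrace>\<^bsub>TP\<^esub> \<otimes>\<^bsub>TP\<^esub> Y"
    unfolding c(2) d(2) e(2) q_mult[OF c(1) d(1), symmetric] br
      q_mult[OF c(1) free_bracket_closed[OF d(1) e(1)], symmetric]
      q_mult[OF free_bracket_closed[OF c(1) e(1)] d(1), symmetric]
    by (rule q_bracket_leibniz[OF c(1) d(1) e(1)])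
qed

sublocale TP: alternating_biderivation TP "pbracket TP"
  by (rule pbracket_alternating_biderivation)

end

section \<open>Linear functionals\<close>

definition linear_subset :: "('k, 'r) ring_scheme \<Rightarrow> ('k, 'a, 's) module_scheme \<Rightarrow> 'a set \<Rightarrow> bool"
  where "linear_subset K A W \<longleftrightarrow> W \<subseteq> carrier A \<and> \<zero>\<^bsub>A\<^esub> \<in> W \<and>
    (\<forall>x\<in>W. \<forall>y\<in>W. x \<oplus>\<^bsub>A\<^esub> y \<in> W) \<and> (\<forall>r\<in>carrier K. \<forall>x\<in>W. r \<odot>\<^bsub>A\<^esub> x \<in> W)"

lemma linear_subset_Union_chain:
  assumes "\<C> \<noteq> {}" "\<And>W. W \<in> \<C> \<Longrightarrow> linear_subset K A W"
    and "\<And>V W. V \<in> \<C> \<Longrightarrow> W \<in> \<C> \<Longrightarrow> V \<subseteq> W \<or> W \<subseteq> V"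
  shows "linear_subset K A (\<Union>\<C>)"
  unfolding linear_subset_def
proof (intro conjI ballI)
  show "\<Union>\<C> \<subseteq> carrier A" "\<zero>\<^bsub>A\<^esub> \<in> \<Union>\<C>"
    using assms(1,2) unfolding linear_subset_def by blast+
  show "r \<odot>\<^bsub>A\<^esub> x \<in> \<Union>\<C>" if "r \<in> carrier K" "x \<in> \<Union>\<C>" for r x
    using that assms(2) unfolding linear_subset_def by blast
  fix x y assume "x \<in> \<Union>\<C>" "y \<in> \<Union>\<C>"
  then obtain V W where "V \<in> \<C>" "x \<in> V" "W \<in> \<C>" "y \<in> W" by blast
  then have "\<exists>U\<in>\<C>. x \<in> U \<and> y \<in> U" using assms(3) by blast
  then show "x \<oplus>\<^bsub>A\<^esub> y \<in> \<Union>\<C>" using assms(2) unfolding linear_subset_def by blast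
qed

context module
begin

lemma linear_subsetD:
  assumes "linear_subset R M W"
  shows "x \<in> W \<Longrightarrow> x \<in> carrier M" "\<zero>\<^bsub>M\<^esub> \<in> W" "\<lbrakk>x \<in> W; y \<in> W\<rbrakk> \<Longrightarrow> x \<oplus>\<^bsub>M\<^esub> y \<in> W"
    "\<lbrakk>r \<in> carrier R; x \<in> W\<rbrakk> \<Longrightarrow> r \<odot>\<^bsub>M\<^esub> x \<in> W"
  using assms by (auto simp: linear_subset_def)

lemma linear_subset_minus:
  assumes "linear_subset R M W" "x \<in> W"
  shows "\<ominus>\<^bsub>M\<^esub> x \<in> W"
  using linear_subsetD(4)[OF assms(1), of "\<ominus> \<one>" x] linear_subsetD(1)[OF assms] assms(2)
  by (simp add: smult_l_minus)

lemma linear_subset_extend: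
  assumes W: "linear_subset R M W" and a: "a \<in> carrier M"
  shows "linear_subset R M {w \<oplus>\<^bsub>M\<^esub> r \<odot>\<^bsub>M\<^esub> a | w r. w \<in> W \<and> r \<in> carrier R}" (is "linear_subset R M ?V")
  unfolding linear_subset_def
proof (intro conjI ballI)
  note WD = linear_subsetD[OF W]
  show "?V \<subseteq> carrier M" using WD(1) a by auto
  show "\<zero>\<^bsub>M\<^esub> \<in> ?V"
    using WD(2) a by (intro CollectI exI[of _ "\<zero>\<^bsub>M\<^esub>"] exI[of _ \<zero>]) simp
  fix x assume "x \<in> ?V"
  then obtain w r where x: "x = w \<oplus>\<^bsub>M\<^esub> r \<odot>\<^bsub>M\<^esub> a" "w \<in> W" "r \<in> carrier R" by blast
  show "s \<odot>\<^bsub>M\<^esub> x \<in> ?V" if "s \<in> carrier R" for s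
    using that x a WD by (intro CollectI exI[of _ "s \<odot>\<^bsub>M\<^esub> w"] exI[of _ "s \<otimes> r"])
      (simp add: smult_r_distr smult_assoc1)
  fix y assume "y \<in> ?V"
  then obtain v s where y: "y = v \<oplus>\<^bsub>M\<^esub> s \<odot>\<^bsub>M\<^esub> a" "v \<in> W" "s \<in> carrier R" by blast
  show "x \<oplus>\<^bsub>M\<^esub> y \<in> ?V"
    using x y a WD by (intro CollectI exI[of _ "w \<oplus>\<^bsub>M\<^esub> v"] exI[of _ "r \<oplus> s"])
      (simp add: smult_l_distr M.a_ac)
qed

lemma linear_subset_span:
  assumes J: "finite J" and f: "f \<in> J \<rightarrow> carrier M"
  shows "linear_subset R M {(\<Oplus>\<^bsub>M\<^esub>j\<in>J. c j \<odot>\<^bsub>M\<^esub> f j) | c. c \<in> J \<rightarrow> carrier R}" (is "linear_subset R M ?V")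
  unfolding linear_subset_def
proof (intro conjI ballI)
  have cl: "(\<lambda>j. c j \<odot>\<^bsub>M\<^esub> f j) \<in> J \<rightarrow> carrier M" if "c \<in> J \<rightarrow> carrier R" for c
    using that f by auto
  show "?V \<subseteq> carrier M" using cl by auto
  have "(\<Oplus>\<^bsub>M\<^esub>j\<in>J. \<zero> \<odot>\<^bsub>M\<^esub> f j) = (\<Oplus>\<^bsub>M\<^esub>j\<in>J. \<zero>\<^bsub>M\<^esub>)"
    using f by (intro M.finsum_cong') (auto simp: Pi_iff)
  then show "\<zero>\<^bsub>M\<^esub> \<in> ?V" by (intro CollectI exI[of _ "\<lambda>j. \<zero>"]) simp
  fix x assume "x \<in> ?V"
  then obtain c where c: "x = (\<Oplus>\<^bsub>M\<^esub>j\<in>J. c j \<odot>\<^bsub>M\<^esub> f j)" "c \<in> J \<rightarrow> carrier R" by blast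
  show "s \<odot>\<^bsub>M\<^esub> x \<in> ?V" if s: "s \<in> carrier R" for s
  proof (intro CollectI exI conjI)
    have "s \<odot>\<^bsub>M\<^esub> x = (\<Oplus>\<^bsub>M\<^esub>j\<in>J. s \<odot>\<^bsub>M\<^esub> (c j \<odot>\<^bsub>M\<^esub> f j))"
      unfolding c(1) by (rule finsum_smult_ldistr[OF J s cl[OF c(2)]])
    also have "\<dots> = (\<Oplus>\<^bsub>M\<^esub>j\<in>J. (s \<otimes> c j) \<odot>\<^bsub>M\<^esub> f j)"
      using s c f by (intro M.finsum_cong') (auto simp: smult_assoc1 Pi_iff)
    finally show "s \<odot>\<^bsub>M\<^esub> x = (\<Oplus>\<^bsub>M\<^esub>j\<in>J. (s \<otimes> c j) \<odot>\<^bsub>M\<^esub> f j)" .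
  qed (use s c in auto)
  fix y assume "y \<in> ?V"
  then obtain d where d: "y = (\<Oplus>\<^bsub>M\<^esub>j\<in>J. d j \<odot>\<^bsub>M\<^esub> f j)" "d \<in> J \<rightarrow> carrier R" by blast
  show "x \<oplus>\<^bsub>M\<^esub> y \<in> ?V"
  proof (intro CollectI exI conjI)
    have "x \<oplus>\<^bsub>M\<^esub> y = (\<Oplus>\<^bsub>M\<^esub>j\<in>J. c j \<odot>\<^bsub>M\<^esub> f j \<oplus>\<^bsub>M\<^esub> d j \<odot>\<^bsub>M\<^esub> f j)"
      unfolding c(1) d(1) by (rule M.finsum_addf[OF cl[OF c(2)] cl[OF d(2)], symmetric])
    also have "\<dots> = (\<Oplus>\<^bsub>M\<^esub>j\<in>J. (c j \<oplus> d j) \<odot>\<^bsub>M\<^esub> f j)"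
      using c d f by (intro M.finsum_cong') (auto simp: smult_l_distr Pi_iff)
    finally show "x \<oplus>\<^bsub>M\<^esub> y = (\<Oplus>\<^bsub>M\<^esub>j\<in>J. (c j \<oplus> d j) \<odot>\<^bsub>M\<^esub> f j)" .
  qed (use c d in auto)
qed

text \<open>Zorn's lemma, starting from the span of the other \<open>f j\<close>, which avoids
  \<open>f i\<close> by independence. The module may have infinite dimension, and the functional is
  needed on all of it; a maximal \<open>W\<close> supplies its kernel without the choice of a
  basis.\<close>

lemma exists_maximal_avoiding:
  assumes F: "field R" and J: "finite J" and ind: "lin_indep_family R M J f" and i: "i \<in> J"
  obtains W where "linear_subset R M W" "\<And>j. j \<in> J \<Longrightarrow> j \<noteq> i \<Longrightarrow> f j \<in> W" "f i \<notin> W"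
    "\<And>V. \<lbrakk>linear_subset R M V; W \<subseteq> V; f i \<notin> V\<rbrakk> \<Longrightarrow> V = W"
proof -
  interpret field R by fact
  let ?good = "{W. linear_subset R M W \<and> (\<forall>j\<in>J - {i}. f j \<in> W) \<and> f i \<notin> W}"
  have f: "f \<in> J \<rightarrow> carrier M" using ind by (simp add: lin_indep_family_def)
  let ?W0 = "{(\<Oplus>\<^bsub>M\<^esub>j\<in>J - {i}. c j \<odot>\<^bsub>M\<^esub> f j) | c. c \<in> J - {i} \<rightarrow> carrier R}"
  have "?W0 \<in> ?good"
  proof (rule CollectI, intro conjI ballI)
    show "linear_subset R M ?W0"
      by (rule linear_subset_span) (use J f in auto)
    fix j assume j: "j \<in> J - {i}"
    have "(\<Oplus>\<^bsub>M\<^esub>k\<in>J - {i}. (if k = j then \<one> else \<zero>) \<odot>\<^bsub>M\<^esub> f k) = (\<Oplus>\<^bsub>M\<^esub>k\<in>J - {i}. if j = k then f k else \<zero>\<^bsub>M\<^esub>)"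
      using f by (intro M.finsum_cong') (auto simp: Pi_iff)
    also have "\<dots> = f j"
      using M.finsum_singleton[of j "J - {i}" f] j J f by auto
    finally show "f j \<in> ?W0"
      by (intro CollectI exI[of _ "\<lambda>k. if k = j then \<one> else \<zero>"]) auto
  next
    show "f i \<notin> ?W0"
    proof
      assume "f i \<in> ?W0"
      then obtain c where c: "f i = (\<Oplus>\<^bsub>M\<^esub>j\<in>J - {i}. c j \<odot>\<^bsub>M\<^esub> f j)" "c \<in> J - {i} \<rightarrow> carrier R" by blast
      \<comment> \<open>The coefficient -1 at \<open>i\<close> turns the assumed expression of
        \<open>f i\<close> into a vanishing combination.\<close>
      let ?c = "c(i := \<ominus> \<one>)"
      have c': "?c \<in> J \<rightarrow> carrier R" using c by auto
      have "(\<Oplus>\<^bsub>M\<^esub>j\<in>insert i (J - {i}). ?c j \<odot>\<^bsub>M\<^esub> f j) =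
          ?c i \<odot>\<^bsub>M\<^esub> f i \<oplus>\<^bsub>M\<^esub> (\<Oplus>\<^bsub>M\<^esub>j\<in>J - {i}. ?c j \<odot>\<^bsub>M\<^esub> f j)"
        using J c(2) f i by (intro M.finsum_insert) (auto simp: Pi_iff)
      also have "(\<Oplus>\<^bsub>M\<^esub>j\<in>J - {i}. ?c j \<odot>\<^bsub>M\<^esub> f j) = (\<Oplus>\<^bsub>M\<^esub>j\<in>J - {i}. c j \<odot>\<^bsub>M\<^esub> f j)"
        using c f by (intro M.finsum_cong') (auto simp: Pi_iff)
      also have "\<dots> = f i" by (simp only: c(1)[symmetric])
      also have "?c i \<odot>\<^bsub>M\<^esub> f i \<oplus>\<^bsub>M\<^esub> f i = \<zero>\<^bsub>M\<^esub>"
        using f i by (simp add: smult_l_minus M.l_neg Pi_iff)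
      finally have "(\<Oplus>\<^bsub>M\<^esub>j\<in>J. ?c j \<odot>\<^bsub>M\<^esub> f j) = \<zero>\<^bsub>M\<^esub>" using i by (simp add: insert_absorb)
      then have "\<forall>j\<in>J. ?c j = \<zero>"
        using ind J c' unfolding lin_indep_family_def by blast
      then have "\<ominus> \<one> = \<zero>" using i by auto
      then show False
        using one_not_zero by (metis R.minus_minus R.minus_zero one_closed)
    qed
  qed
  then have ne: "?good \<noteq> {}" by blast
  obtain W where W: "W \<in> ?good" and max: "\<And>V. V \<in> ?good \<Longrightarrow> W \<subseteq> V \<Longrightarrow> V = W"
  proof -
    have "\<exists>W\<in>?good. \<forall>V\<in>?good. W \<subseteq> V \<longrightarrow> V = W"
    proof (rule subset_Zorn_nonempty[OF ne])
      fix \<C> assume ne: "\<C> \<noteq> {}" and chain: "subset.chain ?good \<C>"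
      have good: "W \<in> ?good" if "W \<in> \<C>" for W
        using chain that by (auto simp: subset.chain_def)
      have "linear_subset R M (\<Union>\<C>)"
      proof (rule linear_subset_Union_chain[OF ne])
        show "linear_subset R M W" if "W \<in> \<C>" for W using good[OF that] by blast
        show "V \<subseteq> W \<or> W \<subseteq> V" if "V \<in> \<C>" "W \<in> \<C>" for V W
          using chain that unfolding subset_chain_def by blast
      qed
      then show "\<Union>\<C> \<in> ?good" using good ne by blast
    qed
    then obtain W where "W \<in> ?good" "\<forall>V\<in>?good. W \<subseteq> V \<longrightarrow> V = W" by (rule bexE)
    then show ?thesis by (intro that[of W]) simp_all
  qed
  show ?thesis
  proof (rule that[of W])
    show "V = W" if "linear_subset R M V" "W \<subseteq> V" "f i \<notin> V" for V
    proof (rule max)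
      show "V \<in> ?good" using W that by (simp add: subset_iff)
    qed (rule that(2))
  qed (use W in simp_all)
qed

text \<open>\<open>\<phi>\<close> reads off the coefficient of \<open>f i\<close> modulo a maximal submodule that avoids \<open>f i\<close>.\<close>

lemma dual_functional:
  assumes F: "field R" and J: "finite J" and ind: "lin_indep_family R M J f" and i: "i \<in> J"
  obtains \<phi> where "\<phi> \<in> carrier M \<rightarrow> carrier R"
    "\<And>a b. \<lbrakk>a \<in> carrier M; b \<in> carrier M\<rbrakk> \<Longrightarrow> \<phi> (a \<oplus>\<^bsub>M\<^esub> b) = \<phi> a \<oplus> \<phi> b"
    "\<And>r a. \<lbrakk>r \<in> carrier R; a \<in> carrier M\<rbrakk> \<Longrightarrow> \<phi> (r \<odot>\<^bsub>M\<^esub> a) = r \<otimes> \<phi> a"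
    "\<And>j. j \<in> J \<Longrightarrow> \<phi> (f j) = (if j = i then \<one> else \<zero>)"
proof -
  interpret field R by fact
  obtain W where W: "linear_subset R M W" and fW: "\<And>j. j \<in> J \<Longrightarrow> j \<noteq> i \<Longrightarrow> f j \<in> W"
    and fi: "f i \<notin> W" and max: "\<And>V. \<lbrakk>linear_subset R M V; W \<subseteq> V; f i \<notin> V\<rbrakk> \<Longrightarrow> V = W"
    using exists_maximal_avoiding[OF assms] by metis
  note WD = linear_subsetD[OF W]
  have f: "f i \<in> carrier M" using ind i by (auto simp: lin_indep_family_def)
  have unit: "inv r \<in> carrier R" "inv r \<otimes> r = \<one>" if "r \<in> carrier R" "r \<noteq> \<zero>" for r
    using that field_Units by auto
  \<comment> \<open>\<open>W\<close> and \<open>f i\<close> span the module: a vector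
    \<open>a\<close> outside \<open>W\<close> enlarges it to a submodule that must contain
    \<open>f i\<close>, and the coefficient of \<open>a\<close> in \<open>f i\<close> is invertible
    because \<open>f i \<notin> W\<close>.\<close>
  have ex: "\<exists>c\<in>carrier R. \<exists>w\<in>W. a = w \<oplus>\<^bsub>M\<^esub> c \<odot>\<^bsub>M\<^esub> f i" if a: "a \<in> carrier M" for a
  proof (cases "a \<in> W")
    case True
    then show ?thesis using a f by (intro bexI[of _ \<zero>] bexI[of _ a]) auto
  next
    case False
    let ?V = "{w \<oplus>\<^bsub>M\<^esub> r \<odot>\<^bsub>M\<^esub> a | w r. w \<in> W \<and> r \<in> carrier R}"
    have WV: "W \<subseteq> ?V"
    proof
      fix w assume "w \<in> W"
      then show "w \<in> ?V" using WD(1) a by (intro CollectI exI[of _ w] exI[of _ \<zero>]) simp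
    qed
    have "a \<in> ?V"
      using WD(2) a by (intro CollectI exI[of _ "\<zero>\<^bsub>M\<^esub>"] exI[of _ \<one>]) simp
    then have "f i \<in> ?V" using max[OF linear_subset_extend[OF W a] WV] False by blast
    then obtain w r where w: "f i = w \<oplus>\<^bsub>M\<^esub> r \<odot>\<^bsub>M\<^esub> a" "w \<in> W" "r \<in> carrier R" by blast
    have r: "r \<noteq> \<zero>" using w fi a WD(1) by auto
    note u = unit[OF w(3) r]
    have wM: "w \<in> carrier M" "inv r \<odot>\<^bsub>M\<^esub> w \<in> carrier M" using w WD(1) u by auto
    have "inv r \<odot>\<^bsub>M\<^esub> f i = inv r \<odot>\<^bsub>M\<^esub> w \<oplus>\<^bsub>M\<^esub> a"
      using w(3) wM a u unfolding w(1) by (simp add: smult_r_distr smult_assoc1[symmetric])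
    then have "a = \<ominus>\<^bsub>M\<^esub> (inv r \<odot>\<^bsub>M\<^esub> w) \<oplus>\<^bsub>M\<^esub> inv r \<odot>\<^bsub>M\<^esub> f i"
      using wM a by (simp add: M.r_neg1)
    then show ?thesis
      using u linear_subset_minus[OF W WD(4)[OF u(1) w(2)]] by blast
  qed
  \<comment> \<open>The sum is direct: otherwise a nonzero multiple of \<open>f i\<close>, hence
    \<open>f i\<close> itself, would lie in \<open>W\<close>.\<close>
  have uniq: "c = d" if eq: "w \<oplus>\<^bsub>M\<^esub> c \<odot>\<^bsub>M\<^esub> f i = v \<oplus>\<^bsub>M\<^esub> d \<odot>\<^bsub>M\<^esub> f i"
    and cd: "c \<in> carrier R" "d \<in> carrier R" and wv: "w \<in> W" "v \<in> W" for c d w v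
  proof (rule ccontr)
    assume "c \<noteq> d"
    have wvM: "w \<in> carrier M" "v \<in> carrier M" using wv WD(1) by auto
    have cdne: "c \<ominus> d \<noteq> \<zero>"
      using \<open>c \<noteq> d\<close> cd by (metis R.add.inv_solve_right' R.l_zero R.zero_closed R.minus_eq)
    have cl: "c \<ominus> d \<in> carrier R" using cd by simp
    have "(c \<ominus> d) \<odot>\<^bsub>M\<^esub> f i = c \<odot>\<^bsub>M\<^esub> f i \<oplus>\<^bsub>M\<^esub> \<ominus>\<^bsub>M\<^esub> (d \<odot>\<^bsub>M\<^esub> f i)"
      using cd f by (simp add: R.minus_eq smult_l_distr smult_l_minus)
    also have "c \<odot>\<^bsub>M\<^esub> f i = \<ominus>\<^bsub>M\<^esub> w \<oplus>\<^bsub>M\<^esub> (v \<oplus>\<^bsub>M\<^esub> d \<odot>\<^bsub>M\<^esub> f i)"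
      using eq[symmetric] wvM cd f by (simp add: M.r_neg1)
    also have "\<dots> \<oplus>\<^bsub>M\<^esub> \<ominus>\<^bsub>M\<^esub> (d \<odot>\<^bsub>M\<^esub> f i) = \<ominus>\<^bsub>M\<^esub> w \<oplus>\<^bsub>M\<^esub> v"
      using wvM cd f by (simp add: M.a_assoc M.r_neg)
    finally have "(c \<ominus> d) \<odot>\<^bsub>M\<^esub> f i \<in> W"
      using WD(3)[OF linear_subset_minus[OF W wv(1)] wv(2)] by simp
    then have "inv (c \<ominus> d) \<odot>\<^bsub>M\<^esub> ((c \<ominus> d) \<odot>\<^bsub>M\<^esub> f i) \<in> W"
      by (rule WD(4)[OF unit(1)[OF cl cdne]])
    then have "f i \<in> W"
      using unit[OF cl cdne] cl f by (simp add: smult_assoc1[symmetric])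
    then show False using fi by contradiction
  qed
  define \<phi> where "\<phi> a = (THE c. c \<in> carrier R \<and> (\<exists>w\<in>W. a = w \<oplus>\<^bsub>M\<^esub> c \<odot>\<^bsub>M\<^esub> f i))" for a
  have \<phi>: "\<phi> (w \<oplus>\<^bsub>M\<^esub> c \<odot>\<^bsub>M\<^esub> f i) = c" if "c \<in> carrier R" "w \<in> W" for c w
    unfolding \<phi>_def by (rule the_equality) (use that uniq in blast)+
  show ?thesis
  proof (rule that[of \<phi>])
    show "\<phi> \<in> carrier M \<rightarrow> carrier R"
      using ex \<phi> by fastforce
    show "\<phi> (a \<oplus>\<^bsub>M\<^esub> b) = \<phi> a \<oplus> \<phi> b" if a: "a \<in> carrier M" and b: "b \<in> carrier M" for a b
    proof -
      obtain c w where c: "c \<in> carrier R" "w \<in> W" "a = w \<oplus>\<^bsub>M\<^esub> c \<odot>\<^bsub>M\<^esub> f i" using ex[OF a] by blast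
      obtain d v where d: "d \<in> carrier R" "v \<in> W" "b = v \<oplus>\<^bsub>M\<^esub> d \<odot>\<^bsub>M\<^esub> f i" using ex[OF b] by blast
      have "a \<oplus>\<^bsub>M\<^esub> b = (w \<oplus>\<^bsub>M\<^esub> v) \<oplus>\<^bsub>M\<^esub> (c \<oplus> d) \<odot>\<^bsub>M\<^esub> f i"
        using c d f WD(1) by (simp add: smult_l_distr M.a_ac)
      then show ?thesis
        using c d \<phi>[OF R.a_closed[OF c(1) d(1)] WD(3)[OF c(2) d(2)]] by (simp add: \<phi>)
    qed
    show "\<phi> (r \<odot>\<^bsub>M\<^esub> a) = r \<otimes> \<phi> a" if r: "r \<in> carrier R" and a: "a \<in> carrier M" for r a
    proof -
      obtain c w where c: "c \<in> carrier R" "w \<in> W" "a = w \<oplus>\<^bsub>M\<^esub> c \<odot>\<^bsub>M\<^esub> f i" using ex[OF a] by blast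
      have "r \<odot>\<^bsub>M\<^esub> a = r \<odot>\<^bsub>M\<^esub> w \<oplus>\<^bsub>M\<^esub> (r \<otimes> c) \<odot>\<^bsub>M\<^esub> f i"
        using c r f WD(1) by (simp add: smult_r_distr smult_assoc1)
      then show ?thesis
        using c \<phi>[OF R.m_closed[OF r c(1)] WD(4)[OF r c(2)]] by (simp add: \<phi>)
    qed
    show "\<phi> (f j) = (if j = i then \<one> else \<zero>)" if j: "j \<in> J" for j
    proof (cases "j = i")
      case True
      then show ?thesis using \<phi>[OF R.one_closed WD(2)] f by simp
    next
      case False
      then show ?thesis using \<phi>[OF R.zero_closed fW[OF j False]] f WD(1)[OF fW[OF j False]] by simp
    qed
  qed
qed

end

section \<open>Antisymmetrised tensors\<close>

lemma (in comm_monoid) finprod_remove: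
  assumes "finite S" "i \<in> S" "g \<in> S \<rightarrow> carrier G"
  shows "finprod G g S = g i \<otimes> finprod G g (S - {i})"
proof -
  have "finprod G g (insert i (S - {i})) = g i \<otimes> finprod G g (S - {i})"
    using assms by (intro finprod_insert) auto
  then show ?thesis using assms(2) by (simp add: insert_absorb)
qed

lemma (in cring) finprod_zero:
  assumes "finite S" "i \<in> S" "g \<in> S \<rightarrow> carrier R" "g i = \<zero>"
  shows "finprod R g S = \<zero>"
  using finprod_remove[OF assms(1-3)] assms(3,4) finprod_closed[of g "S - {i}"] by (auto simp: Pi_iff)

lemma add_hom_sign:
  assumes G: "abelian_group G" and H: "abelian_group H"
    and \<phi>: "\<phi> \<in> hom (add_monoid G) (add_monoid H)" and x: "x \<in> carrier G"
  shows "\<phi> ([sign \<sigma>] \<cdot>\<^bsub>G\<^esub> x) = [sign \<sigma>] \<cdot>\<^bsub>H\<^esub> \<phi> x"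
proof -
  interpret G: abelian_group G by fact
  interpret H: abelian_group H by fact
  have "\<phi> (\<ominus>\<^bsub>G\<^esub> x) = \<ominus>\<^bsub>H\<^esub> \<phi> x"
    using add_hom_minus[OF G H \<phi> G.zero_closed x] add_hom_zero[OF G H \<phi>] x add_hom_closed[OF \<phi> x]
    by (simp add: G.minus_eq H.minus_eq)
  then show ?thesis
    using x add_hom_closed[OF \<phi> x] by (simp add: G.sign_add_pow H.sign_add_pow)
qed

section \<open>Products of linear functionals\<close>

context poisson_tensor
begin

text \<open>The product of the functionals \<open>\<phi> k\<close>, taken on the free module: it is
  applied to representatives, and well-definedness becomes the statement that it kills the tensor
  ideal.\<close>

definition tensor_functional :: "(nat \<Rightarrow> 'a \<Rightarrow> 'k) \<Rightarrow> ((nat \<Rightarrow> 'a) \<Rightarrow> 'k) \<Rightarrow> 'k"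
  where "tensor_functional \<phi> = lin_ext K K (\<lambda>x r. r \<otimes>\<^bsub>K\<^esub> (\<Otimes>\<^bsub>K\<^esub>k\<in>{1..n}. \<phi> k (x k)))"

lemma
  assumes \<phi>: "\<phi> \<in> {1..n} \<rightarrow> carrier A \<rightarrow> carrier K"
  shows tensor_functional_hom: "tensor_functional \<phi> \<in> hom (add_monoid F) (add_monoid K)"
    and tensor_functional_mon: "\<lbrakk>r \<in> carrier K; x \<in> carrier M\<rbrakk> \<Longrightarrow>
      tensor_functional \<phi> (mon r x) = r \<otimes>\<^bsub>K\<^esub> (\<Otimes>\<^bsub>K\<^esub>k\<in>{1..n}. \<phi> k (x k))"
proof -
  have prod: "(\<Otimes>\<^bsub>K\<^esub>k\<in>{1..n}. \<phi> k (x k)) \<in> carrier K" if "x \<in> carrier M" for x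
    using \<phi> comp_closed[OF that] by (intro K.finprod_closed Pi_I) (simp add: Pi_iff)
  have h: "(\<lambda>r. r \<otimes>\<^bsub>K\<^esub> (\<Otimes>\<^bsub>K\<^esub>k\<in>{1..n}. \<phi> k (x k))) \<in> hom (add_monoid K) (add_monoid K)"
    if "x \<in> carrier M" for x
    using prod[OF that] by (simp add: add_hom_iff K.l_distr)
  show "tensor_functional \<phi> \<in> hom (add_monoid F) (add_monoid K)"
    unfolding tensor_functional_def by (rule fp.lin_ext_hom[OF K.abelian_group_axioms h])
  show "tensor_functional \<phi> (mon r x) = r \<otimes>\<^bsub>K\<^esub> (\<Otimes>\<^bsub>K\<^esub>k\<in>{1..n}. \<phi> k (x k))"
    if "r \<in> carrier K" "x \<in> carrier M"
    unfolding tensor_functional_def by (rule fp.lin_ext_mon[OF K.abelian_group_axioms h that])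
qed

text \<open>The factor \<open>i\<close> is split off from the product; it is linear, and the
  remaining factors do not see a change of component \<open>i\<close>.\<close>

lemma tensor_functional_vanish:
  assumes \<phi>: "\<phi> \<in> {1..n} \<rightarrow> carrier A \<rightarrow> carrier K"
    and add: "\<And>k a b. \<lbrakk>k \<in> {1..n}; a \<in> carrier A; b \<in> carrier A\<rbrakk> \<Longrightarrow> \<phi> k (a \<oplus>\<^bsub>A\<^esub> b) = \<phi> k a \<oplus>\<^bsub>K\<^esub> \<phi> k b"
    and smult: "\<And>k r a. \<lbrakk>k \<in> {1..n}; r \<in> carrier K; a \<in> carrier A\<rbrakk> \<Longrightarrow> \<phi> k (r \<odot>\<^bsub>A\<^esub> a) = r \<otimes>\<^bsub>K\<^esub> \<phi> k a"
    and c: "c \<in> I"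
  shows "tensor_functional \<phi> c = \<zero>\<^bsub>K\<^esub>"
proof -
  have \<phi>_closed: "\<phi> k a \<in> carrier K" if "k \<in> {1..n}" "a \<in> carrier A" for k a
    using \<phi> that by (simp add: Pi_iff)
  have upd: "(\<Otimes>\<^bsub>K\<^esub>k\<in>{1..n}. \<phi> k ((x(i := a)) k)) = \<phi> i a \<otimes>\<^bsub>K\<^esub> (\<Otimes>\<^bsub>K\<^esub>k\<in>{1..n} - {i}. \<phi> k (x k))"
    if x: "x \<in> carrier M" and i: "i \<in> {1..n}" and a: "a \<in> carrier A" for x i a
  proof -
    have "(\<Otimes>\<^bsub>K\<^esub>k\<in>{1..n}. \<phi> k ((x(i := a)) k)) =
        \<phi> i ((x(i := a)) i) \<otimes>\<^bsub>K\<^esub> (\<Otimes>\<^bsub>K\<^esub>k\<in>{1..n} - {i}. \<phi> k ((x(i := a)) k))"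
      using \<phi>_closed comp_closed[OF upd_closed[OF x i a]] by (intro K.finprod_remove[OF _ i] Pi_I) blast+
    also have "(\<Otimes>\<^bsub>K\<^esub>k\<in>{1..n} - {i}. \<phi> k ((x(i := a)) k)) = (\<Otimes>\<^bsub>K\<^esub>k\<in>{1..n} - {i}. \<phi> k (x k))"
      using \<phi>_closed comp_closed[OF x] by (intro K.finprod_cong') auto
    finally show ?thesis by simp
  qed
  have rest: "(\<Otimes>\<^bsub>K\<^esub>k\<in>{1..n} - {i}. \<phi> k (x k)) \<in> carrier K" if "x \<in> carrier M" for x i
    using \<phi>_closed comp_closed[OF that] by (intro K.finprod_closed Pi_I) blast
  show ?thesis
  proof (rule tensor_ideal_universal[OF K.abelian_group_axioms tensor_functional_hom[OF \<phi>] _ _ c])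
    fix r x i a b
    assume r: "r \<in> carrier K" and x: "x \<in> carrier M" and i: "i \<in> {1..n}"
      and a: "a \<in> carrier A" and b: "b \<in> carrier A"
    note mon = tensor_functional_mon[OF \<phi> r upd_closed[OF x i]]
    show "tensor_functional \<phi> (mon r (x(i := a \<oplus>\<^bsub>A\<^esub> b))) =
        tensor_functional \<phi> (mon r (x(i := a))) \<oplus>\<^bsub>K\<^esub> tensor_functional \<phi> (mon r (x(i := b)))"
      unfolding mon[OF a] mon[OF b] mon[OF A.add.m_closed[OF a b]] upd[OF x i a] upd[OF x i b]
        upd[OF x i A.add.m_closed[OF a b]] add[OF i a b]
      using r \<phi>_closed[OF i a] \<phi>_closed[OF i b] rest[OF x] by (simp add: K.l_distr K.r_distr)
  next
    fix r s x i a
    assume r: "r \<in> carrier K" and s: "s \<in> carrier K" and x: "x \<in> carrier M" and i: "i \<in> {1..n}"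
      and a: "a \<in> carrier A"
    note mon = tensor_functional_mon[OF \<phi> r upd_closed[OF x i]]
      tensor_functional_mon[OF \<phi> K.m_closed[OF r s] upd_closed[OF x i]]
    show "tensor_functional \<phi> (mon r (x(i := s \<odot>\<^bsub>A\<^esub> a))) = tensor_functional \<phi> (mon (r \<otimes>\<^bsub>K\<^esub> s) (x(i := a)))"
      unfolding mon(1)[OF smult_closed[OF s a]] mon(2)[OF a] upd[OF x i a]
        upd[OF x i smult_closed[OF s a]] smult[OF i s a]
      using r s \<phi>_closed[OF i a] rest[OF x] by (simp add: K.m_assoc)
  qed
qed

end

section \<open>Copies of the algebra inside its tensor power\<close>

context poisson_tensor_domain
begin

text \<open>The copy of \<open>a\<close> in factor \<open>k\<close> from the overview. For
  \<open>k\<close> outside \<open>{1..n}\<close> the tuple is constant and the value is the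
  unit.\<close>

definition factor_emb :: "nat \<Rightarrow> 'a \<Rightarrow> ((nat \<Rightarrow> 'a) \<Rightarrow> 'k) set"
  where "factor_emb k a = q (single K (\<lambda>i\<in>{1..n}. if i = k then a else \<one>\<^bsub>A\<^esub>))"

lemma tuple_closed [simp, intro]:
  "(\<And>i. i \<in> {1..n} \<Longrightarrow> g i \<in> carrier A) \<Longrightarrow> (\<lambda>i\<in>{1..n}. g i) \<in> carrier M"
  by (simp add: carrier_product_group PiE_iff)

lemma factor_emb_closed [simp, intro]: "a \<in> carrier A \<Longrightarrow> factor_emb k a \<in> carrier TP"
  unfolding factor_emb_def by (intro q_closed single_closed tuple_closed) simp

text \<open>Induction over the set \<open>S\<close> of positions already filled, with the unit in
  the others; each further copy fills one position.\<close>

lemma pure_tensor_eq_prod: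
  assumes g: "\<And>k. k \<in> {1..n} \<Longrightarrow> g k \<in> carrier A"
  shows "pure_tensor K A n g = (\<Otimes>\<^bsub>TP\<^esub>k\<in>{1..n}. factor_emb k (g k))"
proof -
  have "(\<Otimes>\<^bsub>TP\<^esub>k\<in>S. factor_emb k (g k)) = q (single K (\<lambda>i\<in>{1..n}. if i \<in> S then g i else \<one>\<^bsub>A\<^esub>))"
    if "S \<subseteq> {1..n}" for S
    using finite_subset[OF that finite_atLeastAtMost] that
  proof (induction S rule: finite_induct)
    case empty
    have "\<one>\<^bsub>F\<^esub> = single K (\<lambda>i\<in>{1..n}. \<one>\<^bsub>A\<^esub>)"
      by (simp only: fp.one_eq_mon one_product_group single_eq_monom_elem)
    then show ?case using q_one by (simp only: TP.finprod_empty empty_iff if_False)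
  next
    case (insert k S)
    let ?x = "\<lambda>i\<in>{1..n}. if i = k then g k else \<one>\<^bsub>A\<^esub>" and ?y = "\<lambda>i\<in>{1..n}. if i \<in> S then g i else \<one>\<^bsub>A\<^esub>"
    have k: "k \<in> {1..n}" and S: "S \<subseteq> {1..n}" using insert.prems by auto
    have x: "?x \<in> carrier M" using g[OF k] by (intro tuple_closed) simp
    have y: "?y \<in> carrier M" using g by (intro tuple_closed) simp
    have "(\<Otimes>\<^bsub>TP\<^esub>k\<in>insert k S. factor_emb k (g k)) = factor_emb k (g k) \<otimes>\<^bsub>TP\<^esub> (\<Otimes>\<^bsub>TP\<^esub>k\<in>S. factor_emb k (g k))"
      using insert.hyps g[OF k] g S by (intro TP.finprod_insert) auto
    also have "\<dots> = q (single K ?x) \<otimes>\<^bsub>TP\<^esub> q (single K ?y)"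
      using insert.IH[OF S] by (simp only: factor_emb_def)
    also have "\<dots> = q (single K (?x \<otimes>\<^bsub>M\<^esub> ?y))"
      using q_mult[OF single_closed[OF x] single_closed[OF y]]
      by (simp add: single_eq_monom_elem fp.mult_mon[OF K.one_closed x K.one_closed y])
    also have "?x \<otimes>\<^bsub>M\<^esub> ?y = (\<lambda>i\<in>{1..n}. if i \<in> insert k S then g i else \<one>\<^bsub>A\<^esub>)"
      using insert.hyps(2) g by (auto simp: mult_product_group fun_eq_iff)
    finally show ?case .
  qed
  note this[OF order_refl]
  moreover have "(\<lambda>i\<in>{1..n}. if i \<in> {1..n} then g i else \<one>\<^bsub>A\<^esub>) = (\<lambda>i\<in>{1..n}. g i)"
    by (rule restrict_ext) simp
  ultimately show ?thesis
    by (simp only: pure_tensor_def)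
qed

text \<open>Makes the determinant calculus available for minors: row \<open>j\<close> belongs to
  \<open>g j\<close> and column \<open>k\<close> to the tensor factor \<open>k\<close>.\<close>

lemma alternator_eq_leibniz_det:
  assumes g: "\<And>k. k \<in> {1..n} \<Longrightarrow> g k \<in> carrier A"
  shows "alternator K A n g = leibniz_det TP {1..n} (\<lambda>j k. factor_emb k (g j))"
  unfolding alternator_def leibniz_det_def
proof (rule TP.finsum_cong'[OF refl])
  show "(\<lambda>\<sigma>. [sign \<sigma>] \<cdot>\<^bsub>TP\<^esub> (\<Otimes>\<^bsub>TP\<^esub>k\<in>{1..n}. factor_emb k (g (\<sigma> k)))) \<in> {\<sigma>. \<sigma> permutes {1..n}} \<rightarrow> carrier TP"
    using g by (intro Pi_I TP.add.int_pow_closed TP.finprod_closed factor_emb_closed)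
      (simp only: mem_Collect_eq permutes_in_image)
  show "[sign \<sigma>] \<cdot>\<^bsub>TP\<^esub> pure_tensor K A n (\<lambda>k. g (\<sigma> k)) =
      [sign \<sigma>] \<cdot>\<^bsub>TP\<^esub> (\<Otimes>\<^bsub>TP\<^esub>k\<in>{1..n}. factor_emb k (g (\<sigma> k)))" if "\<sigma> \<in> {\<sigma>. \<sigma> permutes {1..n}}" for \<sigma>
    using that g by (subst pure_tensor_eq_prod) (simp_all only: mem_Collect_eq permutes_in_image)
qed

text \<open>Since \<open>k \<noteq> l\<close>, at every position one of the two entries is the unit,
  whose bracket with anything vanishes; so every summand of the bracket has a zero
  component.\<close>

lemma factor_emb_commute:
  assumes a: "a \<in> carrier A" and b: "b \<in> carrier A" and kl: "k \<in> {1..n}" "k \<noteq> l"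
  shows "\<lbrace>factor_emb k a, factor_emb l b\<rbrace>\<^bsub>TP\<^esub> = \<zero>\<^bsub>TP\<^esub>"
proof -
  let ?x = "\<lambda>i\<in>{1..n}. if i = k then a else \<one>\<^bsub>A\<^esub>" and ?y = "\<lambda>i\<in>{1..n}. if i = l then b else \<one>\<^bsub>A\<^esub>"
  have x: "?x \<in> carrier M" using a by (intro tuple_closed) simp
  have y: "?y \<in> carrier M" using b by (intro tuple_closed) simp
  have "\<lbrace>factor_emb k a, factor_emb l b\<rbrace>\<^bsub>TP\<^esub> = q (B (mon \<one>\<^bsub>K\<^esub> ?x) (mon \<one>\<^bsub>K\<^esub> ?y))"
    unfolding factor_emb_def single_eq_monom_elem
    by (rule pbracket_q) (use x y in \<open>auto intro: fp.mon_closed\<close>)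
  also have "\<dots> = (\<Oplus>\<^bsub>TP\<^esub>m\<in>{1..n}. q (mon (\<one>\<^bsub>K\<^esub> \<otimes>\<^bsub>K\<^esub> \<one>\<^bsub>K\<^esub>) (bracket_at m ?x ?y)))"
    by (rule q_bracket_mon[OF K.one_closed x K.one_closed y])
  also have "\<dots> = (\<Oplus>\<^bsub>TP\<^esub>m\<in>{1..n}. \<zero>\<^bsub>TP\<^esub>)"
  proof (rule TP.finsum_cong'[OF refl])
    fix m assume m: "m \<in> {1..n}"
    have "\<lbrace>?x m, ?y m\<rbrace>\<^bsub>A\<^esub> = \<zero>\<^bsub>A\<^esub>"
      using m kl a b alternating_biderivation.br_one_l[OF bracket_biderivation]
        alternating_biderivation.br_one_r[OF bracket_biderivation] by auto
    then have "bracket_at m ?x ?y m = \<zero>\<^bsub>A\<^esub>"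
      by (simp only: bracket_at_eq_upd[OF m] fun_upd_same)
    then show "q (mon (\<one>\<^bsub>K\<^esub> \<otimes>\<^bsub>K\<^esub> \<one>\<^bsub>K\<^esub>) (bracket_at m ?x ?y)) = \<zero>\<^bsub>TP\<^esub>"
      using x y m by (intro q_mon_zero[OF _ _ m] bracket_at_closed) simp_all
  qed simp
  finally show ?thesis by simp
qed

lemma alternator_nonzero:
  assumes ind: "lin_indep_family K A {1..n} g"
  shows "alternator K A n g \<noteq> \<zero>\<^bsub>TP\<^esub>"
proof
  assume zero: "alternator K A n g = \<zero>\<^bsub>TP\<^esub>"
  let ?P = "{\<sigma>. \<sigma> permutes {1..n}}"
  have g: "g k \<in> carrier A" if "k \<in> {1..n}" for k
    using ind that by (auto simp: lin_indep_family_def)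
  \<comment> \<open>Bundles the properties of a dual functional, so that the functionals for all
    \<open>i\<close> can be chosen at once.\<close>
  define Q where "Q i \<phi> \<longleftrightarrow> \<phi> \<in> carrier A \<rightarrow> carrier K \<and>
    (\<forall>a\<in>carrier A. \<forall>b\<in>carrier A. \<phi> (a \<oplus>\<^bsub>A\<^esub> b) = \<phi> a \<oplus>\<^bsub>K\<^esub> \<phi> b) \<and>
    (\<forall>r\<in>carrier K. \<forall>a\<in>carrier A. \<phi> (r \<odot>\<^bsub>A\<^esub> a) = r \<otimes>\<^bsub>K\<^esub> \<phi> a) \<and>
    (\<forall>j\<in>{1..n}. \<phi> (g j) = (if j = i then \<one>\<^bsub>K\<^esub> else \<zero>\<^bsub>K\<^esub>))" for i and \<phi> :: "'a \<Rightarrow> 'k"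
  have "\<forall>i\<in>{1..n}. \<exists>\<phi>. Q i \<phi>"
  proof
    fix i assume i: "i \<in> {1..n}"
    show "\<exists>\<phi>. Q i \<phi>"
      unfolding Q_def
      by (rule module.dual_functional[OF module_A K.field_axioms finite_atLeastAtMost ind i]) blast
  qed
  from bchoice[OF this] obtain \<phi> where Q: "\<forall>i\<in>{1..n}. Q i (\<phi> i)" by (rule exE)
  have \<phi>: "\<phi> \<in> {1..n} \<rightarrow> carrier A \<rightarrow> carrier K"
    using Q unfolding Q_def by blast
  have \<phi>_add: "\<phi> i (a \<oplus>\<^bsub>A\<^esub> b) = \<phi> i a \<oplus>\<^bsub>K\<^esub> \<phi> i b" if "i \<in> {1..n}" "a \<in> carrier A" "b \<in> carrier A" for i a b
    using Q that unfolding Q_def by blast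
  have \<phi>_smult: "\<phi> i (r \<odot>\<^bsub>A\<^esub> a) = r \<otimes>\<^bsub>K\<^esub> \<phi> i a" if "i \<in> {1..n}" "r \<in> carrier K" "a \<in> carrier A" for i r a
    using Q that unfolding Q_def by blast
  have \<phi>_g: "\<phi> i (g j) = (if j = i then \<one>\<^bsub>K\<^esub> else \<zero>\<^bsub>K\<^esub>)" if "i \<in> {1..n}" "j \<in> {1..n}" for i j
    using Q that unfolding Q_def by blast
  let ?x = "\<lambda>\<sigma>. \<lambda>i\<in>{1..n}. g (\<sigma> i)"
  have x: "?x \<sigma> \<in> carrier M" if "\<sigma> \<in> ?P" for \<sigma>
    using that g by (intro tuple_closed) (simp only: mem_Collect_eq permutes_in_image)
  \<comment> \<open>A representative of the alternator in the free module, on which the functional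
    can be evaluated.\<close>
  define c where "c = (\<Oplus>\<^bsub>F\<^esub>\<sigma>\<in>?P. [sign \<sigma>] \<cdot>\<^bsub>F\<^esub> single K (?x \<sigma>))"
  have fin: "finite ?P" by (rule finite_permutations[OF finite_atLeastAtMost])
  have terms: "(\<lambda>\<sigma>. [sign \<sigma>] \<cdot>\<^bsub>F\<^esub> single K (?x \<sigma>)) \<in> ?P \<rightarrow> carrier F"
    by (intro Pi_I fp.F.add.int_pow_closed single_closed x)
  have "alternator K A n g = (\<Oplus>\<^bsub>TP\<^esub>\<sigma>\<in>?P. q ([sign \<sigma>] \<cdot>\<^bsub>F\<^esub> single K (?x \<sigma>)))"
    unfolding alternator_def pure_tensor_def
  proof (rule TP.finsum_cong'[OF refl])
    show "(\<lambda>\<sigma>. q ([sign \<sigma>] \<cdot>\<^bsub>F\<^esub> single K (?x \<sigma>))) \<in> ?P \<rightarrow> carrier TP"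
      using terms by (simp add: Pi_iff q_closed)
    show "[sign \<sigma>] \<cdot>\<^bsub>TP\<^esub> q (single K (?x \<sigma>)) = q ([sign \<sigma>] \<cdot>\<^bsub>F\<^esub> single K (?x \<sigma>))" if "\<sigma> \<in> ?P" for \<sigma>
      by (rule add_hom_sign[OF F_group TP_group q_hom single_closed[OF x[OF that]], symmetric])
  qed
  also have "\<dots> = q c"
    unfolding c_def by (rule q_finsum[OF fin terms, symmetric])
  finally have "c \<in> I"
    using zero q_zero_iff[of c] fp.F.finsum_closed[OF terms] by (simp add: c_def)
  then have "tensor_functional \<phi> c = \<zero>\<^bsub>K\<^esub>"
    by (intro tensor_functional_vanish[OF \<phi> \<phi>_add \<phi>_smult])
  moreover have "tensor_functional \<phi> c = \<one>\<^bsub>K\<^esub>"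
  proof -
    note hom = tensor_functional_hom[OF \<phi>]
    have "tensor_functional \<phi> c = (\<Oplus>\<^bsub>K\<^esub>\<sigma>\<in>?P. tensor_functional \<phi> ([sign \<sigma>] \<cdot>\<^bsub>F\<^esub> single K (?x \<sigma>)))"
      unfolding c_def by (rule add_hom_finsum[OF F_group K.abelian_group_axioms hom fin terms])
    also have "\<dots> = (\<Oplus>\<^bsub>K\<^esub>\<sigma>\<in>?P. if id = \<sigma> then \<one>\<^bsub>K\<^esub> else \<zero>\<^bsub>K\<^esub>)"
    proof (rule K.finsum_cong'[OF refl])
      fix \<sigma> assume "\<sigma> \<in> ?P"
      then have \<sigma>: "\<sigma> permutes {1..n}" by simp
      have mem: "\<sigma> k \<in> {1..n}" if "k \<in> {1..n}" for k
        using \<sigma> that by (simp only: permutes_in_image)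
      have "tensor_functional \<phi> (single K (?x \<sigma>)) = (\<Otimes>\<^bsub>K\<^esub>k\<in>{1..n}. \<phi> k (?x \<sigma> k))"
        unfolding single_eq_monom_elem using tensor_functional_mon[OF \<phi> K.one_closed x[OF \<open>\<sigma> \<in> ?P\<close>]]
          \<phi> comp_closed[OF x[OF \<open>\<sigma> \<in> ?P\<close>]]
        by (subst K.l_one[symmetric]) (auto intro!: K.finprod_closed simp: Pi_iff simp del: restrict_apply)
      \<comment> \<open>By duality the factor \<open>k\<close> is one if \<open>\<sigma>\<close>
        fixes \<open>k\<close> and zero otherwise, so only the identity survives, with sign
        one.\<close>
      also have "\<dots> = (\<Otimes>\<^bsub>K\<^esub>k\<in>{1..n}. if \<sigma> k = k then \<one>\<^bsub>K\<^esub> else \<zero>\<^bsub>K\<^esub>)"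
        by (rule K.finprod_cong') (simp_all add: \<phi>_g mem del: atLeastAtMost_iff)
      also have "\<dots> = (if id = \<sigma> then \<one>\<^bsub>K\<^esub> else \<zero>\<^bsub>K\<^esub>)"
      proof (cases "id = \<sigma>")
        case False
        then obtain k where "\<sigma> k \<noteq> k" by (metis eq_id_iff)
        moreover from this have "k \<in> {1..n}" using \<sigma> by (meson permutes_not_in)
        ultimately show ?thesis
          using False by (subst K.finprod_zero[where i=k]) auto
      qed auto
      finally show "tensor_functional \<phi> ([sign \<sigma>] \<cdot>\<^bsub>F\<^esub> single K (?x \<sigma>)) = (if id = \<sigma> then \<one>\<^bsub>K\<^esub> else \<zero>\<^bsub>K\<^esub>)"
        by (auto simp: add_hom_sign[OF F_group K.abelian_group_axioms hom single_closed[OF x[OF \<open>\<sigma> \<in> ?P\<close>]]]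
            K.sign_add_pow)
    qed simp
    also have "\<dots> = \<one>\<^bsub>K\<^esub>"
      using K.add.finprod_singleton[of id ?P "\<lambda>_. \<one>\<^bsub>K\<^esub>"] fin permutes_id by auto
    finally show ?thesis .
  qed
  ultimately show False by simp
qed

end

section \<open>Poisson commutativity\<close>

locale alternating_biderivation_domain = alternating_biderivation R br + domain R
  for R (structure) and br
begin

text \<open>\<open>br_num_rescale\<close> acts on the first pair, and \<open>br_num_swap\<close>
  brings the second pair to the front. Each time the square of a nonzero denominator is cancelled in
  the domain.\<close>

lemma br_num_zero_cong:
  assumes cl: "a \<in> carrier R" "b \<in> carrier R" "a' \<in> carrier R" "b' \<in> carrier R"
      "c \<in> carrier R" "d \<in> carrier R" "c' \<in> carrier R" "d' \<in> carrier R"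
    and nz: "b' \<noteq> \<zero>" "d' \<noteq> \<zero>"
    and eq: "a \<otimes> b' = a' \<otimes> b" "c \<otimes> d' = c' \<otimes> d"
    and zero: "br_num a' b' c' d' = \<zero>"
  shows "br_num a b c d = \<zero>"
proof -
  have cancel: "x = \<zero>" if "x \<in> carrier R" "s \<in> carrier R" "s \<noteq> \<zero>" "(s \<otimes> s) \<otimes> x = \<zero>" for x s
    using that by (simp add: integral_iff)
  have "(d' \<otimes> d') \<otimes> br_num c d a' b' = (d \<otimes> d) \<otimes> br_num c' d' a' b'"
    by (rule br_num_rescale[OF cl(5-8,3,4) eq(2)])
  also have "br_num c' d' a' b' = \<zero>"
    using br_num_swap[of c' d' a' b'] cl zero by simp
  finally have "(d' \<otimes> d') \<otimes> br_num c d a' b' = \<zero>"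
    using cl by simp
  then have "br_num c d a' b' = \<zero>"
    by (rule cancel[of _ d', rotated 3]) (use cl nz in auto)
  then have "br_num a' b' c d = \<zero>"
    using br_num_swap[of a' b' c d] cl by simp
  then have "(b' \<otimes> b') \<otimes> br_num a b c d = \<zero>"
    using br_num_rescale[OF cl(1-6) eq(1)] cl by simp
  then show ?thesis
    by (rule cancel[of _ b', rotated 3]) (use cl nz in auto)
qed

end

text \<open>All fractions with numerator zero are literally the same set, so a nonempty union of
  them is again the zero of the fraction field.\<close>

lemma (in domain) fraction_zero:
  assumes "b \<in> carrier R" "b \<noteq> \<zero>"
  shows "fraction R \<zero> b = {\<zero>} \<times> (carrier R - {\<zero>})"
proof -
  have "\<zero> = c \<otimes> b \<longleftrightarrow> c = \<zero>" if "c \<in> carrier R" for c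
    using integral_iff[OF that assms(1)] assms(2) by metis
  then show ?thesis using assms by (auto simp: fraction_def)
qed

lemma lin_indep_family_subset:
  assumes ind: "lin_indep_family K A I f" and JI: "J \<subseteq> I"
  shows "lin_indep_family K A J f"
proof -
  have f: "f \<in> I \<rightarrow> carrier A" and
    c: "\<And>L c. finite L \<and> L \<subseteq> I \<and> c \<in> L \<rightarrow> carrier K \<and> (\<Oplus>\<^bsub>A\<^esub>i\<in>L. c i \<odot>\<^bsub>A\<^esub> f i) = \<zero>\<^bsub>A\<^esub> \<Longrightarrow> \<forall>i\<in>L. c i = \<zero>\<^bsub>K\<^esub>"
    using ind by (simp_all add: lin_indep_family_def)
  show ?thesis
    unfolding lin_indep_family_def
  proof (intro conjI allI impI)
    show "f \<in> J \<rightarrow> carrier A" using f JI by (simp add: Pi_iff subset_iff)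
    show "\<forall>i\<in>L. c i = \<zero>\<^bsub>K\<^esub>"
      if "finite L \<and> L \<subseteq> J \<and> c \<in> L \<rightarrow> carrier K \<and> (\<Oplus>\<^bsub>A\<^esub>i\<in>L. c i \<odot>\<^bsub>A\<^esub> f i) = \<zero>\<^bsub>A\<^esub>" for L c
      using that JI by (intro c) (simp add: subset_iff)
  qed
qed

text \<open>In Cramer's rule \<open>f 0\<close> stands in place \<open>i\<close>, whereas in the
  minor it stands first and \<open>f 1, ..., f (i - 1)\<close> are shifted by one. This cycle of
  length \<open>i\<close> translates between the two orders; its sign is
  \<open>(-1)^(i - 1)\<close>.\<close>

definition cycle_to_front :: "nat \<Rightarrow> nat \<Rightarrow> nat"
  where "cycle_to_front i j = (if j = 1 then i else if j \<le> i then j - 1 else j)"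

lemma cycle_to_front_permutes:
  assumes "i \<in> {1..n}"
  shows "cycle_to_front i permutes {1..n}"
proof (rule inj_imp_permutes)
  show "inj_on (cycle_to_front i) {1..n}"
    using assms by (auto simp: inj_on_def cycle_to_front_def split: if_splits)
  show "cycle_to_front i x \<in> {1..n}" if "x \<in> {1..n}" for x
    using assms that by (auto simp: cycle_to_front_def)
  show "cycle_to_front i x = x" if "x \<notin> {1..n}" for x
    using assms that by (auto simp: cycle_to_front_def)
qed simp

lemma omit_eq_cycle:
  assumes "i \<in> {1..n}" "j \<in> {1..n}"
  shows "omit i f j = (f(i := f 0)) (cycle_to_front i j)"
  using assms by (auto simp: omit_def cycle_to_front_def)

section \<open>The minors and their quotients\<close>

context poisson_tensor_domain
begin

context
  fixes f :: "nat \<Rightarrow> 'a"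
  assumes ind: "lin_indep_family K A {0..n} f"
begin

abbreviation u where "u \<equiv> \<lambda>j k. factor_emb k (f j)"
abbreviation \<Delta> where "\<Delta> \<equiv> Delta_class K A n f"

text \<open>By Cramer's rule these are the coefficients of a linear relation among the columns \<open>u 0, \<dots>, u n\<close>;
  up to sign, \<open>\<Delta> i\<close> is the determinant with \<open>f i\<close> replaced by \<open>f 0\<close>.\<close>

definition cramer_coeff :: "nat \<Rightarrow> ((nat \<Rightarrow> 'a) \<Rightarrow> 'k) set"
  where "cramer_coeff i = (if i = 0 then leibniz_det TP {1..n} u else \<ominus>\<^bsub>TP\<^esub> leibniz_det TP {1..n} (u(i := u 0)))"

lemma f_closed: "i \<in> {0..n} \<Longrightarrow> f i \<in> carrier A"
  using ind by (auto simp: lin_indep_family_def)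

lemma u_closed: "i \<in> {0..n} \<Longrightarrow> u i k \<in> carrier TP"
  by (intro factor_emb_closed f_closed)

lemma u_upd_closed: "i \<in> {1..n} \<Longrightarrow> j \<in> {1..n} \<Longrightarrow> (u(i := u 0)) j k \<in> carrier TP"
  using u_closed[of j k] u_closed[of 0 k] by simp

lemma cramer_coeff_closed: "i \<in> {0..n} \<Longrightarrow> cramer_coeff i \<in> carrier TP"
  unfolding cramer_coeff_def using u_closed u_upd_closed
  by (auto intro!: TP.leibniz_det_closed simp del: fun_upd_apply)

lemma Delta_0: "\<Delta> 0 = cramer_coeff 0"
proof -
  have "\<Delta> 0 = leibniz_det TP {1..n} (\<lambda>j k. factor_emb k (omit 0 f j))"
    unfolding Delta_class_def
    by (rule alternator_eq_leibniz_det) (use f_closed in \<open>auto simp: omit_def\<close>)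
  also have "\<dots> = leibniz_det TP {1..n} u"
    by (rule TP.leibniz_det_cong) (use u_closed in \<open>auto simp: omit_def\<close>)
  finally show ?thesis by (simp add: cramer_coeff_def)
qed

lemma Delta_0_nonzero: "\<Delta> 0 \<noteq> \<zero>\<^bsub>TP\<^esub>"
proof -
  have "lin_indep_family K A {1..n} f"
    using ind by (rule lin_indep_family_subset) auto
  then have "alternator K A n f \<noteq> \<zero>\<^bsub>TP\<^esub>" by (rule alternator_nonzero)
  moreover have "alternator K A n f = leibniz_det TP {1..n} u"
    by (rule alternator_eq_leibniz_det) (use f_closed in auto)
  ultimately show ?thesis by (simp add: Delta_0 cramer_coeff_def)
qed

text \<open>The minor and the Cramer determinant have the same rows up to a cycle. The sign is left
  open because the vanishing of a bracket of quotients does not depend on it.\<close>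

lemma Delta_eq_E:
  assumes i: "i \<in> {1..n}"
  shows "\<Delta> i = cramer_coeff i \<or> \<Delta> i = \<ominus>\<^bsub>TP\<^esub> cramer_coeff i"
proof -
  let ?p = "cycle_to_front i" and ?M = "u(i := u 0)"
  have p: "?p permutes {1..n}" using i by (rule cycle_to_front_permutes)
  have pj: "?p j \<in> {1..n}" if "j \<in> {1..n}" for j using p that by (simp only: permutes_in_image)
  have om: "omit i f j \<in> carrier A" if "j \<in> {1..n}" for j
    using f_closed[of "?p j"] f_closed[of 0] pj[OF that] by (simp add: omit_eq_cycle[OF i that])
  have "\<Delta> i = leibniz_det TP {1..n} (\<lambda>j k. factor_emb k (omit i f j))"
    unfolding Delta_class_def by (rule alternator_eq_leibniz_det[OF om])
  also have "\<dots> = leibniz_det TP {1..n} (\<lambda>j. ?M (?p j))"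
    by (rule TP.leibniz_det_cong) (use om in \<open>auto simp: omit_eq_cycle[OF i]\<close>)
  also have "\<dots> = [sign ?p] \<cdot>\<^bsub>TP\<^esub> leibniz_det TP {1..n} ?M"
    by (rule TP.leibniz_det_permute[OF finite_atLeastAtMost u_upd_closed[OF i] p])
  finally show ?thesis
    using i TP.leibniz_det_closed[of "{1..n}" ?M, OF u_upd_closed[OF i]]
    by (auto simp: cramer_coeff_def TP.sign_add_pow)
qed

text \<open>Cramer's rule with right-hand side \<open>u 0\<close>: the solution has numerators
  \<open>?D i\<close> and denominator \<open>cramer_coeff 0\<close>. The minus sign in
  \<open>cramer_coeff\<close> brings both sides into one sum.\<close>

lemma cramer_coeff_rel:
  assumes k: "k \<in> {1..n}"
  shows "(\<Oplus>\<^bsub>TP\<^esub>i\<in>insert 0 {1..n}. cramer_coeff i \<otimes>\<^bsub>TP\<^esub> u i k) = \<zero>\<^bsub>TP\<^esub>"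
proof -
  let ?D = "\<lambda>i. leibniz_det TP {1..n} (u(i := u 0))"
  have D: "?D i \<in> carrier TP" if "i \<in> {1..n}" for i
    using u_upd_closed[OF that] by (rule TP.leibniz_det_closed)
  have Du: "(\<lambda>i. ?D i \<otimes>\<^bsub>TP\<^esub> u i k) \<in> {1..n} \<rightarrow> carrier TP"
    using D u_closed by (simp add: Pi_iff del: fun_upd_apply)
  have "(\<Oplus>\<^bsub>TP\<^esub>i\<in>insert 0 {1..n}. cramer_coeff i \<otimes>\<^bsub>TP\<^esub> u i k) =
      cramer_coeff 0 \<otimes>\<^bsub>TP\<^esub> u 0 k \<oplus>\<^bsub>TP\<^esub> (\<Oplus>\<^bsub>TP\<^esub>i\<in>{1..n}. cramer_coeff i \<otimes>\<^bsub>TP\<^esub> u i k)"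
    by (rule TP.finsum_insert) (use cramer_coeff_closed u_closed in auto)
  also have "(\<Oplus>\<^bsub>TP\<^esub>i\<in>{1..n}. cramer_coeff i \<otimes>\<^bsub>TP\<^esub> u i k) = (\<Oplus>\<^bsub>TP\<^esub>i\<in>{1..n}. \<ominus>\<^bsub>TP\<^esub> (?D i \<otimes>\<^bsub>TP\<^esub> u i k))"
    by (rule TP.finsum_cong'[OF refl]) (use D u_closed Du in \<open>auto simp: cramer_coeff_def TP.l_minus simp del: fun_upd_apply\<close>)
  also have "\<dots> = \<ominus>\<^bsub>TP\<^esub> (\<Oplus>\<^bsub>TP\<^esub>i\<in>{1..n}. ?D i \<otimes>\<^bsub>TP\<^esub> u i k)"
    by (rule TP.finsum_minus[OF finite_atLeastAtMost Du])
  also have "(\<Oplus>\<^bsub>TP\<^esub>i\<in>{1..n}. ?D i \<otimes>\<^bsub>TP\<^esub> u i k) = leibniz_det TP {1..n} u \<otimes>\<^bsub>TP\<^esub> u 0 k"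
    by (rule TP.cramer[OF finite_atLeastAtMost _ _ k]) (use u_closed in auto)
  finally show ?thesis
    using cramer_coeff_closed[of 0] u_closed[of 0 k] by (simp add: cramer_coeff_def TP.r_neg)
qed

text \<open>The index 0 is the distinguished \<open>z\<close>, and \<open>{1..n}\<close> serves both
  for the tensor factors and for the remaining functions; the determinant is then
  \<open>\<Delta> 0\<close>.\<close>

lemma cramer_coeff_separated: "separated_variables_domain TP (pbracket TP) 0 {1..n} cramer_coeff u"
proof
  show "cramer_coeff i \<in> carrier TP" if "i \<in> insert 0 {1..n}" for i
    using cramer_coeff_closed[of i] that by auto
  show "u i k \<in> carrier TP" if "i \<in> insert 0 {1..n}" "k \<in> {1..n}" for i k
    using u_closed[of i k] that by auto
  show "(\<Oplus>\<^bsub>TP\<^esub>i\<in>insert 0 {1..n}. cramer_coeff i \<otimes>\<^bsub>TP\<^esub> u i k) = \<zero>\<^bsub>TP\<^esub>" if "k \<in> {1..n}" for k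
    using that by (rule cramer_coeff_rel)
  show "\<lbrace>u i k, u j l\<rbrace>\<^bsub>TP\<^esub> = \<zero>\<^bsub>TP\<^esub>"
    if "i \<in> insert 0 {1..n}" "j \<in> insert 0 {1..n}" "k \<in> {1..n}" "l \<in> {1..n}" "k \<noteq> l" for i j k l
    using that f_closed by (intro factor_emb_commute) auto
  show "leibniz_det TP {1..n} u \<noteq> \<zero>\<^bsub>TP\<^esub>"
    using Delta_0_nonzero by (simp add: Delta_0 cramer_coeff_def)
qed auto

lemma Delta_closed: "i \<in> {0..n} \<Longrightarrow> \<Delta> i \<in> carrier TP"
  using Delta_0 Delta_eq_E[of i] cramer_coeff_closed[of i] by (cases "i = 0") auto

text \<open>\<open>br_num_minus\<close> acts on the first pair, so each Cramer coefficient is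
  replaced by its minor while it stands in front. With one exchange in between, the chain has to
  start from the order \<open>j\<close>, \<open>i\<close>.\<close>

lemma Delta_br_num:
  assumes i: "i \<in> {1..n}" and j: "j \<in> {1..n}"
  shows "TP.br_num (\<Delta> i) (\<Delta> 0) (\<Delta> j) (\<Delta> 0) = \<zero>\<^bsub>TP\<^esub>"
proof -
  have cl: "cramer_coeff i \<in> carrier TP" "cramer_coeff j \<in> carrier TP" "cramer_coeff 0 \<in> carrier TP" "\<Delta> j \<in> carrier TP"
    using i j cramer_coeff_closed Delta_closed by auto
  have flip: "TP.br_num X (cramer_coeff 0) Y (cramer_coeff 0) = \<zero>\<^bsub>TP\<^esub>"
    if "TP.br_num X' (cramer_coeff 0) Y (cramer_coeff 0) = \<zero>\<^bsub>TP\<^esub>" "X = X' \<or> X = \<ominus>\<^bsub>TP\<^esub> X'" "X' \<in> carrier TP" "Y \<in> carrier TP" for X X' Y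
    using that cl TP.br_num_minus[of X' "cramer_coeff 0" Y] by auto
  have "TP.br_num (cramer_coeff j) (cramer_coeff 0) (cramer_coeff i) (cramer_coeff 0) = \<zero>\<^bsub>TP\<^esub>"
    by (rule separated_variables_domain.br_num_zero[OF cramer_coeff_separated j i])
  then have "TP.br_num (\<Delta> j) (cramer_coeff 0) (cramer_coeff i) (cramer_coeff 0) = \<zero>\<^bsub>TP\<^esub>"
    by (rule flip[OF _ Delta_eq_E[OF j]]) (use cl in auto)
  then have "TP.br_num (cramer_coeff i) (cramer_coeff 0) (\<Delta> j) (cramer_coeff 0) = \<zero>\<^bsub>TP\<^esub>"
    using TP.br_num_swap[of "cramer_coeff i" "cramer_coeff 0" "\<Delta> j" "cramer_coeff 0"] cl by simp
  then show ?thesis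
    unfolding Delta_0 by (rule flip[OF _ Delta_eq_E[OF i]]) (use cl in auto)
qed

text \<open>The bracket is a union over the representatives of both quotients. For the pairs
  \<open>(\<Delta> i, \<Delta> 0)\<close> and \<open>(\<Delta> j, \<Delta> 0)\<close> the numerator
  vanishes, and \<open>br_num_zero_cong\<close> carries this to all others, so every member of the
  union is the zero class.\<close>

lemma H_class_commute:
  assumes i: "i \<in> {1..n}" and j: "j \<in> {1..n}"
  shows "\<lbrace>H_class K A n f i, H_class K A n f j\<rbrace>\<^bsub>fraction_field TP\<^esub> = \<zero>\<^bsub>fraction_field TP\<^esub>"
proof -
  interpret dom: alternating_biderivation_domain TP "pbracket TP" ..
  let ?Z = "{\<zero>\<^bsub>TP\<^esub>} \<times> (carrier TP - {\<zero>\<^bsub>TP\<^esub>})"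
  have cl: "\<Delta> i \<in> carrier TP" "\<Delta> j \<in> carrier TP" "\<Delta> 0 \<in> carrier TP"
    using i j Delta_closed by auto
  have summand: "fraction TP (TP.br_num a b c d) ((b \<otimes>\<^bsub>TP\<^esub> b) \<otimes>\<^bsub>TP\<^esub> (d \<otimes>\<^bsub>TP\<^esub> d)) = ?Z"
    if ab: "(a, b) \<in> H_class K A n f i" and cd: "(c, d) \<in> H_class K A n f j" for a b c d
  proof -
    have ab': "a \<in> carrier TP" "b \<in> carrier TP" "b \<noteq> \<zero>\<^bsub>TP\<^esub>" "a \<otimes>\<^bsub>TP\<^esub> \<Delta> 0 = \<Delta> i \<otimes>\<^bsub>TP\<^esub> b"
      using ab by (auto simp: H_class_def fraction_def)
    have cd': "c \<in> carrier TP" "d \<in> carrier TP" "d \<noteq> \<zero>\<^bsub>TP\<^esub>" "c \<otimes>\<^bsub>TP\<^esub> \<Delta> 0 = \<Delta> j \<otimes>\<^bsub>TP\<^esub> d"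
      using cd by (auto simp: H_class_def fraction_def)
    have "TP.br_num a b c d = \<zero>\<^bsub>TP\<^esub>"
      by (rule dom.br_num_zero_cong[OF ab'(1,2) cl(1,3) cd'(1,2) cl(2,3) Delta_0_nonzero Delta_0_nonzero
            ab'(4) cd'(4) Delta_br_num[OF i j]])
    then show ?thesis
      using ab' cd' by (simp add: TP.fraction_zero TP.integral_iff)
  qed
  \<comment> \<open>A representative exists, so the union is not empty.\<close>
  have mem: "(\<Delta> k, \<Delta> 0) \<in> H_class K A n f k" if "k \<in> {1..n}" for k
    using Delta_closed[of k] Delta_closed[of 0] that Delta_0_nonzero by (simp add: H_class_def fraction_def)
  have "\<lbrace>H_class K A n f i, H_class K A n f j\<rbrace>\<^bsub>fraction_field TP\<^esub> =
      (\<Union>(a, b)\<in>H_class K A n f i. \<Union>(c, d)\<in>H_class K A n f j.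
        fraction TP (TP.br_num a b c d) ((b \<otimes>\<^bsub>TP\<^esub> b) \<otimes>\<^bsub>TP\<^esub> (d \<otimes>\<^bsub>TP\<^esub> d)))"
    by (simp add: fraction_field_def TP.br_num_def)
  also have "\<dots> = (\<Union>(a, b)\<in>H_class K A n f i. \<Union>(c, d)\<in>H_class K A n f j. ?Z)"
    using summand by (intro SUP_cong refl) (auto split: prod.split)
  also have "\<dots> = ?Z"
    using mem[OF i] mem[OF j] by auto
  also have "\<dots> = \<zero>\<^bsub>fraction_field TP\<^esub>"
    by (simp add: fraction_field_def TP.fraction_zero)
  finally show ?thesis .
qed

end

end

theorem theorem2p1:
  fixes K :: "('k, 'r) ring_scheme"
    and A :: "('k, 'a, 's) poisson_scheme"
    and n :: nat
    and f :: "nat \<Rightarrow> 'a"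
  assumes "poisson_algebra K A"
    and "\<one>\<^bsub>K\<^esub> \<oplus>\<^bsub>K\<^esub> \<one>\<^bsub>K\<^esub> \<noteq> \<zero>\<^bsub>K\<^esub>"
    and "n \<ge> 1"
    and "domain (tensor_power K A n)"
    and "lin_indep_family K A {0..n} f"
  shows "Delta_class K A n f 0 \<noteq> \<zero>\<^bsub>tensor_power K A n\<^esub> \<and>
    (\<forall>i\<in>{1..n}. \<forall>j\<in>{1..n}.
      \<lbrace>H_class K A n f i, H_class K A n f j\<rbrace>\<^bsub>fraction_field (tensor_power K A n)\<^esub>
        = \<zero>\<^bsub>fraction_field (tensor_power K A n)\<^esub>)"
proof -
  interpret poisson_tensor_domain K A n
    by (intro poisson_tensor_domain.intro poisson_tensor.intro poisson_tensor_domain_axioms.intro assms(1,4))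
  show ?thesis
    by (intro conjI ballI Delta_0_nonzero[OF assms(5)] H_class_commute[OF assms(5)])
qed

end
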